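(* Given a bounded open set $D\subset\mathbb R^d$, let $M^D$ and $\widetilde M^D$ be two random a.s.-finite Borel measures on $D$ and let $\Phi$ be a centered Gaussian field on $D$ independent of $M^D$ and $\widetilde M^D$ such that, for some bounded measurable functions $\mathfrak h_k\colon D\to\mathbb R$, $k\ge0$, $$\mathrm{Cov}\bigl(\Phi(x),\Phi(y)\bigr)=\sum_{k=0}^\infty\mathfrak h_k(x)\mathfrak h_k(y),\qquad\text{locally uniformly in }x,y\in D .$$ Then $$e^{\Phi(x)}M^D(\mathrm dx)\overset{\text{law}}=e^{\Phi(x)}\widetilde M^D(\mathrm dx)$$ implies $M^D\overset{\text{law}}=\widetilde M^D$.
   Context: $\overset{\text{law}}=$ denotes equality in distribution of random Borel measures on $D$. *)

theory Defs
  imports "HOL-Probability.Probability"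
begin

abbreviation borel_on :: "'a::topological_space set \<Rightarrow> 'a measure" where
  "borel_on D \<equiv> restrict_space borel D"

text \<open>
  The measurable space of all (not necessarily finite) measures on \<open>K\<close>, with the
  \<open>\<sigma>\<close>-algebra generated by the evaluations at the measurable sets of \<open>K\<close>. This is
  \<^const>\<open>subprob_algebra\<close> without the restriction on the total mass: multiplying a finite
  measure by the exponential of a Gaussian field may make its total mass infinite.
\<close>

definition measure_algebra :: "'a measure \<Rightarrow> 'a measure measure" where
  "measure_algebra K =
    (SUP A \<in> sets K. vimage_algebra {M. sets M = sets K} (\<lambda>M. emeasure M A) borel)"

lemma space_measure_algebra: "space (measure_algebra K) = {M. sets M = sets K}"
  by (auto simp: measure_algebra_def space_Sup_eq_UN)

lemma measurable_emeasure_measure_algebra: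
  assumes "A \<in> sets K"
  shows "(\<lambda>M. emeasure M A) \<in> borel_measurable (measure_algebra K)"
  unfolding measure_algebra_def
  by (rule measurable_SUP1[OF assms]) (auto intro!: measurable_vimage_algebra1)

definition random_finite_measure ::
    "'w measure \<Rightarrow> 'a::topological_space set \<Rightarrow> ('w \<Rightarrow> 'a measure) \<Rightarrow> bool" where
  "random_finite_measure P D M \<longleftrightarrow>
     M \<in> P \<rightarrow>\<^sub>M measure_algebra (borel_on D) \<and> (AE \<omega> in P. finite_measure (M \<omega>))"

text \<open>
  The completion of \<open>P\<close> makes the law meaningful for a map that is only almost surely equal to a
  measurable one. For a measurable map it changes nothing (see \<open>distr_completion\<close>), but
  the product of the exponential of a field with an almost surely finite random measure need not
  be measurable with respect to \<open>P\<close> on the null event where the measure fails to be finite.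
\<close>

definition law_on ::
    "'w measure \<Rightarrow> 'a::topological_space set \<Rightarrow> ('w \<Rightarrow> 'a measure) \<Rightarrow> 'a measure measure" where
  "law_on P D M = distr (completion P) (measure_algebra (borel_on D)) M"

definition exp_times :: "('a \<Rightarrow> 'w \<Rightarrow> real) \<Rightarrow> ('w \<Rightarrow> 'a measure) \<Rightarrow> 'w \<Rightarrow> 'a measure" where
  "exp_times \<Phi> M \<omega> = density (M \<omega>) (\<lambda>x. ennreal (exp (\<Phi> x \<omega>)))"

text \<open>The constant 0 counts as a (degenerate) centered Gaussian.\<close>

definition centered_gaussian :: "'w measure \<Rightarrow> ('w \<Rightarrow> real) \<Rightarrow> bool" where
  "centered_gaussian P X \<longleftrightarrow> X \<in> borel_measurable P \<and>
     ((AE \<omega> in P. X \<omega> = 0) \<or>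
      (\<exists>\<sigma>>0. distributed P lborel X (\<lambda>t. ennreal (normal_density 0 \<sigma> t))))"

definition centered_gaussian_field ::
    "'w measure \<Rightarrow> 'a set \<Rightarrow> ('a \<Rightarrow> 'w \<Rightarrow> real) \<Rightarrow> bool" where
  "centered_gaussian_field P D \<Phi> \<longleftrightarrow>
     (\<forall>F a. finite F \<and> F \<subseteq> D \<longrightarrow> centered_gaussian P (\<lambda>\<omega>. \<Sum>x\<in>F. a x * \<Phi> x \<omega>))"

definition covariance :: "'w measure \<Rightarrow> ('w \<Rightarrow> real) \<Rightarrow> ('w \<Rightarrow> real) \<Rightarrow> real" where
  "covariance P X Y =
     (\<integral>\<omega>. (X \<omega> - (\<integral>\<omega>'. X \<omega>' \<partial>P)) * (Y \<omega> - (\<integral>\<omega>'. Y \<omega>' \<partial>P)) \<partial>P)"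

text \<open>
  Independence of a random field and a random measure. For the product of \<open>exp \<Phi>\<close> with a random
  measure to be a random measure, the field has to be jointly measurable in \<open>(\<omega>, x)\<close>. The
  \<open>\<sigma>\<close>-algebra \<open>G\<close> carries the field as a jointly measurable object; it contains the
  \<open>\<sigma>\<close>-algebra generated by the variables \<open>\<Phi> x\<close>, \<open>x \<in> D\<close>, and one may take it equal to the
  latter if the field is jointly measurable with respect to that one. Joint measurability
  with respect to all of \<open>P\<close> together with independence of the family of the variables \<open>\<Phi> x\<close> would
  not do: it would allow to replace \<open>\<Phi> x\<close> by \<open>\<Phi> x + of_bool (x = U)\<close> and to take the Dirac
  measure at \<open>U\<close> as the measure, for a random point \<open>U\<close> without atoms that is independent of the
  original field.
\<close>

definition field_indep_measure ::
    "'w measure \<Rightarrow> 'a::topological_space set \<Rightarrow> ('a \<Rightarrow> 'w \<Rightarrow> real) \<Rightarrow> ('w \<Rightarrow> 'a measure) \<Rightarrow> bool" where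
  "field_indep_measure P D \<Phi> M \<longleftrightarrow>
     (\<exists>G. subalgebra P G \<and>
          (\<lambda>(\<omega>, x). \<Phi> x \<omega>) \<in> borel_measurable (G \<Otimes>\<^sub>M borel_on D) \<and>
          prob_space.indep_set P (sets G)
            (sets (vimage_algebra (space P) M (measure_algebra (borel_on D)))))"

definition locally_uniform_limit ::
    "'x::topological_space set \<Rightarrow> (nat \<Rightarrow> 'x \<Rightarrow> 'b::metric_space) \<Rightarrow> ('x \<Rightarrow> 'b) \<Rightarrow> bool" where
  "locally_uniform_limit S f l \<longleftrightarrow>
     (\<forall>z\<in>S. \<exists>U. open U \<and> z \<in> U \<and> uniform_limit (U \<inter> S) f l sequentially)"

end

theory Submission
  imports Defs
begin

text \<open>
  The Gaussian factor is removed one coefficient at a time. The law of a random measure is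
  determined by its Laplace functional, and by independence the functional of \<open>exp \<Phi> M\<close> only
  involves the finite-dimensional laws of \<open>\<Phi>\<close>; hence \<open>\<Phi>\<close> may be replaced by a series
  \<open>\<Sum>k. X\<^sub>k h\<^sub>k\<close> with independent standard Gaussian \<open>X\<^sub>k\<close>. If \<open>\<Phi>\<^sub>n\<close> is the part of the series with
  \<open>k \<ge> n\<close>, then \<open>\<Phi>\<^sub>n = X\<^sub>n h\<^sub>n + \<Phi>\<^sub>n\<^sub>+\<^sub>1\<close>, so for the tilted test function \<open>f exp (t h\<^sub>n)\<close> the functional of
  \<open>exp \<Phi>\<^sub>n M\<close> is, as a function of \<open>t\<close>, the convolution of a Gaussian density with the one of
  \<open>exp \<Phi>\<^sub>n\<^sub>+\<^sub>1 M\<close>. Convolution with a Gaussian is injective on bounded continuous functions, because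
  multiplying by the density turns the convolution into a moment generating function. Thus
  \<open>exp \<Phi>\<^sub>n M\<close> and \<open>exp \<Phi>\<^sub>n M'\<close> have the same law for all \<open>n\<close>, and \<open>\<Phi>\<^sub>n \<rightarrow> 0\<close> as \<open>n \<rightarrow> \<infinity>\<close>.
\<close>

section \<open>Measures on the line with exponential moments\<close>

text \<open>No moments of \<open>M\<close> are available, and the mass of
  \<open>exp \<Phi> M\<close> may be infinite. Hence only the bounded functional \<open>expn\<close>
  of an integral is averaged, and the identifications of laws rest on uniqueness for finite measures
  on the line; joint laws are reached by putting all variables but one into a weight. Injectivity of
  Gaussian convolution gives equality in \<open>t\<close> only almost everywhere. To recover
  \<open>t = 0\<close> the functional has to be continuous there, which needs a dominating function
  for the tilts \<open>exp (t h\<^sub>n)\<close>; this is where the boundedness of each single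
  \<open>h\<^sub>n\<close> enters. It does not bound the variance of the field, so the test
  functions live on sublevel sets of the variance. This class is stable under tilting, which lets
  the induction on \<open>n\<close> run for all its members at once, and the sublevel sets exhaust
  the space in the end.\<close>

definition exp_integrable :: "real measure \<Rightarrow> bool" where
  "exp_integrable \<nu> \<longleftrightarrow> sets \<nu> = sets borel \<and> (\<forall>t. (\<integral>\<^sup>+x. ennreal (exp (t * x)) \<partial>\<nu>) < \<infinity>)"

lemma exp_integrable_finite:
  assumes "exp_integrable \<nu>" shows "finite_measure \<nu>"
proof
  have "(\<integral>\<^sup>+x. ennreal (exp (0 * x)) \<partial>\<nu>) < \<infinity>"
    using assms unfolding exp_integrable_def by blast
  then show "emeasure \<nu> (space \<nu>) \<noteq> \<infinity>" by simp
qed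

lemma exp_integrableD:
  assumes "exp_integrable \<nu>"
  shows "integrable \<nu> (\<lambda>x. exp (t * x))" "integrable \<nu> (\<lambda>x. exp (\<bar>t * x\<bar>))"
proof -
  have [measurable_cong]: "sets \<nu> = sets borel" using assms by (simp add: exp_integrable_def)
  have *: "integrable \<nu> (\<lambda>x. exp (t * x))" for t
    using assms by (auto simp: exp_integrable_def integrable_iff_bounded)
  then show "integrable \<nu> (\<lambda>x. exp (t * x))" .
  have le: "exp \<bar>y\<bar> \<le> exp y + exp (- y)" for y :: real
    by (cases "y \<ge> 0") auto
  show "integrable \<nu> (\<lambda>x. exp (\<bar>t * x\<bar>))"
    by (rule Bochner_Integration.integrable_bound
          [OF Bochner_Integration.integrable_add[OF *[of t] *[of "-t"]]])
       (use le in \<open>auto simp: abs_of_pos add_pos_pos intro!: AE_I2\<close>)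
qed

text \<open>Supplies the dominating function for exchanging the exponential series with an integral,
  uniformly in the number of terms.\<close>

lemma norm_exp_partial_sum_le:
  fixes z :: "'a::{real_normed_algebra_1,real_normed_field,banach}"
  shows "norm (\<Sum>k<n. z ^ k /\<^sub>R fact k) \<le> exp (norm z)"
proof -
  have "norm (\<Sum>k<n. z ^ k /\<^sub>R fact k) \<le> (\<Sum>k<n. norm z ^ k /\<^sub>R fact k)"
    by (rule sum_norm_le) (simp add: norm_power)
  also have "\<dots> \<le> exp (norm z)"
    unfolding exp_def by (intro sum_le_suminf summable_exp_generic) auto
  finally show ?thesis .
qed

text \<open>Dominated convergence for the exponential series. The type of \<open>z\<close> is left
  general because real \<open>z\<close> gives the moment generating function and
  \<open>z = \<i> t\<close> the characteristic function, with the same moments as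
  coefficients.\<close>

lemma mgf_sums:
  fixes z :: "'a::{real_normed_algebra_1,real_normed_field,banach,second_countable_topology}"
  assumes "exp_integrable \<nu>"
  shows "(\<lambda>k. z ^ k * of_real ((LINT x|\<nu>. x ^ k) / fact k)) sums (LINT x|\<nu>. exp (z * of_real x))"
proof -
  have S[measurable_cong]: "sets \<nu> = sets borel" using assms by (simp add: exp_integrable_def)
  have ik: "integrable \<nu> (\<lambda>x. x ^ k)" for k
  proof (rule Bochner_Integration.integrable_bound)
    show "integrable \<nu> (\<lambda>x. fact k * exp (\<bar>1 * x\<bar>))"
      using exp_integrableD(2)[OF assms, of 1] by simp
    show "AE x in \<nu>. norm (x ^ k) \<le> norm (fact k * exp (\<bar>1 * x\<bar>))"
    proof (rule AE_I2)
      fix x :: real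
      \<comment> \<open>A single term of the exponential series of \<open>\<bar>x\<bar>\<close> is
        at most its sum.\<close>
      have "\<bar>x\<bar> ^ k /\<^sub>R fact k = (\<Sum>k\<in>{k}. \<bar>x\<bar> ^ k /\<^sub>R fact k)" by simp
      also have "\<dots> \<le> exp \<bar>x\<bar>"
        unfolding exp_def by (intro sum_le_suminf summable_exp_generic) auto
      finally show "norm (x ^ k) \<le> norm (fact k * exp (\<bar>1 * x\<bar>))"
        by (simp add: field_simps power_abs)
    qed
  qed simp
  have "(\<lambda>n. LINT x|\<nu>. (\<Sum>k<n. (z * of_real x) ^ k /\<^sub>R fact k)) \<longlonglongrightarrow> (LINT x|\<nu>. exp (z * of_real x))"
  proof (rule integral_dominated_convergence)
    show "integrable \<nu> (\<lambda>x. exp (\<bar>norm z * x\<bar>))" by (rule exp_integrableD[OF assms])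
    show "AE x in \<nu>. (\<lambda>n. \<Sum>k<n. (z * of_real x) ^ k /\<^sub>R fact k) \<longlonglongrightarrow> exp (z * of_real x)"
      using exp_converges[of "z * of_real _"] by (auto simp: sums_def)
    show "AE x in \<nu>. norm (\<Sum>k<n. (z * of_real x) ^ k /\<^sub>R fact k) \<le> exp (\<bar>norm z * x\<bar>)" for n
      using norm_exp_partial_sum_le[of "z * of_real _"] by (auto simp: norm_mult abs_mult)
  qed measurable
  moreover have "(LINT x|\<nu>. (\<Sum>k<n. (z * of_real x) ^ k /\<^sub>R fact k)) =
      (\<Sum>k<n. z ^ k * of_real ((LINT x|\<nu>. x ^ k) / fact k))" for n
  proof -
    have i2: "integrable \<nu> (\<lambda>x. of_real (x ^ k) :: 'a)" for k using ik by (rule integrable_of_real)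
    have eq: "(z * of_real x) ^ k /\<^sub>R fact k = (z ^ k /\<^sub>R fact k) * of_real (x ^ k)" for x k
      by (simp add: power_mult_distrib)
    show ?thesis unfolding eq
      by (subst Bochner_Integration.integral_sum)
         (auto intro!: integrable_mult_right i2 sum.cong
          simp: divide_inverse scaleR_conv_of_real integral_of_real ik
          simp del: of_real_power)
  qed
  ultimately show ?thesis by (simp add: sums_def)
qed

text \<open>If \<open>c\<close> is the first index where the coefficients differ, dividing the
  difference of the two series by \<open>t ^ c\<close> gives a power series that vanishes for
  \<open>t \<noteq> 0\<close> but tends to a nonzero constant at 0.\<close>

lemma powser_real_unique:
  fixes a b :: "nat \<Rightarrow> real"
  assumes "\<And>t. (\<lambda>k. t ^ k * a k) sums f t" "\<And>t. (\<lambda>k. t ^ k * b k) sums f t"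
  shows "a = b"
proof (rule ccontr)
  assume "a \<noteq> b"
  then obtain k where "a k \<noteq> b k" by auto
  define c where "c = (LEAST k. a k \<noteq> b k)"
  have c: "a c \<noteq> b c" unfolding c_def by (rule LeastI) fact
  have z: "a k - b k = 0" if "k < c" for k
    using not_less_Least[of k "\<lambda>k. a k \<noteq> b k"] that by (auto simp: c_def)
  have s: "(\<lambda>k. (a (k + c) - b (k + c)) * t ^ k) sums 0" if "t \<noteq> 0" for t
  proof -
    have "(\<lambda>k. (a k - b k) * t ^ k) sums 0"
      using sums_diff[OF assms(1)[of t] assms(2)[of t]] by (simp add: algebra_simps)
    then have "(\<lambda>k. (a (k + c) - b (k + c)) * t ^ (k + c)) sums 0"
      using z by (subst sums_zero_iff_shift) auto
    from sums_divide[OF this, of "t ^ c"] show ?thesis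
      using that by (simp add: power_add)
  qed
  have "((\<lambda>_. 0) \<longlongrightarrow> a (0 + c) - b (0 + c)) (at (0::real))"
    by (rule powser_limit_0_strong[of 1]) (use s in auto)
  then show False using c by (auto dest!: LIM_const_eq)
qed

text \<open>Exponential moments make the characteristic function an everywhere convergent series in
  the moments, so Levy's uniqueness theorem applies. That theorem concerns probability measures,
  hence the normalisation by the zeroth moment and the separate case of mass 0.\<close>

lemma measure_eqI_moments:
  assumes \<nu>: "exp_integrable \<nu>" and \<nu>': "exp_integrable \<nu>'"
    and eq: "\<And>k. (LINT x|\<nu>. x ^ k) = (LINT x|\<nu>'. x ^ k)"
  shows "\<nu> = \<nu>'"
proof -
  interpret F: finite_measure \<nu> by (rule exp_integrable_finite) fact
  interpret F': finite_measure \<nu>' by (rule exp_integrable_finite) fact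
  have S[measurable_cong, simp]: "sets \<nu> = sets borel" "sets \<nu>' = sets borel"
    using \<nu> \<nu>' by (simp_all add: exp_integrable_def)
  have sp[simp]: "space \<nu> = UNIV" "space \<nu>' = UNIV" using S[THEN sets_eq_imp_space_eq] by auto
  define m where "m = measure \<nu> UNIV"
  have m': "measure \<nu>' UNIV = m"
    using eq[of 0] by (simp add: m_def)
  have e: "emeasure \<nu> UNIV = ennreal m" "emeasure \<nu>' UNIV = ennreal m"
    by (simp_all add: m_def F.emeasure_eq_measure F'.emeasure_eq_measure m'[unfolded m_def])
  have m0: "0 \<le> m" by (simp add: m_def)
  show ?thesis
  proof (cases "m = 0")
    case True
    show ?thesis
    proof (rule measure_eqI)
      fix A assume "A \<in> sets \<nu>"
      have "emeasure \<nu> A \<le> emeasure \<nu> UNIV" "emeasure \<nu>' A \<le> emeasure \<nu>' UNIV" by (auto intro!: emeasure_mono)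
      then show "emeasure \<nu> A = emeasure \<nu>' A" using True e by simp
    qed simp
  next
    case False
    with m0 have mp: "m > 0" by simp
    define n where "n \<mu> = density \<mu> (\<lambda>_. ennreal (1/m))" for \<mu> :: "real measure"
    have rd: "real_distribution (n \<nu>)" "real_distribution (n \<nu>')"
      using mp by (auto intro!: real_distribution.intro prob_spaceI simp: n_def real_distribution_axioms_def emeasure_density_const e simp flip: ennreal_mult)
    have ch: "(LINT x|\<nu>. iexp (t * x)) = (LINT x|\<nu>'. iexp (t * x))" for t
      using mgf_sums[OF \<nu>, of "\<i> * of_real t"] mgf_sums[OF \<nu>', of "\<i> * of_real t"]
      by (simp add: eq sums_unique2 mult.assoc)
    have "char (n \<nu>) = char (n \<nu>')"
    proof
      fix t
      have *: "char (n \<mu>) t = (1/m) *\<^sub>R (LINT x|\<mu>. iexp (t * x))" if [measurable_cong]: "sets \<mu> = sets borel" for \<mu>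
        unfolding char_def n_def using mp
        by (subst integral_density) auto
      show "char (n \<nu>) t = char (n \<nu>') t" using * ch by simp
    qed
    then have nn: "n \<nu> = n \<nu>'" by (rule Levy_uniqueness[OF rd])
    show ?thesis
    proof (rule measure_eqI)
      fix A assume "A \<in> sets \<nu>"
      have "emeasure (n \<nu>) A = emeasure (n \<nu>') A" using nn by simp
      then have "ennreal m * (ennreal (1/m) * emeasure \<nu> A) = ennreal m * (ennreal (1/m) * emeasure \<nu>' A)"
        using \<open>A \<in> sets \<nu>\<close> by (simp add: n_def emeasure_density_const)
      then show "emeasure \<nu> A = emeasure \<nu>' A" using mp
        by (simp add: mult.assoc[symmetric] flip: ennreal_mult)
    qed simp
  qed
qed

text \<open>The moments are recovered as the power series coefficients of the moment generating
  function on the real line.\<close>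

lemma measure_eqI_mgf:
  assumes "sets \<nu> = sets borel" "sets \<nu>' = sets borel"
    and fin: "\<And>t. (\<integral>\<^sup>+x. ennreal (exp (t * x)) \<partial>\<nu>) < \<infinity>"
    and eq: "\<And>t. (\<integral>\<^sup>+x. ennreal (exp (t * x)) \<partial>\<nu>) = (\<integral>\<^sup>+x. ennreal (exp (t * x)) \<partial>\<nu>')"
  shows "\<nu> = \<nu>'"
proof -
  have \<nu>: "exp_integrable \<nu>" "exp_integrable \<nu>'"
    using assms by (auto simp: exp_integrable_def)
  have eq': "(LINT x|\<nu>. exp (t * x)) = (LINT x|\<nu>'. exp (t * x))" for t
    using assms by (simp add: integral_eq_nn_integral)
  have "(\<lambda>k. (LINT x|\<nu>. x ^ k) / fact k) = (\<lambda>k. (LINT x|\<nu>'. x ^ k) / fact k)"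
    using mgf_sums[OF \<nu>(1), where 'a=real] mgf_sums[OF \<nu>(2), where 'a=real]
    by (intro powser_real_unique[where f="\<lambda>t. LINT x|\<nu>. exp (t * x)"]) (auto simp: eq')
  then have "(LINT x|\<nu>. x ^ k) / fact k = (LINT x|\<nu>'. x ^ k) / fact k" for k by metis
  then show ?thesis
    by (intro measure_eqI_moments[OF \<nu>]) (simp add: field_simps)
qed

section \<open>Laplace functionals and laws of random measures\<close>

text \<open>Extends \<open>exp (- z)\<close> continuously to infinity. The value there is set by
  hand because \<open>enn2real \<top> = 0\<close> would produce 1.\<close>

definition expn :: "ennreal \<Rightarrow> ennreal" where
  "expn z = (if z = \<top> then 0 else ennreal (exp (- enn2real z)))"

lemma expn_top[simp]: "expn \<top> = 0" and expn_0[simp]: "expn 0 = 1"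
  by (simp_all add: expn_def)

lemma expn_ennreal: "0 \<le> x \<Longrightarrow> expn (ennreal x) = ennreal (exp (- x))"
  by (simp add: expn_def)

lemma expn_le_1[simp]: "expn z \<le> 1"
  by (cases z) (auto simp: expn_ennreal)

lemma expn_less_top[simp]: "expn z < \<top>"
  by (cases z) (auto simp: expn_ennreal)

lemma expn_add: "expn (a + b) = expn a * expn b"
  by (cases a; cases b) (auto simp: expn_ennreal exp_add[symmetric] simp flip: ennreal_plus ennreal_mult)

lemma expn_antimono: "a \<le> b \<Longrightarrow> expn b \<le> expn a"
  by (cases a; cases b) (auto simp: expn_ennreal top_unique)

lemma measurable_expn[measurable]: "expn \<in> borel_measurable borel"
  unfolding expn_def by measurable

lemma tendsto_expn:
  assumes f: "(f \<longlongrightarrow> z) F" shows "((\<lambda>x. expn (f x)) \<longlongrightarrow> expn z) F"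
proof (cases z)
  case (real r)
  have ev: "eventually (\<lambda>x. f x < \<top>) F"
    using f real by (intro order_tendstoD) auto
  have "((\<lambda>x. ennreal (exp (- enn2real (f x)))) \<longlongrightarrow> ennreal (exp (- r))) F"
    using f real by (intro tendsto_intros tendsto_enn2real) auto
  then show ?thesis
    unfolding real(2) expn_ennreal[OF real(1)]
    by (rule Lim_transform_eventually) (use ev in eventually_elim, auto simp: expn_def)
next
  case top
  show ?thesis unfolding top expn_top
  proof (rule order_tendstoI)
    fix e :: ennreal assume e: "0 < e"
    obtain B where B: "0 \<le> B" "ennreal (exp (- B)) < e"
    proof (cases e)
      case (real r)
      then have "r > 0" using e by auto
      \<comment> \<open>The exponent is at most \<open>ln r - 1\<close>, hence strictly below
        \<open>ln r\<close>; the maximum with 0 keeps \<open>B\<close> nonnegative, as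
        \<open>expn_ennreal\<close> demands.\<close>
      then have "exp (- (max 0 (1 - ln r))) < r"
        by (subst (2) exp_ln[of r, symmetric]) (auto simp del: exp_ln)
      then show ?thesis using real by (intro that[of "max 0 (1 - ln r)"]) (auto simp: ennreal_less_iff)
    qed (use that[of 0] in auto)
    have "eventually (\<lambda>x. ennreal B < f x) F"
      using f top by (intro order_tendstoD) auto
    then show "eventually (\<lambda>x. expn (f x) < e) F"
    proof eventually_elim
      case (elim x)
      have "expn (f x) \<le> expn (ennreal B)" using elim by (intro expn_antimono) auto
      then show ?case using B by (simp add: expn_ennreal)
    qed
  qed auto
qed

section \<open>Measurability of integrals against measure-valued maps\<close>

lemma measurable_measure_algebraI:
  assumes "\<And>a. a \<in> space N \<Longrightarrow> sets (k a) = sets K"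
    and "\<And>A. A \<in> sets K \<Longrightarrow> (\<lambda>a. emeasure (k a) A) \<in> borel_measurable N"
  shows "k \<in> N \<rightarrow>\<^sub>M measure_algebra K"
  unfolding measure_algebra_def using assms
  by (intro measurable_Sup2) (auto intro!: measurable_vimage_algebra2)

lemma measurable_nn_integral_measure_algebra:
  assumes f: "f \<in> borel_measurable K"
  shows "(\<lambda>\<mu>. integral\<^sup>N \<mu> f) \<in> borel_measurable (measure_algebra K)" (is "_ \<in> ?B")
  using f
proof induct
  case (cong f g)
  moreover have "(\<lambda>M'. \<integral>\<^sup>+M''. f M'' \<partial>M') \<in> ?B \<longleftrightarrow> (\<lambda>M'. \<integral>\<^sup>+M''. g M'' \<partial>M') \<in> ?B"
    by (intro measurable_cong nn_integral_cong cong)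
       (auto simp: space_measure_algebra dest!: sets_eq_imp_space_eq)
  ultimately show ?case by simp
next
  case (set B)
  then have "(\<lambda>M'. \<integral>\<^sup>+M''. indicator B M'' \<partial>M') \<in> ?B \<longleftrightarrow> (\<lambda>M'. emeasure M' B) \<in> ?B"
    by (intro measurable_cong nn_integral_indicator) (simp add: space_measure_algebra)
  with set show ?case
    by (simp add: measurable_emeasure_measure_algebra)
next
  case (mult f c)
  then have "(\<lambda>M'. \<integral>\<^sup>+M''. c * f M'' \<partial>M') \<in> ?B \<longleftrightarrow> (\<lambda>M'. c * \<integral>\<^sup>+M''. f M'' \<partial>M') \<in> ?B"
    by (intro measurable_cong nn_integral_cmult) (auto simp add: space_measure_algebra)
  with mult show ?case by simp
next
  case (add f g)
  then have "(\<lambda>M'. \<integral>\<^sup>+M''. f M'' + g M'' \<partial>M') \<in> ?B \<longleftrightarrow>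
      (\<lambda>M'. (\<integral>\<^sup>+M''. f M'' \<partial>M') + (\<integral>\<^sup>+M''. g M'' \<partial>M')) \<in> ?B"
    by (intro measurable_cong nn_integral_add) (auto simp add: space_measure_algebra)
  with add show ?case by (simp add: ac_simps)
next
  case (seq F)
  then have "(\<lambda>M'. \<integral>\<^sup>+M''. (SUP i. F i) M'' \<partial>M') \<in> ?B \<longleftrightarrow>
      (\<lambda>M'. SUP i. (\<integral>\<^sup>+M''. F i M'' \<partial>M')) \<in> ?B"
    unfolding SUP_apply
    by (intro measurable_cong nn_integral_monotone_convergence_SUP) (auto simp add: space_measure_algebra)
  with seq show ?case
    by (simp add: ac_simps)
qed

text \<open>Here the integrand depends on the parameter too. Dividing by a measurable positive
  function of the parameter turns the finite kernel into a subprobability kernel, where the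
  statement is known; the factor is multiplied back afterwards. The empty space is treated apart
  because \<open>subprob_space\<close> excludes it.\<close>

lemma measurable_nn_integral_kernel:
  assumes k: "k \<in> N \<rightarrow>\<^sub>M measure_algebra K"
    and fin: "\<And>a. a \<in> space N \<Longrightarrow> emeasure (k a) (space K) < \<infinity>"
    and F: "(\<lambda>(a, x). F a x) \<in> borel_measurable (N \<Otimes>\<^sub>M K)"
  shows "(\<lambda>a. \<integral>\<^sup>+x. F a x \<partial>k a) \<in> borel_measurable N"
proof (cases "space K = {}")
  case True
  have "(\<integral>\<^sup>+x. F a x \<partial>k a) = 0" if "a \<in> space N" for a
  proof -
    have "space (k a) = {}"
      using measurable_space[OF k that] True by (auto simp: space_measure_algebra dest: sets_eq_imp_space_eq)
    then show ?thesis by (rule nn_integral_empty)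
  qed
  then show ?thesis by (simp cong: measurable_cong)
next
  case False
  have sk: "sets (k a) = sets K" "space (k a) = space K" if "a \<in> space N" for a
    using measurable_space[OF k that] by (auto simp: space_measure_algebra dest: sets_eq_imp_space_eq)
  have mk: "(\<lambda>a. emeasure (k a) A) \<in> borel_measurable N" if "A \<in> sets K" for A
    using measurable_compose[OF k measurable_emeasure_measure_algebra[OF that]] .
  note mk[OF sets.top, measurable]
  \<comment> \<open>The summand 1 keeps the divisor away from 0 where \<open>k a\<close> is the zero
    measure.\<close>
  define c where "c a = 1 + emeasure (k a) (space K)" for a
  have [measurable]: "c \<in> borel_measurable N" unfolding c_def by measurable
  have c: "c a \<noteq> 0" "c a \<noteq> \<top>" if "a \<in> space N" for a
    using fin[OF that] by (auto simp: c_def)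
  define k' where "k' a = scale_measure (1 / c a) (k a)" for a
  have k': "k' \<in> N \<rightarrow>\<^sub>M subprob_algebra K"
  proof (rule measurable_subprob_algebra)
    fix a assume a: "a \<in> space N"
    show "subprob_space (k' a)"
    proof
      have "1 / c a * emeasure (k a) (space K) \<le> 1 / c a * c a"
        by (intro mult_left_mono) (auto simp: c_def)
      also have "\<dots> = 1" using c[OF a] by (simp add: ennreal_divide_times ennreal_divide_self less_top)
      finally show "emeasure (k' a) (space (k' a)) \<le> 1"
        by (simp add: k'_def space_scale_measure sk[OF a])
      show "space (k' a) \<noteq> {}" using False by (simp add: k'_def space_scale_measure sk[OF a])
    qed
    show "sets (k' a) = sets K" by (simp add: k'_def sk[OF a])
  next
    fix A assume A[measurable]: "A \<in> sets K"
    note mk[OF A, measurable]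
    show "(\<lambda>a. emeasure (k' a) A) \<in> borel_measurable N"
      unfolding k'_def by simp
  qed
  have "(\<lambda>a. c a * (\<integral>\<^sup>+x. F a x \<partial>k' a)) \<in> borel_measurable N"
    by (intro borel_measurable_times_ennreal nn_integral_measurable_subprob_algebra2[OF _ k'] F) auto
  moreover have "c a * (\<integral>\<^sup>+x. F a x \<partial>k' a) = (\<integral>\<^sup>+x. F a x \<partial>k a)" if a: "a \<in> space N" for a
  proof -
    have [measurable_cong]: "sets (k a) = sets K" by (rule sk[OF a])
    have "(\<lambda>x. F a x) \<in> borel_measurable K"
      using measurable_Pair2[OF F a] by simp
    then have "F a \<in> borel_measurable (k a)" by simp
    then show ?thesis unfolding k'_def
      by (subst nn_integral_scale_measure)
         (use c[OF a] in \<open>auto simp: mult.assoc[symmetric] ennreal_times_divide ennreal_divide_self less_top\<close>)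
  qed
  ultimately show ?thesis by (simp cong: measurable_cong)
qed

section \<open>Uniqueness for image measures of weighted laws\<close>

lemma nn_integral_weighted:
  assumes [measurable]: "W \<in> borel_measurable P" "Z \<in> borel_measurable P" "u \<in> borel_measurable borel"
  shows "(\<integral>\<^sup>+x. u x \<partial>distr (density P W) borel Z) = (\<integral>\<^sup>+\<omega>. W \<omega> * u (Z \<omega>) \<partial>P)"
  by (simp add: nn_integral_distr nn_integral_density)

text \<open>The weight \<open>W\<close> is absorbed into a density, so a statement about the single
  real variable \<open>Z\<close> becomes one about its joint law with everything that enters
  \<open>W\<close>. This allows joint laws to be treated one variable at a time.\<close>

lemma weighted_eqI_mgf:
  fixes Z :: "'a \<Rightarrow> real" and Z' :: "'b \<Rightarrow> real" and u :: "real \<Rightarrow> ennreal"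
  assumes [measurable]: "W \<in> borel_measurable P" "Z \<in> borel_measurable P" "u \<in> borel_measurable borel"
    "W' \<in> borel_measurable P'" "Z' \<in> borel_measurable P'"
    and fin: "\<And>t. (\<integral>\<^sup>+\<omega>. W \<omega> * ennreal (exp (t * Z \<omega>)) \<partial>P) < \<infinity>"
    and eq: "\<And>t. (\<integral>\<^sup>+\<omega>. W \<omega> * ennreal (exp (t * Z \<omega>)) \<partial>P) = (\<integral>\<^sup>+\<omega>. W' \<omega> * ennreal (exp (t * Z' \<omega>)) \<partial>P')"
  shows "(\<integral>\<^sup>+\<omega>. W \<omega> * u (Z \<omega>) \<partial>P) = (\<integral>\<^sup>+\<omega>. W' \<omega> * u (Z' \<omega>) \<partial>P')"
proof -
  have "distr (density P W) borel Z = distr (density P' W') borel Z'"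
    using fin eq by (intro measure_eqI_mgf) (simp_all add: nn_integral_weighted)
  then have "(\<integral>\<^sup>+x. u x \<partial>distr (density P W) borel Z) = (\<integral>\<^sup>+x. u x \<partial>distr (density P' W') borel Z')"
    by simp
  then show ?thesis
    by (simp only: nn_integral_weighted assms(1-5))
qed

lemma exp_integrable_weighted:
  fixes Y :: "'a \<Rightarrow> real"
  assumes [measurable]: "V \<in> borel_measurable Q" "Y \<in> borel_measurable Q"
    and Y: "\<And>\<omega>. 0 \<le> Y \<omega> \<and> Y \<omega> \<le> C" and f: "(\<integral>\<^sup>+\<omega>. V \<omega> \<partial>Q) < \<infinity>"
  shows "exp_integrable (distr (density Q V) borel Y)"
    unfolding exp_integrable_def
  proof safe
    fix t :: real
    have "(\<integral>\<^sup>+\<omega>. V \<omega> * ennreal (exp (t * Y \<omega>)) \<partial>Q) \<le> (\<integral>\<^sup>+\<omega>. V \<omega> * ennreal (exp (\<bar>t\<bar> * C)) \<partial>Q)"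
    proof (intro nn_integral_mono mult_left_mono ennreal_leI)
      fix \<omega>
      have "t * Y \<omega> \<le> \<bar>t\<bar> * Y \<omega>" using Y by (intro mult_right_mono) auto
      also have "\<dots> \<le> \<bar>t\<bar> * C" using Y by (intro mult_left_mono) auto
      finally show "exp (t * Y \<omega>) \<le> exp (\<bar>t\<bar> * C)" by simp
    qed auto
    also have "\<dots> < \<infinity>" using f by (simp add: nn_integral_multc ennreal_mult_less_top)
    finally show "(\<integral>\<^sup>+x. ennreal (exp (t * x)) \<partial>distr (density Q V) borel Y) < \<infinity>"
      by (simp add: nn_integral_weighted)
  qed simp_all

lemma moment_weighted:
  fixes Y :: "'a \<Rightarrow> real"
  assumes [measurable]: "V \<in> borel_measurable Q" "Y \<in> borel_measurable Q"
    and Y: "\<And>\<omega>. 0 \<le> Y \<omega> \<and> Y \<omega> \<le> C"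
  shows "(LINT x|distr (density Q V) borel Y. x ^ k) = enn2real (\<integral>\<^sup>+\<omega>. V \<omega> * ennreal (Y \<omega>) ^ k \<partial>Q)"
  proof -
    have "(LINT x|distr (density Q V) borel Y. x ^ k) = enn2real (\<integral>\<^sup>+x. ennreal (x ^ k) \<partial>distr (density Q V) borel Y)"
      by (rule integral_eq_nn_integral) (auto simp: AE_distr_iff Y)
    also have "\<dots> = enn2real (\<integral>\<^sup>+\<omega>. V \<omega> * ennreal (Y \<omega> ^ k) \<partial>Q)"
      by (simp add: nn_integral_weighted)
    finally show ?thesis using Y by (simp add: ennreal_power)
  qed

text \<open>For a bounded variable and an integrable weight all exponential moments are finite, so
  matching the weighted powers suffices.\<close>

lemma weighted_eqI_moments:
  fixes Z :: "'a \<Rightarrow> real" and Z' :: "'b \<Rightarrow> real" and u :: "real \<Rightarrow> ennreal"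
  assumes [measurable]: "W \<in> borel_measurable P" "Z \<in> borel_measurable P" "u \<in> borel_measurable borel"
    "W' \<in> borel_measurable P'" "Z' \<in> borel_measurable P'"
    and bd: "\<And>\<omega>. 0 \<le> Z \<omega> \<and> Z \<omega> \<le> C" "\<And>\<omega>. 0 \<le> Z' \<omega> \<and> Z' \<omega> \<le> C"
    and fin: "(\<integral>\<^sup>+\<omega>. W \<omega> \<partial>P) < \<infinity>"
    and eq: "\<And>k. (\<integral>\<^sup>+\<omega>. W \<omega> * ennreal (Z \<omega>) ^ k \<partial>P) = (\<integral>\<^sup>+\<omega>. W' \<omega> * ennreal (Z' \<omega>) ^ k \<partial>P')"
  shows "(\<integral>\<^sup>+\<omega>. W \<omega> * u (Z \<omega>) \<partial>P) = (\<integral>\<^sup>+\<omega>. W' \<omega> * u (Z' \<omega>) \<partial>P')"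
proof -
  have fin': "(\<integral>\<^sup>+\<omega>. W' \<omega> \<partial>P') < \<infinity>" using fin eq[of 0] by simp
  have "distr (density P W) borel Z = distr (density P' W') borel Z'"
    by (rule measure_eqI_moments)
       (auto intro!: exp_integrable_weighted[where C=C] fin fin' simp: bd moment_weighted[OF _ _ bd(1)] moment_weighted[OF _ _ bd(2)] eq)
  then have "(\<integral>\<^sup>+x. u x \<partial>distr (density P W) borel Z) = (\<integral>\<^sup>+x. u x \<partial>distr (density P' W') borel Z')"
    by simp
  then show ?thesis
    by (simp only: nn_integral_weighted assms(1-5))
qed

lemma measurable_prod_list_ennreal[measurable (raw)]:
  assumes "\<And>p. p \<in> set l \<Longrightarrow> f p \<in> borel_measurable N"
  shows "(\<lambda>x. (\<Prod>p\<leftarrow>l. f p x) :: ennreal) \<in> borel_measurable N"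
  using assms by (induction l) auto

lemma prod_list_le_1:
  assumes "\<And>p. p \<in> set l \<Longrightarrow> f p \<le> 1"
  shows "(\<Prod>p\<leftarrow>l. f p) \<le> (1 :: ennreal)"
  using assms by (induction l) (auto intro!: mult_le_one)

text \<open>Left inverse of \<open>enn2real \<circ> expn\<close>, with 0 standing for infinity. It
  turns a function of an extended nonnegative mass into a function of a real variable in
  \<open>[0, 1]\<close>, to which the moment method applies.\<close>

definition ln_inv :: "real \<Rightarrow> ennreal" where
  "ln_inv v = (if v = 0 then \<top> else ennreal (- ln v))"

lemma ln_inv_expn: "ln_inv (enn2real (expn z)) = z"
  by (cases z) (auto simp: expn_ennreal ln_inv_def)

lemma measurable_ln_inv[measurable]: "ln_inv \<in> borel_measurable borel"
  unfolding ln_inv_def by measurable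

text \<open>
  The variables \<open>expn (emeasure (X \<omega>) A)\<close> lie in \<open>[0, 1]\<close> and determine \<open>emeasure (X \<omega>) A\<close>, the value
  \<open>\<infinity>\<close> included. Their mixed moments are the Laplace functionals, with repetitions in the list of sets.
\<close>

lemma laplace_joint:
  fixes X :: "'w \<Rightarrow> 'a measure" and X' :: "'v \<Rightarrow> 'a measure"
  assumes P: "prob_space P" and P': "prob_space P'"
    and X[measurable]: "X \<in> P \<rightarrow>\<^sub>M measure_algebra K" and X'[measurable]: "X' \<in> P' \<rightarrow>\<^sub>M measure_algebra K"
    and eq: "\<And>l. set l \<subseteq> sets K \<Longrightarrow>
      (\<integral>\<^sup>+\<omega>. (\<Prod>A\<leftarrow>l. expn (emeasure (X \<omega>) A)) \<partial>P) = (\<integral>\<^sup>+\<omega>. (\<Prod>A\<leftarrow>l. expn (emeasure (X' \<omega>) A)) \<partial>P')"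
    and L: "\<And>u A. (u, A) \<in> set L \<Longrightarrow> u \<in> borel_measurable borel \<and> A \<in> sets K \<and> (\<forall>z. u z \<le> (1::ennreal))"
    and l: "set l \<subseteq> sets K"
  shows "(\<integral>\<^sup>+\<omega>. (\<Prod>(u, A)\<leftarrow>L. u (emeasure (X \<omega>) A)) * (\<Prod>A\<leftarrow>l. expn (emeasure (X \<omega>) A)) \<partial>P) =
    (\<integral>\<^sup>+\<omega>. (\<Prod>(u, A)\<leftarrow>L. u (emeasure (X' \<omega>) A)) * (\<Prod>A\<leftarrow>l. expn (emeasure (X' \<omega>) A)) \<partial>P')"
  using L l
proof (induction L arbitrary: l)
  case Nil
  then show ?case using eq by simp
next
  case (Cons p L)
  obtain u A where p: "p = (u, A)" by (cases p)
  have u[measurable]: "u \<in> borel_measurable borel" and A: "A \<in> sets K" "\<And>z. u z \<le> 1"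
    using Cons.prems(1)[of u A] by (auto simp: p)
  have me: "(\<lambda>\<omega>. emeasure (X \<omega>) A) \<in> borel_measurable P" "(\<lambda>\<omega>. emeasure (X' \<omega>) A) \<in> borel_measurable P'"
    if "A \<in> sets K" for A
    using measurable_compose[OF X measurable_emeasure_measure_algebra[OF that]]
      measurable_compose[OF X' measurable_emeasure_measure_algebra[OF that]] by auto
  note me[OF A(1), measurable]
  define W where "W \<mu> = (\<Prod>(u, A)\<leftarrow>L. u (emeasure \<mu> A)) * (\<Prod>A\<leftarrow>l. expn (emeasure \<mu> A))"
    for \<mu> :: "'a measure"
  have mW[measurable]: "(\<lambda>\<omega>. W (X \<omega>)) \<in> borel_measurable P" "(\<lambda>\<omega>. W (X' \<omega>)) \<in> borel_measurable P'"
    unfolding W_def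
    by (auto intro!: borel_measurable_times_ennreal measurable_prod_list_ennreal measurable_compose[OF _ measurable_expn] me
          dest!: Cons.prems(1)[OF list.set_intros(2)] subsetD[OF Cons.prems(2)]
          intro: measurable_compose[OF me(1)] measurable_compose[OF me(2)])
  have W1: "W \<mu> \<le> 1" for \<mu>
    unfolding W_def using Cons.prems(1) 
    by (intro mult_le_one prod_list_le_1) auto
  interpret P: prob_space P by fact
  have "(\<integral>\<^sup>+\<omega>. W (X \<omega>) * u (ln_inv (enn2real (expn (emeasure (X \<omega>) A)))) \<partial>P) =
    (\<integral>\<^sup>+\<omega>. W (X' \<omega>) * u (ln_inv (enn2real (expn (emeasure (X' \<omega>) A)))) \<partial>P')"
  proof (rule weighted_eqI_moments[where u="\<lambda>v. u (ln_inv v)" and C=1])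
    have "enn2real (expn z) \<le> 1" for z
      using enn2real_mono[OF expn_le_1] by simp
    then show "0 \<le> enn2real (expn (emeasure (X \<omega>) A)) \<and> enn2real (expn (emeasure (X \<omega>) A)) \<le> 1"
      "0 \<le> enn2real (expn (emeasure (X' \<omega>') A)) \<and> enn2real (expn (emeasure (X' \<omega>') A)) \<le> 1" for \<omega> \<omega>' by auto
    have "(\<integral>\<^sup>+\<omega>. W (X \<omega>) \<partial>P) \<le> (\<integral>\<^sup>+\<omega>. 1 \<partial>P)" by (intro nn_integral_mono W1)
    then show "(\<integral>\<^sup>+\<omega>. W (X \<omega>) \<partial>P) < \<infinity>" by (simp add: P.emeasure_space_1 order.strict_trans1)
    fix k
    have *: "W \<mu> * ennreal (enn2real (expn (emeasure \<mu> A))) ^ k =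
      (\<Prod>(u, A)\<leftarrow>L. u (emeasure \<mu> A)) * (\<Prod>A\<leftarrow>replicate k A @ l. expn (emeasure \<mu> A))"
      for \<mu>
      unfolding W_def by (simp add: mult_ac ennreal_enn2real[OF expn_less_top] prod_list_replicate)
    show "(\<integral>\<^sup>+\<omega>. W (X \<omega>) * ennreal (enn2real (expn (emeasure (X \<omega>) A))) ^ k \<partial>P) =
       (\<integral>\<^sup>+\<omega>. W (X' \<omega>) * ennreal (enn2real (expn (emeasure (X' \<omega>) A))) ^ k \<partial>P')"
      unfolding * by (rule Cons.IH) (use Cons.prems A in auto)
  qed measurable
  then show ?case
    by (simp add: ln_inv_expn p W_def mult_ac)
qed

text \<open>With lists, intersection of cylinders is concatenation, the empty list gives the whole
  space, and the indicator of a cylinder is a product over the list as in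
  \<open>laplace_joint\<close>.\<close>

definition cylinder :: "'a measure \<Rightarrow> (ennreal set \<times> 'a set) list \<Rightarrow> 'a measure set" where
  "cylinder K L = {\<mu> \<in> space (measure_algebra K). \<forall>(B, A)\<in>set L. emeasure \<mu> A \<in> B}"

lemma sets_cylinder:
  assumes "set L \<subseteq> sets borel \<times> sets K"
  shows "cylinder K L \<in> sets (measure_algebra K)"
      using assms
    proof (induction L)
      case (Cons p L)
      obtain B A where p: "p = (B, A)" by (cases p)
      have "cylinder K (p # L) = ((\<lambda>\<mu>. emeasure \<mu> A) -` B \<inter> space (measure_algebra K)) \<inter> cylinder K L"
        by (auto simp: cylinder_def p)
      moreover have "(\<lambda>\<mu>. emeasure \<mu> A) -` B \<inter> space (measure_algebra K) \<in> sets (measure_algebra K)"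
        by (rule measurable_sets[OF measurable_emeasure_measure_algebra]) (use Cons.prems p in auto)
      ultimately show ?case using Cons by auto
    qed (simp add: cylinder_def)

lemma emeasure_distr_cylinder:
  assumes Y: "Y \<in> Q \<rightarrow>\<^sub>M measure_algebra K" and L: "set L \<subseteq> sets borel \<times> sets K"
  shows "emeasure (distr Q (measure_algebra K) Y) (cylinder K L) =
      (\<integral>\<^sup>+\<omega>. (\<Prod>(u, A)\<leftarrow>map (map_prod indicator id) L. u (emeasure (Y \<omega>) A)) \<partial>Q)"
  proof -
    have cy: "cylinder K L \<in> sets (measure_algebra K)" using L by (rule sets_cylinder)
    then have "emeasure (distr Q (measure_algebra K) Y) (cylinder K L) = (\<integral>\<^sup>+\<omega>. indicator (cylinder K L) (Y \<omega>) \<partial>Q)"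
      by (subst nn_integral_distr[OF Y, symmetric]) auto
    also have "\<dots> = (\<integral>\<^sup>+\<omega>. (\<Prod>(u, A)\<leftarrow>map (map_prod indicator id) L. u (emeasure (Y \<omega>) A)) \<partial>Q)"
    proof (rule nn_integral_cong)
      fix \<omega> assume "\<omega> \<in> space Q"
      then have \<mu>: "Y \<omega> \<in> space (measure_algebra K)" using Y by (rule measurable_space[rotated])
      show "(indicator (cylinder K L) (Y \<omega>) :: ennreal) = (\<Prod>(u, A)\<leftarrow>map (map_prod indicator id) L. u (emeasure (Y \<omega>) A))"
        by (induction L) (auto simp: cylinder_def \<mu> indicator_def of_bool_def split: if_splits)
    qed
    finally show ?thesis .
  qed

text \<open>Cylinders form an intersection-stable generator, and the probability of one is the
  integral of a product of indicators of masses, that is, \<open>laplace_joint\<close> with no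
  exponential factor left.\<close>

lemma distr_measure_algebra_eqI:
  fixes X :: "'w \<Rightarrow> 'a measure" and X' :: "'v \<Rightarrow> 'a measure"
  assumes P: "prob_space P" and P': "prob_space P'"
    and X[measurable]: "X \<in> P \<rightarrow>\<^sub>M measure_algebra K" and X'[measurable]: "X' \<in> P' \<rightarrow>\<^sub>M measure_algebra K"
    and eq: "\<And>l. set l \<subseteq> sets K \<Longrightarrow>
      (\<integral>\<^sup>+\<omega>. (\<Prod>A\<leftarrow>l. expn (emeasure (X \<omega>) A)) \<partial>P) = (\<integral>\<^sup>+\<omega>. (\<Prod>A\<leftarrow>l. expn (emeasure (X' \<omega>) A)) \<partial>P')"
  shows "distr P (measure_algebra K) X = distr P' (measure_algebra K) X'"
proof -
  let ?\<Omega> = "space (measure_algebra K)"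
  define \<E> where "\<E> = {cylinder K L | L. set L \<subseteq> sets borel \<times> sets K}"
  interpret P: prob_space P by fact
  have sub: "\<E> \<subseteq> sets (measure_algebra K)"
    by (auto simp: \<E>_def intro!: sets_cylinder)
  then have pow: "\<E> \<subseteq> Pow ?\<Omega>" using sets.space_closed by blast
  have gen: "sets (measure_algebra K) = sigma_sets ?\<Omega> \<E>"
  proof
    show "sigma_sets ?\<Omega> \<E> \<subseteq> sets (measure_algebra K)"
      using sub by (rule sets.sigma_sets_subset)
    \<comment> \<open>Measurability of the identity out of the space generated by cylinders is the
      inclusion of \<sigma>-algebras that is still missing.\<close>
    have "(\<lambda>\<mu>. \<mu>) \<in> sigma ?\<Omega> \<E> \<rightarrow>\<^sub>M measure_algebra K"
    proof (rule measurable_measure_algebraI)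
      fix A assume A: "A \<in> sets K"
      show "(\<lambda>\<mu>. emeasure \<mu> A) \<in> borel_measurable (sigma ?\<Omega> \<E>)"
      proof (rule measurableI)
        fix B :: "ennreal set" assume B: "B \<in> sets borel"
        have "(\<lambda>\<mu>. emeasure \<mu> A) -` B \<inter> space (sigma ?\<Omega> \<E>) = cylinder K [(B, A)]"
          using pow by (auto simp: cylinder_def space_measure_of)
        moreover have "cylinder K [(B, A)] \<in> \<E>" unfolding \<E>_def using A B by auto
        ultimately show "(\<lambda>\<mu>. emeasure \<mu> A) -` B \<inter> space (sigma ?\<Omega> \<E>) \<in> sets (sigma ?\<Omega> \<E>)"
          using pow by (auto simp: sets_measure_of)
      qed simp
    qed (use pow in \<open>auto simp: space_measure_of space_measure_algebra\<close>)
    then show "sets (measure_algebra K) \<subseteq> sigma_sets ?\<Omega> \<E>"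
      using pow sets.sets_into_space
      by (auto simp: measurable_def sets_measure_of space_measure_of Int_absorb2)
  qed
  show ?thesis
  proof (rule measure_eqI_generator_eq[where E=\<E> and \<Omega>="?\<Omega>" and A="\<lambda>_. ?\<Omega>"])
    show "Int_stable \<E>"
    proof (rule Int_stableI)
      fix a b assume "a \<in> \<E>" "b \<in> \<E>"
      then obtain L L' where L: "a = cylinder K L" "b = cylinder K L'" "set L \<subseteq> sets borel \<times> sets K" "set L' \<subseteq> sets borel \<times> sets K"
        by (auto simp: \<E>_def)
      then have "a \<inter> b = cylinder K (L @ L')" by (auto simp: cylinder_def)
      then show "a \<inter> b \<in> \<E>" unfolding \<E>_def using L by (auto intro!: exI[of _ "L @ L'"])
    qed
    have "?\<Omega> \<in> \<E>" unfolding \<E>_def by (auto intro!: exI[of _ "[]"] simp: cylinder_def)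
    then show "range (\<lambda>_::nat. ?\<Omega>) \<subseteq> \<E>" by auto
    show "emeasure (distr P (measure_algebra K) X) ?\<Omega> \<noteq> \<infinity>"
      using P.prob_space_distr[OF X, THEN prob_space.emeasure_space_1] by simp
    fix E assume "E \<in> \<E>"
    then obtain L where L: "E = cylinder K L" "set L \<subseteq> sets borel \<times> sets K" by (auto simp: \<E>_def)
    show "emeasure (distr P (measure_algebra K) X) E = emeasure (distr P' (measure_algebra K) X') E"
      unfolding L(1) emeasure_distr_cylinder[OF X L(2)] emeasure_distr_cylinder[OF X' L(2)]
      using laplace_joint[OF P P' X X' eq, of "map (map_prod indicator id) L" "[]"] L(2)
      by (simp, elim meta_mp) (auto simp: indicator_def)
  qed (use gen pow in auto)
qed

section \<open>Fields with equal exponential moments\<close>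

abbreviation lin_comb :: "('a \<Rightarrow> 'w \<Rightarrow> real) \<Rightarrow> (real \<times> 'a) list \<Rightarrow> 'w \<Rightarrow> real" where
  "lin_comb Y l \<omega> \<equiv> (\<Sum>(a, y)\<leftarrow>l. a * Y y \<omega>)"

lemma measurable_lin_comb:
  assumes "\<And>y. y \<in> snd ` set l \<Longrightarrow> Y y \<in> borel_measurable P"
  shows "lin_comb Y l \<in> borel_measurable P"
  using assms by (induction l) auto

text \<open>Points may repeat in a list, so that \<open>fdd_eq\<close> can put a further pair
  \<open>(t, y)\<close> in front without looking at the others. Finiteness on the side of
  \<open>Q\<close> follows from the equality.\<close>

definition same_exponential_moments ::
    "'a set \<Rightarrow> 'w measure \<Rightarrow> ('a \<Rightarrow> 'w \<Rightarrow> real) \<Rightarrow> 'v measure \<Rightarrow> ('a \<Rightarrow> 'v \<Rightarrow> real) \<Rightarrow> bool" where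
  "same_exponential_moments D P Y Q Z \<longleftrightarrow>
     (\<forall>y\<in>D. Y y \<in> borel_measurable P \<and> Z y \<in> borel_measurable Q) \<and>
     (\<forall>l. snd ` set l \<subseteq> D \<longrightarrow>
        (\<integral>\<^sup>+\<omega>. ennreal (exp (lin_comb Y l \<omega>)) \<partial>P) < \<infinity> \<and>
        (\<integral>\<^sup>+\<omega>. ennreal (exp (lin_comb Y l \<omega>)) \<partial>P) = (\<integral>\<^sup>+\<omega>. ennreal (exp (lin_comb Z l \<omega>)) \<partial>Q))"

lemma prod_list_bounded:
  fixes Y :: "'a \<Rightarrow> 'w \<Rightarrow> 'b"
  assumes "\<And>u y. (u, y) \<in> set L \<Longrightarrow> \<exists>c. \<forall>z. u z \<le> ennreal c"
  shows "\<exists>c. \<forall>\<omega>. (\<Prod>(u, y)\<leftarrow>L. u (Y y \<omega>)) \<le> ennreal c"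
  using assms
proof (induction L)
  case Nil
  show ?case by (rule exI[of _ 1]) simp
next
  case (Cons p L)
  obtain u y where p: "p = (u, y)" by (cases p)
  obtain c where c: "\<And>\<omega>. (\<Prod>(u, y)\<leftarrow>L. u (Y y \<omega>)) \<le> ennreal c"
    using Cons.IH Cons.prems by (metis list.set_intros(2))
  obtain d where d: "\<And>z. u z \<le> ennreal d" using Cons.prems[of u y] p by auto
  \<comment> \<open>\<open>ennreal\<close> sends negative reals to 0, so the product of the bounds
    is the product of the positive parts.\<close>
  have "ennreal d * ennreal c = ennreal (max 0 d * max 0 c)"
    by (cases "d \<ge> 0"; cases "c \<ge> 0") (auto simp: ennreal_mult ennreal_neg max_def)
  then have "(\<Prod>(u, y)\<leftarrow>p # L. u (Y y \<omega>)) \<le> ennreal (max 0 d * max 0 c)" for \<omega>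
    using mult_mono[OF d[of "Y y \<omega>"] c[of \<omega>]] by (simp add: p)
  then show ?case by blast
qed

lemma mult_exp_lin_comb:
  "w * ennreal (exp (lin_comb X l \<omega>)) * ennreal (exp (t * X y \<omega>)) =
    w * ennreal (exp (lin_comb X ((t, y) # l) \<omega>))"
  by (simp add: exp_add ennreal_mult mult_ac)

text \<open>
  One factor \<open>u (Y y)\<close> is added at a time: weighted with the other factors, the moment generating
  function of \<open>Y y\<close> is again an expectation of the same kind, with one exponential factor more.
\<close>

lemma fdd_eq:
  assumes s: "same_exponential_moments D P Y Q Z"
    and L: "\<And>u y. (u, y) \<in> set L \<Longrightarrow> u \<in> borel_measurable borel \<and> y \<in> D \<and> (\<exists>c. \<forall>z. u z \<le> ennreal c)"
    and l: "snd ` set l \<subseteq> D"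
  shows "(\<integral>\<^sup>+\<omega>. (\<Prod>(u, y)\<leftarrow>L. u (Y y \<omega>)) * ennreal (exp (lin_comb Y l \<omega>)) \<partial>P) =
    (\<integral>\<^sup>+\<omega>. (\<Prod>(u, y)\<leftarrow>L. u (Z y \<omega>)) * ennreal (exp (lin_comb Z l \<omega>)) \<partial>Q)"
  using L l
proof (induction L arbitrary: l)
  case Nil
  then show ?case using s by (simp add: same_exponential_moments_def)
next
  case (Cons p L)
  obtain u y where p: "p = (u, y)" by (cases p)
  have u[measurable]: "u \<in> borel_measurable borel" and y: "y \<in> D"
    using Cons.prems(1)[of u y] by (auto simp: p)
  have mY: "Y y \<in> borel_measurable P" "Z y \<in> borel_measurable Q" if "y \<in> D" for y
    using s that by (auto simp: same_exponential_moments_def)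
  note mY[OF y, measurable]
  have L: "v \<in> borel_measurable borel" "x \<in> D" "\<exists>c. \<forall>z. v z \<le> ennreal c" if "(v, x) \<in> set L" for v x
    using Cons.prems(1)[of v x] that by auto
  have [measurable]: "(\<lambda>\<omega>. \<Prod>(u, y)\<leftarrow>L. u (Y y \<omega>)) \<in> borel_measurable P"
     "(\<lambda>\<omega>. \<Prod>(u, y)\<leftarrow>L. u (Z y \<omega>)) \<in> borel_measurable Q"
    by (auto intro!: measurable_prod_list_ennreal dest: L intro: measurable_compose[OF mY(1)] measurable_compose[OF mY(2)])
  have [measurable]: "lin_comb Y l \<in> borel_measurable P" "lin_comb Z l \<in> borel_measurable Q"
    using Cons.prems(2) by (auto intro!: measurable_lin_comb mY)
  have "(\<integral>\<^sup>+\<omega>. (\<Prod>(u, y)\<leftarrow>L. u (Y y \<omega>)) * ennreal (exp (lin_comb Y l \<omega>)) * u (Y y \<omega>) \<partial>P) =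
    (\<integral>\<^sup>+\<omega>. (\<Prod>(u, y)\<leftarrow>L. u (Z y \<omega>)) * ennreal (exp (lin_comb Z l \<omega>)) * u (Z y \<omega>) \<partial>Q)"
  proof (rule weighted_eqI_mgf, goal_cases)
    \<comment> \<open>The remaining factors are bounded by a constant, so the weighted moment
      generating function is controlled by an unweighted exponential moment.\<close>
    case (6 t)
    obtain c where c: "\<And>\<omega>. (\<Prod>(u, y)\<leftarrow>L. u (Y y \<omega>)) \<le> ennreal c"
      using prod_list_bounded[of L Y] L(3) by metis
    have "(\<integral>\<^sup>+\<omega>. (\<Prod>(u, y)\<leftarrow>L. u (Y y \<omega>)) * ennreal (exp (lin_comb Y ((t, y) # l) \<omega>)) \<partial>P) \<le>
        (\<integral>\<^sup>+\<omega>. ennreal c * ennreal (exp (lin_comb Y ((t, y) # l) \<omega>)) \<partial>P)"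
      by (intro nn_integral_mono mult_right_mono c) auto
    also have "\<dots> = ennreal c * (\<integral>\<^sup>+\<omega>. ennreal (exp (lin_comb Y ((t, y) # l) \<omega>)) \<partial>P)"
      by (intro nn_integral_cmult) simp
    also have "\<dots> < \<infinity>"
      using s[unfolded same_exponential_moments_def, THEN conjunct2, rule_format, of "(t, y) # l"] y Cons.prems(2)
      by (auto simp: ennreal_mult_less_top simp del: less_top)
    finally show ?case unfolding mult_exp_lin_comb .
  next
    case (7 t)
    show ?case unfolding mult_exp_lin_comb by (rule Cons.IH) (use Cons.prems y in auto)
  qed measurable
  then show ?case by (simp add: p mult_ac)
qed

text \<open>
  By Tonelli every factor of the \<open>n\<close>-th power becomes one more evaluation point, so that the moments
  of the integral only involve finite-dimensional laws.
\<close>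

lemma exp_moments_eq_pow:
  fixes F :: "'a \<Rightarrow> real \<Rightarrow> ennreal"
  assumes s: "same_exponential_moments (space K) P Y Q Z"
    and "prob_space P" "prob_space Q" "finite_measure \<mu>" and sets: "sets \<mu> = sets K"
    and Y: "(\<lambda>(\<omega>, x). Y x \<omega>) \<in> borel_measurable (P \<Otimes>\<^sub>M K)"
    and Z: "(\<lambda>(\<omega>, x). Z x \<omega>) \<in> borel_measurable (Q \<Otimes>\<^sub>M K)"
    and F: "(\<lambda>(x, t). F x t) \<in> borel_measurable (K \<Otimes>\<^sub>M borel)"
    and bd: "\<And>x t. F x t \<le> ennreal c"
    and L: "\<And>u y. (u, y) \<in> set L \<Longrightarrow> u \<in> borel_measurable borel \<and> y \<in> space K \<and> (\<exists>c. \<forall>z. u z \<le> ennreal c)"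
  shows "(\<integral>\<^sup>+\<omega>. (\<Prod>(u, y)\<leftarrow>L. u (Y y \<omega>)) * (\<integral>\<^sup>+x. F x (Y x \<omega>) \<partial>\<mu>) ^ n \<partial>P) =
    (\<integral>\<^sup>+\<omega>. (\<Prod>(u, y)\<leftarrow>L. u (Z y \<omega>)) * (\<integral>\<^sup>+x. F x (Z x \<omega>) \<partial>\<mu>) ^ n \<partial>Q)"
  using L
proof (induction n arbitrary: L)
  case 0
  show ?case using fdd_eq[OF s, of L "[]"] 0 by simp
next
  case (Suc n)
  interpret P: prob_space P by fact
  interpret Q: prob_space Q by fact
  interpret \<mu>: finite_measure \<mu> by fact
  interpret P\<mu>: pair_sigma_finite P \<mu> ..
  interpret Q\<mu>: pair_sigma_finite Q \<mu> ..
  note [measurable_cong] = sets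
  have sp: "space \<mu> = space K" using sets by (rule sets_eq_imp_space_eq)
  note Y[measurable (raw)] Z[measurable (raw)] F[measurable (raw)]
  have L: "v \<in> borel_measurable borel" "x \<in> space K" if "(v, x) \<in> set L" for v x
    using Suc.prems[of v x] that by auto
  have mY: "Y y \<in> borel_measurable P" "Z y \<in> borel_measurable Q" if "y \<in> space K" for y
    using s that by (auto simp: same_exponential_moments_def)
  have [measurable]: "(\<lambda>\<omega>. \<Prod>(u, y)\<leftarrow>L. u (Y y \<omega>)) \<in> borel_measurable P"
     "(\<lambda>\<omega>. \<Prod>(u, y)\<leftarrow>L. u (Z y \<omega>)) \<in> borel_measurable Q"
    by (auto intro!: measurable_prod_list_ennreal dest: L intro: measurable_compose[OF mY(1)] measurable_compose[OF mY(2)])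
  have mF[measurable]: "(\<lambda>(\<omega>, x). F x (Y x \<omega>)) \<in> borel_measurable (P \<Otimes>\<^sub>M \<mu>)"
     "(\<lambda>(\<omega>, x). F x (Z x \<omega>)) \<in> borel_measurable (Q \<Otimes>\<^sub>M \<mu>)"
    using measurable_compose[OF measurable_Pair[OF measurable_snd Y] F]
      measurable_compose[OF measurable_Pair[OF measurable_snd Z] F] by (simp_all add: split_beta')
  have mFs: "F x \<in> borel_measurable borel" if "x \<in> space K" for x
    using measurable_Pair2[OF F that] by simp
  have [measurable]: "(\<lambda>\<omega>. \<integral>\<^sup>+x. F x (Y x \<omega>) \<partial>\<mu>) \<in> borel_measurable P"
      "(\<lambda>\<omega>. \<integral>\<^sup>+x. F x (Z x \<omega>) \<partial>\<mu>) \<in> borel_measurable Q"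
    by measurable
  have *: "(\<integral>\<^sup>+\<omega>. (\<Prod>(u, y)\<leftarrow>L. u (Y y \<omega>)) * (\<integral>\<^sup>+x. F x (Y x \<omega>) \<partial>\<mu>) ^ Suc n \<partial>P) =
    (\<integral>\<^sup>+x. \<integral>\<^sup>+\<omega>. (\<Prod>(u, y)\<leftarrow>(F x, x) # L. u (Y y \<omega>)) * (\<integral>\<^sup>+x. F x (Y x \<omega>) \<partial>\<mu>) ^ n \<partial>P \<partial>\<mu>)"
  proof -
    have "(\<integral>\<^sup>+\<omega>. (\<Prod>(u, y)\<leftarrow>L. u (Y y \<omega>)) * (\<integral>\<^sup>+x. F x (Y x \<omega>) \<partial>\<mu>) ^ Suc n \<partial>P) =
      (\<integral>\<^sup>+\<omega>. \<integral>\<^sup>+x. ((\<Prod>(u, y)\<leftarrow>L. u (Y y \<omega>)) * (\<integral>\<^sup>+x. F x (Y x \<omega>) \<partial>\<mu>) ^ n) * F x (Y x \<omega>) \<partial>\<mu> \<partial>P)"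
      using measurable_Pair2[OF mF(1)]
      by (intro nn_integral_cong) (subst nn_integral_cmult, simp_all add: mult_ac)
    also have "\<dots> = (\<integral>\<^sup>+x. \<integral>\<^sup>+\<omega>. ((\<Prod>(u, y)\<leftarrow>L. u (Y y \<omega>)) * (\<integral>\<^sup>+x. F x (Y x \<omega>) \<partial>\<mu>) ^ n) * F x (Y x \<omega>) \<partial>P \<partial>\<mu>)"
      by (rule P\<mu>.Fubini'[symmetric]) measurable
    finally show ?thesis by (simp add: mult_ac)
  qed
  have **: "(\<integral>\<^sup>+\<omega>. (\<Prod>(u, y)\<leftarrow>L. u (Z y \<omega>)) * (\<integral>\<^sup>+x. F x (Z x \<omega>) \<partial>\<mu>) ^ Suc n \<partial>Q) =
    (\<integral>\<^sup>+x. \<integral>\<^sup>+\<omega>. (\<Prod>(u, y)\<leftarrow>(F x, x) # L. u (Z y \<omega>)) * (\<integral>\<^sup>+x. F x (Z x \<omega>) \<partial>\<mu>) ^ n \<partial>Q \<partial>\<mu>)"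
  proof -
    have "(\<integral>\<^sup>+\<omega>. (\<Prod>(u, y)\<leftarrow>L. u (Z y \<omega>)) * (\<integral>\<^sup>+x. F x (Z x \<omega>) \<partial>\<mu>) ^ Suc n \<partial>Q) =
      (\<integral>\<^sup>+\<omega>. \<integral>\<^sup>+x. ((\<Prod>(u, y)\<leftarrow>L. u (Z y \<omega>)) * (\<integral>\<^sup>+x. F x (Z x \<omega>) \<partial>\<mu>) ^ n) * F x (Z x \<omega>) \<partial>\<mu> \<partial>Q)"
      using measurable_Pair2[OF mF(2)]
      by (intro nn_integral_cong) (subst nn_integral_cmult, simp_all add: mult_ac)
    also have "\<dots> = (\<integral>\<^sup>+x. \<integral>\<^sup>+\<omega>. ((\<Prod>(u, y)\<leftarrow>L. u (Z y \<omega>)) * (\<integral>\<^sup>+x. F x (Z x \<omega>) \<partial>\<mu>) ^ n) * F x (Z x \<omega>) \<partial>Q \<partial>\<mu>)"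
      by (rule Q\<mu>.Fubini'[symmetric]) measurable
    finally show ?thesis by (simp add: mult_ac)
  qed
  show ?case unfolding * **
    by (intro nn_integral_cong Suc.IH) (use bd sp mFs Suc.prems in auto)
qed

text \<open>The random integral is bounded by \<open>c\<close> times the mass of
  \<open>\<mu>\<close>, so its law is determined by its powers, which are compared in
  \<open>exp_moments_eq_pow\<close> with an empty list.\<close>

lemma expn_integral_eq_bounded:
  fixes F :: "'a \<Rightarrow> real \<Rightarrow> ennreal"
  assumes s: "same_exponential_moments (space K) P Y Q Z"
    and P: "prob_space P" and Q: "prob_space Q" and \<mu>: "finite_measure \<mu>" and sets: "sets \<mu> = sets K"
    and Y: "(\<lambda>(\<omega>, x). Y x \<omega>) \<in> borel_measurable (P \<Otimes>\<^sub>M K)"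
    and Z: "(\<lambda>(\<omega>, x). Z x \<omega>) \<in> borel_measurable (Q \<Otimes>\<^sub>M K)"
    and F: "(\<lambda>(x, t). F x t) \<in> borel_measurable (K \<Otimes>\<^sub>M borel)"
    and bd: "\<And>x t. F x t \<le> ennreal c"
  shows "(\<integral>\<^sup>+\<omega>. expn (\<integral>\<^sup>+x. F x (Y x \<omega>) \<partial>\<mu>) \<partial>P) = (\<integral>\<^sup>+\<omega>. expn (\<integral>\<^sup>+x. F x (Z x \<omega>) \<partial>\<mu>) \<partial>Q)"
proof -
  interpret P: prob_space P by fact
  interpret \<mu>: finite_measure \<mu> by fact
  note [measurable_cong] = sets
  define C where "C = enn2real (ennreal c * emeasure \<mu> (space \<mu>))"
  have le: "(\<integral>\<^sup>+x. F x (g x) \<partial>\<mu>) \<le> ennreal C" for g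
  proof -
    have "(\<integral>\<^sup>+x. F x (g x) \<partial>\<mu>) \<le> (\<integral>\<^sup>+x. ennreal c \<partial>\<mu>)" by (intro nn_integral_mono bd)
    also have "\<dots> = ennreal C"
      unfolding C_def using \<mu>.emeasure_finite[of "space \<mu>"]
      by (subst ennreal_enn2real) (auto simp: less_top[symmetric] ennreal_mult_eq_top_iff)
    finally show ?thesis .
  qed
  then have fin: "(\<integral>\<^sup>+x. F x (g x) \<partial>\<mu>) < \<top>" for g using le_less_trans ennreal_less_top by blast
  have [measurable]: "(\<lambda>(\<omega>, x). F x (Y x \<omega>)) \<in> borel_measurable (P \<Otimes>\<^sub>M \<mu>)"
     "(\<lambda>(\<omega>, x). F x (Z x \<omega>)) \<in> borel_measurable (Q \<Otimes>\<^sub>M \<mu>)"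
    using measurable_compose[OF measurable_Pair[OF measurable_snd Y] F]
      measurable_compose[OF measurable_Pair[OF measurable_snd Z] F] by (simp_all add: split_beta')
  have "(\<integral>\<^sup>+\<omega>. 1 * expn (ennreal (enn2real (\<integral>\<^sup>+x. F x (Y x \<omega>) \<partial>\<mu>))) \<partial>P) = 
      (\<integral>\<^sup>+\<omega>. 1 * expn (ennreal (enn2real (\<integral>\<^sup>+x. F x (Z x \<omega>) \<partial>\<mu>))) \<partial>Q)"
  proof (rule weighted_eqI_moments[where u="\<lambda>z. expn (ennreal z)" and C=C])
    show "(\<integral>\<^sup>+\<omega>. 1 * ennreal (enn2real (\<integral>\<^sup>+x. F x (Y x \<omega>) \<partial>\<mu>)) ^ k \<partial>P) = 
      (\<integral>\<^sup>+\<omega>. 1 * ennreal (enn2real (\<integral>\<^sup>+x. F x (Z x \<omega>) \<partial>\<mu>)) ^ k \<partial>Q)" for k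
      using exp_moments_eq_pow[OF s P Q \<mu> sets Y Z F bd, of "[]" k] by (simp add: fin)
  next
    have "enn2real (\<integral>\<^sup>+x. F x (g x) \<partial>\<mu>) \<le> C" for g
      using enn2real_mono[OF le] by (simp add: C_def)
    then show "0 \<le> enn2real (\<integral>\<^sup>+x. F x (Y x \<omega>) \<partial>\<mu>) \<and> enn2real (\<integral>\<^sup>+x. F x (Y x \<omega>) \<partial>\<mu>) \<le> C"
      "0 \<le> enn2real (\<integral>\<^sup>+x. F x (Z x \<omega>') \<partial>\<mu>) \<and> enn2real (\<integral>\<^sup>+x. F x (Z x \<omega>') \<partial>\<mu>) \<le> C" for \<omega> \<omega>'
      by auto
  qed (auto simp: P.emeasure_space_1)
  then show ?thesis by (simp add: fin)
qed

lemma tendsto_min_of_nat_ennreal: "(\<lambda>n. min z (of_nat n)) \<longlonglongrightarrow> (z :: ennreal)"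
  using tendsto_min[OF tendsto_const of_nat_tendsto_top_ennreal, of z] by simp

lemma expn_integral_min_LIMSEQ:
  fixes X :: "'a \<Rightarrow> 'w \<Rightarrow> real"
  assumes R: "prob_space R" and \<mu>: "finite_measure \<mu>" and sets[measurable_cong]: "sets \<mu> = sets K"
    and X[measurable]: "(\<lambda>(\<omega>, x). X x \<omega>) \<in> borel_measurable (R \<Otimes>\<^sub>M K)"
    and f[measurable]: "f \<in> borel_measurable K"
  shows "(\<lambda>n. \<integral>\<^sup>+\<omega>. expn (\<integral>\<^sup>+x. min (f x * ennreal (exp (X x \<omega>))) (of_nat n) \<partial>\<mu>) \<partial>R) \<longlonglongrightarrow>
      (\<integral>\<^sup>+\<omega>. expn (\<integral>\<^sup>+x. f x * ennreal (exp (X x \<omega>)) \<partial>\<mu>) \<partial>R)"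
proof (rule nn_integral_dominated_convergence[where w="\<lambda>_. 1"])
  interpret R: prob_space R by fact
  interpret \<mu>: finite_measure \<mu> by fact
  have X'[measurable]: "(\<lambda>z. X (snd z) (fst z)) \<in> borel_measurable (R \<Otimes>\<^sub>M K)"
    using X by (simp add: split_beta')
  have F1[measurable]: "(\<lambda>(\<omega>, x). min (f x * ennreal (exp (X x \<omega>))) (of_nat n)) \<in> borel_measurable (R \<Otimes>\<^sub>M \<mu>)" for n
    unfolding split_beta' by measurable
  have [measurable]: "(\<lambda>(\<omega>, x). f x * ennreal (exp (X x \<omega>))) \<in> borel_measurable (R \<Otimes>\<^sub>M \<mu>)" for n
    unfolding split_beta' by measurable
  show "(\<integral>\<^sup>+\<omega>. 1 \<partial>R) < \<infinity>" by (simp add: R.emeasure_space_1)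
  show "AE \<omega> in R. (\<lambda>n. expn (\<integral>\<^sup>+x. min (f x * ennreal (exp (X x \<omega>))) (of_nat n) \<partial>\<mu>)) \<longlonglongrightarrow>
      expn (\<integral>\<^sup>+x. f x * ennreal (exp (X x \<omega>)) \<partial>\<mu>)"
  proof (intro AE_I2 tendsto_expn nn_integral_LIMSEQ)
    fix \<omega> assume "\<omega> \<in> space R"
    then show "(\<lambda>x. min (f x * ennreal (exp (X x \<omega>))) (of_nat n)) \<in> borel_measurable \<mu>" for n
      using measurable_Pair2[OF F1, of \<omega>] by simp
    show "incseq (\<lambda>n x. min (f x * ennreal (exp (X x \<omega>))) (of_nat n))"
      by (auto simp: incseq_def le_fun_def simp del: min.bounded_iff intro!: min.mono)
    show "(\<lambda>n. min (f x * ennreal (exp (X x \<omega>))) (of_nat n)) \<longlonglongrightarrow> f x * ennreal (exp (X x \<omega>))" for x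
      by (rule tendsto_min_of_nat_ennreal)
  qed
  show "(\<lambda>\<omega>. expn (\<integral>\<^sup>+x. min (f x * ennreal (exp (X x \<omega>))) (of_nat n) \<partial>\<mu>)) \<in> borel_measurable R" for n
    by measurable
  show "(\<lambda>\<omega>. expn (\<integral>\<^sup>+x. f x * ennreal (exp (X x \<omega>)) \<partial>\<mu>)) \<in> borel_measurable R"
    by measurable
qed auto

text \<open>\<open>f x * exp t\<close> is unbounded, so it is cut off at height \<open>n\<close>. As
  \<open>n\<close> grows the inner integral increases to the full one, possibly infinite, and the
  bounded continuous \<open>expn\<close> carries the limit through the expectation.\<close>

lemma expn_integral_exp_eq:
  fixes f :: "'a \<Rightarrow> ennreal"
  assumes s: "same_exponential_moments (space K) P Y Q Z"
    and P: "prob_space P" and Q: "prob_space Q" and \<mu>: "finite_measure \<mu>" and sets: "sets \<mu> = sets K"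
    and Y: "(\<lambda>(\<omega>, x). Y x \<omega>) \<in> borel_measurable (P \<Otimes>\<^sub>M K)"
    and Z: "(\<lambda>(\<omega>, x). Z x \<omega>) \<in> borel_measurable (Q \<Otimes>\<^sub>M K)"
    and f[measurable]: "f \<in> borel_measurable K"
  shows "(\<integral>\<^sup>+\<omega>. expn (\<integral>\<^sup>+x. f x * ennreal (exp (Y x \<omega>)) \<partial>\<mu>) \<partial>P) =
    (\<integral>\<^sup>+\<omega>. expn (\<integral>\<^sup>+x. f x * ennreal (exp (Z x \<omega>)) \<partial>\<mu>) \<partial>Q)"
proof -
  interpret P: prob_space P by fact
  interpret Q: prob_space Q by fact
  interpret \<mu>: finite_measure \<mu> by fact
  note [measurable_cong] = sets
  define F where "F n x t = min (f x * ennreal (exp t)) (of_nat n)" for n x and t :: real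
  note Y[measurable] Z[measurable]
  have F: "(\<lambda>(x, t). F n x t) \<in> borel_measurable (K \<Otimes>\<^sub>M borel)" for n
    unfolding F_def by measurable
  have eq: "(\<integral>\<^sup>+\<omega>. expn (\<integral>\<^sup>+x. F n x (Y x \<omega>) \<partial>\<mu>) \<partial>P) = (\<integral>\<^sup>+\<omega>. expn (\<integral>\<^sup>+x. F n x (Z x \<omega>) \<partial>\<mu>) \<partial>Q)" for n
    by (rule expn_integral_eq_bounded[OF s P Q \<mu> sets Y Z F, where c="real n"])
       (simp add: F_def ennreal_of_nat_eq_real_of_nat)
  have "(\<lambda>n. \<integral>\<^sup>+\<omega>. expn (\<integral>\<^sup>+x. F n x (Y x \<omega>) \<partial>\<mu>) \<partial>P) \<longlonglongrightarrow>
      (\<integral>\<^sup>+\<omega>. expn (\<integral>\<^sup>+x. f x * ennreal (exp (Y x \<omega>)) \<partial>\<mu>) \<partial>P)"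
    unfolding F_def by (rule expn_integral_min_LIMSEQ[OF P \<mu> sets Y f])
  moreover have "(\<lambda>n. \<integral>\<^sup>+\<omega>. expn (\<integral>\<^sup>+x. F n x (Z x \<omega>) \<partial>\<mu>) \<partial>Q) \<longlonglongrightarrow>
      (\<integral>\<^sup>+\<omega>. expn (\<integral>\<^sup>+x. f x * ennreal (exp (Z x \<omega>)) \<partial>\<mu>) \<partial>Q)"
    unfolding F_def by (rule expn_integral_min_LIMSEQ[OF Q \<mu> sets Z f])
  ultimately show ?thesis
    unfolding eq by (rule LIMSEQ_unique)
qed

section \<open>Gaussian series\<close>

text \<open>Completing the square: the factor \<open>exp (t * x)\<close> moves the mean to
  \<open>\<sigma>\<^sup>2 * t\<close> and leaves a constant.\<close>

lemma nn_integral_normal_density_exp: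
  assumes "0 < \<sigma>"
  shows "(\<integral>\<^sup>+x. ennreal (normal_density 0 \<sigma> x) * ennreal (exp (t * x)) \<partial>lborel) = ennreal (exp (\<sigma>\<^sup>2 * t\<^sup>2 / 2))"
proof -
  have "normal_density 0 \<sigma> x * exp (t * x) = exp (\<sigma>\<^sup>2 * t\<^sup>2 / 2) * normal_density (\<sigma>\<^sup>2 * t) \<sigma> x" for x
  proof -
    have "- x\<^sup>2 / (2 * \<sigma>\<^sup>2) + t * x = \<sigma>\<^sup>2 * t\<^sup>2 / 2 + (- (x - \<sigma>\<^sup>2 * t)\<^sup>2 / (2 * \<sigma>\<^sup>2))"
      using assms by (simp add: field_simps power2_eq_square)
    then have "exp (- x\<^sup>2 / (2 * \<sigma>\<^sup>2)) * exp (t * x) = exp (\<sigma>\<^sup>2 * t\<^sup>2 / 2) * exp (- (x - \<sigma>\<^sup>2 * t)\<^sup>2 / (2 * \<sigma>\<^sup>2))"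
      by (simp only: exp_add[symmetric])
    then show ?thesis
      unfolding normal_density_def by simp
  qed
  then have "(\<integral>\<^sup>+x. ennreal (normal_density 0 \<sigma> x) * ennreal (exp (t * x)) \<partial>lborel) =
      (\<integral>\<^sup>+x. ennreal (exp (\<sigma>\<^sup>2 * t\<^sup>2 / 2)) * ennreal (normal_density (\<sigma>\<^sup>2 * t) \<sigma> x) \<partial>lborel)"
    by (simp flip: ennreal_mult)
  also have "\<dots> = ennreal (exp (\<sigma>\<^sup>2 * t\<^sup>2 / 2)) * (\<integral>\<^sup>+x. ennreal (normal_density (\<sigma>\<^sup>2 * t) \<sigma> x) \<partial>lborel)"
    by (rule nn_integral_cmult) simp
  also have "(\<integral>\<^sup>+x. ennreal (normal_density (\<sigma>\<^sup>2 * t) \<sigma> x) \<partial>lborel) = 1"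
    using assms by (subst nn_integral_eq_integral) auto
  finally show ?thesis by simp
qed

section \<open>Sequences of independent standard Gaussian variables\<close>

definition gauss :: "real measure" where
  "gauss = density lborel (\<lambda>x. ennreal (std_normal_density x))"

lemma sets_gauss[measurable_cong, simp]: "sets gauss = sets borel"
  and space_gauss[simp]: "space gauss = UNIV"
  by (simp_all add: gauss_def)

interpretation gauss: prob_space gauss
  unfolding gauss_def by (rule prob_space_normal_density) simp

interpretation gauss_seq: sequence_space gauss ..

abbreviation gauss_seq :: "(nat \<Rightarrow> real) measure" where
  "gauss_seq \<equiv> \<Pi>\<^sub>M i\<in>UNIV. gauss"

lemma prob_space_gauss_seq: "prob_space gauss_seq"
  by (rule gauss_seq.P.prob_space_axioms)

lemma gauss_mgf: "(\<integral>\<^sup>+x. ennreal (exp (t * x)) \<partial>gauss) = ennreal (exp (t\<^sup>2 / 2))"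
  using nn_integral_normal_density_exp[of 1 t] by (simp add: gauss_def nn_integral_density)

text \<open>Prepending an independent standard Gaussian coefficient preserves the law of the
  sequence. This is how one coefficient is split off, both in \<open>gauss_seq_mgf\<close> and in
  \<open>chaos_step\<close>.\<close>

lemma nn_integral_gauss_seq_iter:
  assumes [measurable]: "F \<in> borel_measurable gauss_seq"
  shows "(\<integral>\<^sup>+\<omega>. F \<omega> \<partial>gauss_seq) = (\<integral>\<^sup>+s. \<integral>\<^sup>+\<omega>. F (case_nat s \<omega>) \<partial>gauss_seq \<partial>gauss)"
proof -
  have "(\<integral>\<^sup>+\<omega>. F \<omega> \<partial>gauss_seq) = (\<integral>\<^sup>+\<omega>. F \<omega> \<partial>distr (gauss \<Otimes>\<^sub>M gauss_seq) gauss_seq (\<lambda>(s, \<omega>). case_nat s \<omega>))"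
    by (simp only: gauss_seq.PiM_iter)
  also have "\<dots> = (\<integral>\<^sup>+z. F (case_nat (fst z) (snd z)) \<partial>(gauss \<Otimes>\<^sub>M gauss_seq))"
    by (subst nn_integral_distr) (auto simp: split_beta')
  also have "\<dots> = (\<integral>\<^sup>+s. \<integral>\<^sup>+\<omega>. F (case_nat s \<omega>) \<partial>gauss_seq \<partial>gauss)"
    by (subst gauss_seq.P.nn_integral_fst[symmetric]) auto
  finally show ?thesis .
qed

lemma gauss_seq_mgf:
  "(\<integral>\<^sup>+\<omega>. ennreal (exp (\<Sum>k<N. c k * \<omega> k)) \<partial>gauss_seq) = ennreal (exp ((\<Sum>k<N. (c k)\<^sup>2) / 2))"
proof (induction N arbitrary: c)
  case 0
  show ?case using prob_space.emeasure_space_1[OF prob_space_gauss_seq] by simp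
next
  case (Suc N)
  have "(\<integral>\<^sup>+\<omega>. ennreal (exp (\<Sum>k<Suc N. c k * \<omega> k)) \<partial>gauss_seq) =
     (\<integral>\<^sup>+s. \<integral>\<^sup>+\<omega>. ennreal (exp (c 0 * s)) * ennreal (exp (\<Sum>k<N. c (Suc k) * \<omega> k)) \<partial>gauss_seq \<partial>gauss)"
    by (subst nn_integral_gauss_seq_iter)
       (auto simp: sum.lessThan_Suc_shift exp_add ennreal_mult simp del: sum.lessThan_Suc)
  also have "\<dots> = (\<integral>\<^sup>+s. ennreal (exp (c 0 * s)) * ennreal (exp ((\<Sum>k<N. (c (Suc k))\<^sup>2) / 2)) \<partial>gauss)"
    by (simp add: nn_integral_cmult Suc)
  also have "\<dots> = ennreal (exp ((c 0)\<^sup>2 / 2)) * ennreal (exp ((\<Sum>k<N. (c (Suc k))\<^sup>2) / 2))"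
    by (simp add: nn_integral_multc gauss_mgf)
  also have "\<dots> = ennreal (exp ((\<Sum>k<Suc N. (c k)\<^sup>2) / 2))"
    by (simp add: sum.lessThan_Suc_shift add_divide_distrib exp_add ennreal_mult del: sum.lessThan_Suc)
  finally show ?case .
qed

text \<open>Uses \<open>\<bar>y\<bar> \<le> (exp (t y) + exp (- t y)) / t\<close> with
  \<open>t = 2 ^ j\<close>, chosen so that \<open>t y\<close> has variance at most 1. Each
  exponential moment is then at most \<open>exp (1/2) \<le> 2\<close>, and the two together give the
  constant 4.\<close>

lemma gauss_seq_abs_le:
  assumes V: "(\<Sum>k<N. (c k)\<^sup>2) \<le> (1/4) ^ j"
  shows "(\<integral>\<^sup>+\<omega>. ennreal \<bar>\<Sum>k<N. c k * \<omega> k\<bar> \<partial>gauss_seq) \<le> ennreal (4 * (1/2) ^ j)"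
proof -
  let ?t = "2 ^ j :: real"
  have e: "(\<integral>\<^sup>+\<omega>. ennreal (exp (s * (\<Sum>k<N. c k * \<omega> k))) \<partial>gauss_seq) \<le> ennreal 2" if "s\<^sup>2 = ?t\<^sup>2" for s
  proof -
    have *: "(\<integral>\<^sup>+\<omega>. ennreal (exp (s * (\<Sum>k<N. c k * \<omega> k))) \<partial>gauss_seq) = ennreal (exp ((s\<^sup>2 * (\<Sum>k<N. (c k)\<^sup>2)) / 2))"
      using gauss_seq_mgf[of "\<lambda>k. s * c k" N] by (simp add: sum_distrib_left power_mult_distrib mult.assoc)
    have "s\<^sup>2 * (\<Sum>k<N. (c k)\<^sup>2) \<le> ?t\<^sup>2 * (1/4) ^ j"
      using that by (intro mult_mono V) (auto intro: sum_nonneg)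
    also have "?t\<^sup>2 * (1/4) ^ j = 1"
      by (simp add: power2_eq_square power_divide flip: power_mult_distrib)
    finally have "exp ((s\<^sup>2 * (\<Sum>k<N. (c k)\<^sup>2)) / 2) \<le> exp (1/2)" by simp
    also have "exp (1/2) \<le> (2::real)" 
      using exp_half_le2 by simp
    finally show ?thesis unfolding * by (rule ennreal_leI)
  qed
  have "(\<integral>\<^sup>+\<omega>. ennreal \<bar>\<Sum>k<N. c k * \<omega> k\<bar> \<partial>gauss_seq) \<le>
     (\<integral>\<^sup>+\<omega>. ennreal (1 / ?t) * (ennreal (exp (?t * (\<Sum>k<N. c k * \<omega> k))) + ennreal (exp (- ?t * (\<Sum>k<N. c k * \<omega> k)))) \<partial>gauss_seq)"
  proof (rule nn_integral_mono)
    fix \<omega> :: "nat \<Rightarrow> real"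
    define y where "y = (\<Sum>k<N. c k * \<omega> k)"
    have "\<bar>z\<bar> \<le> exp z + exp (- z)" for z :: real
      using exp_ge_add_one_self[of z] exp_ge_add_one_self[of "- z"] exp_gt_zero[of z] exp_gt_zero[of "-z"] 
      unfolding abs_le_iff by (intro conjI) linarith+
    from this[of "?t * y"] have "\<bar>y\<bar> \<le> 1 / ?t * (exp (?t * y) + exp (- ?t * y))"
      by (simp add: abs_mult field_simps)
    then show "ennreal \<bar>y\<bar> \<le> ennreal (1 / ?t) * (ennreal (exp (?t * y)) + ennreal (exp (- ?t * y)))"
      by (simp flip: ennreal_plus ennreal_mult)
  qed
  also have "\<dots> = ennreal (1 / ?t) * ((\<integral>\<^sup>+\<omega>. ennreal (exp (?t * (\<Sum>k<N. c k * \<omega> k))) \<partial>gauss_seq)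
      + (\<integral>\<^sup>+\<omega>. ennreal (exp (- ?t * (\<Sum>k<N. c k * \<omega> k))) \<partial>gauss_seq))"
    by (subst nn_integral_cmult, measurable, subst nn_integral_add) auto
  also have "\<dots> \<le> ennreal (1 / ?t) * (ennreal 2 + ennreal 2)"
    by (intro mult_left_mono add_mono e) auto
  also have "ennreal 2 + ennreal 2 = ennreal 4"
    by (subst ennreal_plus[symmetric]) auto
  also have "ennreal (1 / ?t) * ennreal 4 = ennreal (4 * (1/2) ^ j)"
    by (subst ennreal_mult[symmetric]) (auto simp: power_divide)
  finally show ?thesis .
qed

text \<open>The bound on the second moments of \<open>exp (Y j)\<close> gives uniform integrability:
  truncating at height \<open>R\<close> costs at most \<open>C / R\<close>, for all \<open>j\<close>
  alike, and truncated expectations converge by dominated convergence.\<close>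

lemma (in prob_space) nn_integral_exp_LIMSEQ:
  fixes Y :: "nat \<Rightarrow> 'a \<Rightarrow> real"
  assumes [measurable]: "\<And>j. Y j \<in> borel_measurable M" "Z \<in> borel_measurable M"
    and lim: "AE \<omega> in M. (\<lambda>j. Y j \<omega>) \<longlonglongrightarrow> Z \<omega>"
    and L: "(\<lambda>j. \<integral>\<^sup>+\<omega>. ennreal (exp (Y j \<omega>)) \<partial>M) \<longlonglongrightarrow> L"
    and bd: "\<And>j. (\<integral>\<^sup>+\<omega>. ennreal (exp (2 * Y j \<omega>)) \<partial>M) \<le> ennreal C"
  shows "(\<integral>\<^sup>+\<omega>. ennreal (exp (Z \<omega>)) \<partial>M) = L"
proof -
  have lim1: "(\<lambda>j. \<integral>\<^sup>+\<omega>. min (ennreal (exp (Y j \<omega>))) (of_nat R) \<partial>M) \<longlonglongrightarrow>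
     (\<integral>\<^sup>+\<omega>. min (ennreal (exp (Z \<omega>))) (of_nat R) \<partial>M)" for R
  proof (rule nn_integral_dominated_convergence[where w="\<lambda>_. of_nat R"])
    show "AE \<omega> in M. (\<lambda>j. min (ennreal (exp (Y j \<omega>))) (of_nat R)) \<longlonglongrightarrow> min (ennreal (exp (Z \<omega>))) (of_nat R)"
      using lim by eventually_elim (intro tendsto_intros tendsto_ennrealI)
  qed (auto simp: emeasure_space_1 ennreal_of_nat_eq_real_of_nat)
  have lim2: "(\<lambda>R. \<integral>\<^sup>+\<omega>. min (ennreal (exp (Z \<omega>))) (of_nat R) \<partial>M) \<longlonglongrightarrow> (\<integral>\<^sup>+\<omega>. ennreal (exp (Z \<omega>)) \<partial>M)"
    by (rule nn_integral_LIMSEQ)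
       (auto simp: incseq_def le_fun_def tendsto_min_of_nat_ennreal simp del: min.bounded_iff intro!: min.mono)
  have "(\<integral>\<^sup>+\<omega>. min (ennreal (exp (Z \<omega>))) (of_nat R) \<partial>M) \<le> L" for R
    by (rule tendsto_le[OF _ L lim1]) (auto intro!: always_eventually nn_integral_mono)
  then have le1: "(\<integral>\<^sup>+\<omega>. ennreal (exp (Z \<omega>)) \<partial>M) \<le> L"
    by (intro LIMSEQ_le_const2[OF lim2]) auto
  \<comment> \<open>Pointwise, a value \<open>g > R\<close> satisfies
    \<open>g \<le> g\<^sup>2 / R\<close>.\<close>
  have le: "(\<integral>\<^sup>+\<omega>. ennreal (exp (Y j \<omega>)) \<partial>M) \<le>
      (\<integral>\<^sup>+\<omega>. min (ennreal (exp (Y j \<omega>))) (of_nat R) \<partial>M) + ennreal (C / real R)" if R: "R > 0" for j R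
  proof -
    have "(\<integral>\<^sup>+\<omega>. ennreal (exp (Y j \<omega>)) \<partial>M) \<le>
      (\<integral>\<^sup>+\<omega>. min (ennreal (exp (Y j \<omega>))) (of_nat R) + ennreal (1 / real R) * ennreal (exp (2 * Y j \<omega>)) \<partial>M)"
    proof (rule nn_integral_mono)
      fix \<omega>
      define g where "g = exp (Y j \<omega>)"
      have g: "g > 0" "exp (2 * Y j \<omega>) = g * g"
        by (simp_all add: g_def mult_exp_exp)
      have "ennreal g \<le> min (ennreal g) (of_nat R) + ennreal (1 / real R) * ennreal (g * g)"
      proof (cases "g \<le> real R")
        case True
        then have "min (ennreal g) (of_nat R) = ennreal g"
          by (intro min_absorb1) (simp add: ennreal_of_nat_eq_real_of_nat ennreal_leI)
        then show ?thesis by simp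
      next
        case False
        then have "real R * g \<le> g * g" using g by (intro mult_right_mono) auto
        then have "g \<le> 1 / real R * (g * g)" using R by (simp add: field_simps)
        then have "ennreal g \<le> ennreal (1 / real R) * ennreal (g * g)"
          by (subst ennreal_mult[symmetric]) (use g in \<open>auto intro!: ennreal_leI\<close>)
        then show ?thesis by (simp add: add_increasing)
      qed
      then show "ennreal (exp (Y j \<omega>)) \<le> min (ennreal (exp (Y j \<omega>))) (of_nat R) + ennreal (1 / real R) * ennreal (exp (2 * Y j \<omega>))"
        unfolding g_def[symmetric] g(2) .
    qed
    also have "\<dots> = (\<integral>\<^sup>+\<omega>. min (ennreal (exp (Y j \<omega>))) (of_nat R) \<partial>M) +
        ennreal (1 / real R) * (\<integral>\<^sup>+\<omega>. ennreal (exp (2 * Y j \<omega>)) \<partial>M)"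
      by (subst nn_integral_add, measurable, subst nn_integral_cmult) auto
    also have "\<dots> \<le> (\<integral>\<^sup>+\<omega>. min (ennreal (exp (Y j \<omega>))) (of_nat R) \<partial>M) + ennreal (1 / real R) * ennreal C"
      by (intro add_left_mono mult_left_mono bd) auto
    also have "ennreal (1 / real R) * ennreal C = ennreal (C / real R)"
      by (cases "C \<ge> 0") (simp_all add: ennreal_neg divide_nonpos_nonneg flip: ennreal_mult)
    finally show ?thesis .
  qed
  have "L \<le> (\<integral>\<^sup>+\<omega>. min (ennreal (exp (Z \<omega>))) (of_nat R) \<partial>M) + ennreal (C / real R)" if R: "R > 0" for R
    by (rule tendsto_le[OF _ tendsto_add[OF lim1 tendsto_const] L]) (use le[OF R] in \<open>auto intro!: always_eventually\<close>)
  then have "L \<le> (\<integral>\<^sup>+\<omega>. ennreal (exp (Z \<omega>)) \<partial>M) + ennreal 0"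
    by (intro tendsto_le[OF _ tendsto_add[OF lim2 tendsto_ennrealI[OF lim_const_over_n[of C]]] tendsto_const])
       (auto intro!: eventually_sequentiallyI[of 1])
  with le1 show ?thesis by simp
qed


section \<open>The Gaussian series and its finite-dimensional exponential moments\<close>

locale gaussian_series =
  fixes K :: "'a measure" and h :: "nat \<Rightarrow> 'a \<Rightarrow> real"
  assumes h_measurable: "\<And>k. h k \<in> borel_measurable K"
    and h_summable: "\<And>x. x \<in> space K \<Longrightarrow> summable (\<lambda>k. (h k x)\<^sup>2)"
begin

text \<open>
  Along these cutoffs the increments of the series have summable first moments, which gives almost
  sure convergence at every point without a maximal inequality. As the cutoff may depend on the
  point, pointwise convergence of the covariance series is enough.
\<close>

definition cutoff :: "nat \<Rightarrow> 'a \<Rightarrow> nat" where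
  "cutoff j x = (LEAST m. j \<le> m \<and> (\<forall>n. (\<Sum>k=m..<n. (h k x)\<^sup>2) \<le> (1/4) ^ j))"

lemma cutoff_props:
  assumes x: "x \<in> space K"
  shows "j \<le> cutoff j x" "(\<Sum>k=cutoff j x..<n. (h k x)\<^sup>2) \<le> (1/4) ^ j"
proof -
  obtain N where N: "\<And>m n. m \<ge> N \<Longrightarrow> norm (\<Sum>k=m..<n. (h k x)\<^sup>2) < (1/4) ^ j"
    using h_summable[OF x] unfolding summable_Cauchy by (metis zero_less_power zero_less_divide_1_iff zero_less_numeral)
  have "j \<le> max j N \<and> (\<forall>n. (\<Sum>k=max j N..<n. (h k x)\<^sup>2) \<le> (1/4) ^ j)"
    using N[of "max j N"] by (auto simp: abs_less_iff less_imp_le)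
  then have "j \<le> cutoff j x \<and> (\<forall>n. (\<Sum>k=cutoff j x..<n. (h k x)\<^sup>2) \<le> (1/4) ^ j)"
    unfolding cutoff_def by (rule LeastI)
  then show "j \<le> cutoff j x" "(\<Sum>k=cutoff j x..<n. (h k x)\<^sup>2) \<le> (1/4) ^ j" by auto
qed

lemma measurable_cutoff[measurable]: "cutoff j \<in> K \<rightarrow>\<^sub>M count_space UNIV"
proof -
  note h_measurable[measurable]
  show ?thesis unfolding cutoff_def by measurable
qed

text \<open>
  The first \<open>n\<close> coefficients are dropped and the others are indexed from 0; thus \<open>case_nat s \<omega>\<close> puts
  the coefficient \<open>s\<close> of \<open>h n\<close> in front of the coefficients \<open>\<omega>\<close> of the functions \<open>h k\<close>, \<open>k > n\<close>.
\<close>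

definition partial :: "nat \<Rightarrow> nat \<Rightarrow> 'a \<Rightarrow> (nat \<Rightarrow> real) \<Rightarrow> real" where
  "partial n j x \<omega> = (\<Sum>k<cutoff j x - n. h (n + k) x * \<omega> k)"

text \<open>A pointwise \<open>lim\<close> of jointly measurable functions is jointly measurable.
  Where the limit does not exist the value is unspecified; for each fixed \<open>x\<close> this
  concerns a null event only.\<close>

definition field :: "nat \<Rightarrow> 'a \<Rightarrow> (nat \<Rightarrow> real) \<Rightarrow> real" where
  "field n x \<omega> = lim (\<lambda>j. partial n j x \<omega>)"

text \<open>The number of summands depends on \<open>x\<close>, so the sum is cut into countably
  many cases by the value of the cutoff.\<close>

lemma measurable_partial[measurable]: "(\<lambda>(\<omega>, x). partial n j x \<omega>) \<in> borel_measurable (gauss_seq \<Otimes>\<^sub>M K)"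
proof -
  note h_measurable[measurable]
  have "(\<lambda>z. (\<Sum>k<i - n. h (n + k) (snd z) * fst z k)) \<in> borel_measurable (gauss_seq \<Otimes>\<^sub>M K)" for i
    by measurable
  from measurable_compose_countable[OF this, of "\<lambda>z. cutoff j (snd z)"]
  show ?thesis unfolding partial_def split_beta' by measurable
qed

lemma measurable_field[measurable]: "(\<lambda>(\<omega>, x). field n x \<omega>) \<in> borel_measurable (gauss_seq \<Otimes>\<^sub>M K)"
  using measurable_partial unfolding field_def split_beta' by measurable

lemma measurable_partial_at: "x \<in> space K \<Longrightarrow> partial n j x \<in> borel_measurable gauss_seq"
  using measurable_Pair1[OF measurable_partial, of x] by simp

lemma measurable_field_at: "x \<in> space K \<Longrightarrow> field n x \<in> borel_measurable gauss_seq"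
  using measurable_Pair1[OF measurable_field, of x] by simp

text \<open>The cutoff of level \<open>Suc j\<close> satisfies the stronger tail bound and hence
  competes in the minimum that defines level \<open>j\<close>.\<close>

lemma cutoff_mono:
  assumes x: "x \<in> space K" shows "cutoff j x \<le> cutoff (Suc j) x"
proof -
  have "(\<Sum>k=cutoff (Suc j) x..<n. (h k x)\<^sup>2) \<le> (1/4) ^ j" for n
    using cutoff_props(2)[OF x, of "Suc j" n]
    by (rule order_trans) (intro power_decreasing, auto)
  moreover have "j \<le> cutoff (Suc j) x" using cutoff_props(1)[OF x, of "Suc j"] by simp
  ultimately show ?thesis
    by (subst (1) cutoff_def) (auto intro!: Least_le)
qed

lemma AE_convergent:
  assumes x: "x \<in> space K"
  shows "AE \<omega> in gauss_seq. convergent (\<lambda>j. partial n j x \<omega>)"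
proof -
  note [measurable] = measurable_partial_at[OF x]
  let ?d = "\<lambda>j \<omega>. partial n (Suc j) x \<omega> - partial n j x \<omega>"
  \<comment> \<open>Padding with zeros below the earlier cutoff turns the increment into a sum that
    starts at index 0, the form \<open>gauss_seq_abs_le\<close> takes.\<close>
  define c where "c j k = (if cutoff j x - n \<le> k then h (n + k) x else 0)" for j k
  have d: "?d j \<omega> = (\<Sum>k<cutoff (Suc j) x - n. c j k * \<omega> k)" for j \<omega>
  proof -
    have le: "cutoff j x - n \<le> cutoff (Suc j) x - n" using cutoff_mono[OF x] by (rule diff_le_mono)
    have "(\<Sum>k<cutoff (Suc j) x - n. c j k * \<omega> k) = (\<Sum>k\<in>{..<cutoff (Suc j) x - n} - {..<cutoff j x - n}. h (n + k) x * \<omega> k)"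
      by (rule sum.mono_neutral_cong_right) (auto simp: c_def)
    also have "\<dots> = ?d j \<omega>"
      unfolding partial_def using le by (subst sum_diff) auto
    finally show ?thesis by simp
  qed
  have V: "(\<Sum>k<cutoff (Suc j) x - n. (c j k)\<^sup>2) \<le> (1/4) ^ j" for j
  proof -
    have "(\<Sum>k<cutoff (Suc j) x - n. (c j k)\<^sup>2) = (\<Sum>k\<in>{cutoff j x - n..<cutoff (Suc j) x - n}. (h (n + k) x)\<^sup>2)"
      by (rule sum.mono_neutral_cong_right) (auto simp: c_def)
    also have "\<dots> = (\<Sum>i\<in>(+) n ` {cutoff j x - n..<cutoff (Suc j) x - n}. (h i x)\<^sup>2)"
      by (subst sum.reindex) auto
    \<comment> \<open>Only an inequality: if \<open>n\<close> exceeds \<open>cutoff j x\<close>, the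
      truncated subtraction leaves out the indices below \<open>n\<close>.\<close>
    also have "\<dots> \<le> (\<Sum>i=cutoff j x..<cutoff (Suc j) x. (h i x)\<^sup>2)"
      by (rule sum_mono2) auto
    also have "\<dots> \<le> (1/4) ^ j" by (rule cutoff_props[OF x])
    finally show ?thesis .
  qed
  have "(\<integral>\<^sup>+\<omega>. (\<Sum>j. ennreal \<bar>?d j \<omega>\<bar>) \<partial>gauss_seq) = (\<Sum>j. \<integral>\<^sup>+\<omega>. ennreal \<bar>?d j \<omega>\<bar> \<partial>gauss_seq)"
    by (intro nn_integral_suminf) measurable
  also have "\<dots> \<le> (\<Sum>j. ennreal (4 * (1/2) ^ j))"
    unfolding d by (intro suminf_le gauss_seq_abs_le V) auto
  also have "\<dots> = ennreal (\<Sum>j. 4 * (1/2) ^ j)"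
    by (intro suminf_ennreal2) (auto intro!: summable_mult summable_geometric)
  finally have "(\<integral>\<^sup>+\<omega>. (\<Sum>j. ennreal \<bar>?d j \<omega>\<bar>) \<partial>gauss_seq) \<noteq> \<infinity>"
    by (metis ennreal_less_top infinity_ennreal_def le_less_trans less_irrefl)
  then have "AE \<omega> in gauss_seq. (\<Sum>j. ennreal \<bar>?d j \<omega>\<bar>) \<noteq> \<infinity>"
    by (intro nn_integral_PInf_AE) measurable
  then show ?thesis
  proof eventually_elim
    case (elim \<omega>)
    then have "summable (\<lambda>j. \<bar>?d j \<omega>\<bar>)"
      by (intro summable_suminf_not_top) simp_all
    then have "summable (\<lambda>j. ?d j \<omega>)" by (rule summable_rabs_cancel)
    then have "convergent (\<lambda>m. \<Sum>j<m. ?d j \<omega>)" by (simp add: summable_iff_convergent)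
    then have "convergent (\<lambda>m. partial n m x \<omega> - partial n 0 x \<omega>)"
      by (simp only: sum_lessThan_telescope[of "\<lambda>j. partial n j x \<omega>"])
    then show ?case
      using convergent_add[OF _ convergent_const[of "partial n 0 x \<omega>"]] by fastforce
  qed
qed

lemma AE_partial_LIMSEQ:
  "x \<in> space K \<Longrightarrow> AE \<omega> in gauss_seq. (\<lambda>j. partial n j x \<omega>) \<longlonglongrightarrow> field n x \<omega>"
  using AE_convergent[of x n] unfolding field_def by (simp add: convergent_LIMSEQ_iff)

lemma field_case_nat:
  assumes x: "x \<in> space K" and c: "convergent (\<lambda>j. partial (Suc n) j x \<omega>)"
  shows "field n x (case_nat s \<omega>) = s * h n x + field (Suc n) x \<omega>"
proof -
  \<comment> \<open>The clause \<open>j \<le> m\<close> in \<open>cutoff\<close> guarantees that the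
    term of \<open>h n\<close> is present as soon as \<open>j > n\<close>.\<close>
  have "partial n j x (case_nat s \<omega>) = s * h n x + partial (Suc n) j x \<omega>" if "j > n" for j
  proof -
    have "n < cutoff j x" using cutoff_props(1)[OF x, of j] that by simp
    then have "cutoff j x - n = Suc (cutoff j x - Suc n)" by simp
    then show ?thesis unfolding partial_def
      by (simp add: sum.lessThan_Suc_shift del: sum.lessThan_Suc)
  qed
  then have "eventually (\<lambda>j. s * h n x + partial (Suc n) j x \<omega> = partial n j x (case_nat s \<omega>)) sequentially"
    by (intro eventually_sequentiallyI[of "Suc n"]) auto
  moreover have "(\<lambda>j. s * h n x + partial (Suc n) j x \<omega>) \<longlonglongrightarrow> s * h n x + field (Suc n) x \<omega>"
    using c unfolding field_def by (intro tendsto_intros) (simp add: convergent_LIMSEQ_iff)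
  ultimately have "(\<lambda>j. partial n j x (case_nat s \<omega>)) \<longlonglongrightarrow> s * h n x + field (Suc n) x \<omega>"
    by (rule Lim_transform_eventually[rotated])
  then show ?thesis unfolding field_def[of n] by (rule limI)
qed

text \<open>\<open>coef\<close> and \<open>pcoef\<close> are the coefficients of
  \<open>\<omega> k\<close> in a linear combination of values of \<open>field n\<close> and of
  \<open>partial n j\<close>; \<open>acoef\<close> is a square summable majorant of the latter for
  all \<open>j\<close>.\<close>

abbreviation coef :: "nat \<Rightarrow> (real \<times> 'a) list \<Rightarrow> nat \<Rightarrow> real" where
  "coef n l k \<equiv> (\<Sum>(a, x)\<leftarrow>l. a * h (n + k) x)"

abbreviation pcoef :: "nat \<Rightarrow> nat \<Rightarrow> (real \<times> 'a) list \<Rightarrow> nat \<Rightarrow> real" where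
  "pcoef n j l k \<equiv> (\<Sum>(a, x)\<leftarrow>l. if k < cutoff j x - n then a * h (n + k) x else 0)"

abbreviation acoef :: "nat \<Rightarrow> (real \<times> 'a) list \<Rightarrow> nat \<Rightarrow> real" where
  "acoef n l k \<equiv> (\<Sum>(a, x)\<leftarrow>l. \<bar>a * h (n + k) x\<bar>)"

lemma lin_comb_partial:
  assumes "\<And>a x. (a, x) \<in> set l \<Longrightarrow> cutoff j x \<le> N"
  shows "lin_comb (partial n j) l \<omega> = (\<Sum>k<N. pcoef n j l k * \<omega> k)"
  using assms
proof (induction l)
  case (Cons p l)
  obtain a x where p: "p = (a, x)" by (cases p)
  have "partial n j x \<omega> = (\<Sum>k<N. if k < cutoff j x - n then h (n + k) x * \<omega> k else 0)"
    unfolding partial_def using Cons.prems[of a x] p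
    by (intro sum.mono_neutral_cong_left) auto
  then have "a * partial n j x \<omega> = (\<Sum>k<N. (if k < cutoff j x - n then a * h (n + k) x else 0) * \<omega> k)"
    by (auto simp: sum_distrib_left intro!: sum.cong)
  moreover have "lin_comb (partial n j) l \<omega> = (\<Sum>k<N. pcoef n j l k * \<omega> k)"
    using Cons.prems by (intro Cons.IH) auto
  ultimately show ?case by (simp add: p sum.distrib[symmetric] distrib_right)
qed simp

lemma pcoef_le: "\<bar>pcoef n j l k\<bar> \<le> acoef n l k"
proof (induction l)
  case (Cons p l)
  then show ?case
    by (cases p) (auto intro!: order_trans[OF abs_triangle_ineq] add_mono simp: add_increasing)
qed simp

lemma acoef_summable:
  assumes "snd ` set l \<subseteq> space K" shows "summable (\<lambda>k. (acoef n l k)\<^sup>2)"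
  using assms
proof (induction l)
  case (Cons p l)
  obtain a x where p: "p = (a, x)" by (cases p)
  have "summable (\<lambda>k. (h (n + k) x)\<^sup>2)"
    using h_summable[of x] Cons.prems p summable_iff_shift[of "\<lambda>k. (h k x)\<^sup>2" n] by (simp add: add.commute)
  then have s: "summable (\<lambda>k. 2 * \<bar>a * h (n + k) x\<bar>\<^sup>2 + 2 * (acoef n l k)\<^sup>2)"
    using Cons by (intro summable_add summable_mult) (auto simp: power_mult_distrib abs_mult intro!: summable_mult)
  show ?case
  proof (rule summable_comparison_test'[OF s])
    have "(u + v)\<^sup>2 \<le> 2 * u\<^sup>2 + 2 * v\<^sup>2" for u v :: real
      using zero_le_power2[of "u - v"] by (simp add: power2_eq_square algebra_simps)
    from this[of "\<bar>a * h (n + k) x\<bar>" "acoef n l k" for k]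
    show "norm ((acoef n (p # l) k)\<^sup>2) \<le> 2 * \<bar>a * h (n + k) x\<bar>\<^sup>2 + 2 * (acoef n l k)\<^sup>2" for k
      by (simp add: p)
  qed
qed simp

lemma pcoef_LIMSEQ:
  assumes "snd ` set l \<subseteq> space K" shows "(\<lambda>j. pcoef n j l k) \<longlonglongrightarrow> coef n l k"
  using assms
proof (induction l)
  case (Cons p l)
  obtain a x where p: "p = (a, x)" by (cases p)
  have "(\<lambda>j. if k < cutoff j x - n then a * h (n + k) x else 0) \<longlonglongrightarrow> a * h (n + k) x"
  proof (rule tendsto_eventually, rule eventually_sequentiallyI)
    fix j assume "Suc (n + k) \<le> j"
    then have "k < cutoff j x - n" using cutoff_props(1)[of x j] Cons.prems p by auto
    then show "(if k < cutoff j x - n then a * h (n + k) x else 0) = a * h (n + k) x" by simp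
  qed
  with Cons show ?case by (auto simp: p intro!: tendsto_add)
qed simp

lemma partial_mgf:
  assumes "snd ` set l \<subseteq> space K"
  shows "(\<integral>\<^sup>+\<omega>. ennreal (exp (lin_comb (partial n j) l \<omega>)) \<partial>gauss_seq) = ennreal (exp ((\<Sum>k. (pcoef n j l k)\<^sup>2) / 2))"
proof -
  \<comment> \<open>Each point has its own cutoff; \<open>N\<close> lies above all that occur in
    \<open>l\<close>, so all coefficients vanish from \<open>N\<close> on.\<close>
  define N where "N = Max (insert 0 ((\<lambda>(a, x). cutoff j x) ` set l))"
  have N: "cutoff j x \<le> N" if "(a, x) \<in> set l" for a x
    unfolding N_def using that by (intro Max_ge) (auto intro!: image_eqI[of _ _ "(a, x)"])
  have "pcoef n j l k = 0" if "k \<ge> N" for k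
    using N
  proof (induction l)
    case (Cons p l)
    then have "pcoef n j l k = 0" by (meson list.set_intros(2))
    moreover have "cutoff j (snd p) \<le> N" using Cons.prems[of "fst p" "snd p"] by simp
    ultimately show ?case using that by (simp add: split_beta')
  qed simp
  then have "(\<Sum>k. (pcoef n j l k)\<^sup>2) = (\<Sum>k<N. (pcoef n j l k)\<^sup>2)"
    by (intro suminf_finite) (auto simp: not_less)
  then show ?thesis
    using gauss_seq_mgf[of "pcoef n j l" N] lin_comb_partial[of l j N n, OF N] by simp
qed

text \<open>Both sides pass to the limit in \<open>j\<close>: the variances by Tannery's theorem
  with majorant \<open>acoef\<close> squared, the exponential moments by
  \<open>nn_integral_exp_LIMSEQ\<close>.\<close>

lemma field_mgf:
  assumes l: "snd ` set l \<subseteq> space K"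
  shows "(\<integral>\<^sup>+\<omega>. ennreal (exp (lin_comb (field n) l \<omega>)) \<partial>gauss_seq) = ennreal (exp ((\<Sum>k. (coef n l k)\<^sup>2) / 2))"
proof -
  have b: "norm ((pcoef n j l k)\<^sup>2) \<le> (acoef n l k)\<^sup>2" for j k
    using power_mono[OF pcoef_le[where n=n and j=j and l=l and k=k], of 2] by simp
  have sm: "summable (\<lambda>k. (acoef n l k)\<^sup>2)" using l by (rule acoef_summable)
  have lim: "(\<lambda>j. \<Sum>k. (pcoef n j l k)\<^sup>2) \<longlonglongrightarrow> (\<Sum>k. (coef n l k)\<^sup>2)"
    by (rule tannerys_theorem[where M="\<lambda>k. (acoef n l k)\<^sup>2", THEN conjunct2, THEN conjunct2])
       (auto intro!: tendsto_power pcoef_LIMSEQ[OF l] always_eventually sm b[simplified])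
  \<comment> \<open>The second moments of the exponentials are first moments for the list with
    doubled coefficients, so \<open>partial_mgf\<close> bounds them as well.\<close>
  have d: "lin_comb X (map (\<lambda>(a, x). (2 * a, x)) l) \<omega> = 2 * lin_comb X l \<omega>" for X \<omega>
    by (induction l) (auto simp: algebra_simps)
  have d2: "pcoef n j (map (\<lambda>(a, x). (2 * a, x)) l) k = 2 * pcoef n j l k" for j k
    by (induction l) (auto simp: algebra_simps)
  show ?thesis
  proof (rule prob_space.nn_integral_exp_LIMSEQ[OF prob_space_gauss_seq])
    show "lin_comb (partial n j) l \<in> borel_measurable gauss_seq" for j
      using l by (auto intro!: measurable_lin_comb measurable_partial_at)
    show "lin_comb (field n) l \<in> borel_measurable gauss_seq"
      using l by (auto intro!: measurable_lin_comb measurable_field_at)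
    show "AE \<omega> in gauss_seq. (\<lambda>j. lin_comb (partial n j) l \<omega>) \<longlonglongrightarrow> lin_comb (field n) l \<omega>"
      using l
    proof (induction l)
      case (Cons p l)
      obtain a x where p: "p = (a, x)" by (cases p)
      have "AE \<omega> in gauss_seq. (\<lambda>j. partial n j x \<omega>) \<longlonglongrightarrow> field n x \<omega>"
        using Cons.prems p by (intro AE_partial_LIMSEQ) auto
      moreover have "AE \<omega> in gauss_seq. (\<lambda>j. lin_comb (partial n j) l \<omega>) \<longlonglongrightarrow> lin_comb (field n) l \<omega>"
        using Cons by auto
      ultimately show ?case
        by eventually_elim (auto simp: p intro!: tendsto_intros)
    qed simp
    show "(\<lambda>j. \<integral>\<^sup>+\<omega>. ennreal (exp (lin_comb (partial n j) l \<omega>)) \<partial>gauss_seq) \<longlonglongrightarrow> ennreal (exp ((\<Sum>k. (coef n l k)\<^sup>2) / 2))"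
      unfolding partial_mgf[OF l] by (intro tendsto_intros lim tendsto_ennrealI) auto
    show "(\<integral>\<^sup>+\<omega>. ennreal (exp (2 * lin_comb (partial n j) l \<omega>)) \<partial>gauss_seq) \<le> ennreal (exp ((\<Sum>k. 4 * (acoef n l k)\<^sup>2) / 2))" for j
    proof -
      have "(\<Sum>k. (2 * pcoef n j l k)\<^sup>2) \<le> (\<Sum>k. 4 * (acoef n l k)\<^sup>2)"
        using b sm
        by (intro suminf_le summable_mult) (auto intro!: summable_mult summable_comparison_test'[OF sm] simp: power_mult_distrib)
      moreover have "snd ` set (map (\<lambda>(a, x). (2 * a, x)) l) \<subseteq> space K" using l by auto
      note partial_mgf[OF this, of n j, unfolded d d2]
      ultimately show ?thesis by (simp only:) (intro ennreal_leI, simp)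
    qed
  qed
qed

end

section \<open>Deconvolution of one coefficient\<close>

text \<open>One half of the 1-Lipschitz continuity of \<open>exp (- z)\<close>, in an additive form
  that avoids subtraction in \<open>ennreal\<close> and makes sense at infinity.\<close>

lemma expn_lipschitz:
  assumes "a \<le> b + r" shows "expn b \<le> expn a + r"
proof (cases r)
  case (real s)
  show ?thesis
  proof (cases b)
    case (real c)
    have "exp (- c) \<le> exp (- (c + s)) + s"
    proof -
      have "1 - exp (- s) \<le> s" using exp_ge_add_one_self[of "- s"] by simp
      moreover have "exp (- c) * (1 - exp (- s)) \<le> 1 * (1 - exp (- s))"
        using \<open>0 \<le> c\<close> \<open>0 \<le> s\<close> by (intro mult_right_mono) auto
      ultimately have "exp (- (c + s)) + exp (- c) * (1 - exp (- s)) \<le> exp (- (c + s)) + s"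
        by (intro add_left_mono) simp
      also have "exp (- (c + s)) + exp (- c) * (1 - exp (- s)) = exp (- c)"
        by (simp add: right_diff_distrib mult_exp_exp)
      finally show ?thesis .
    qed
    then have "expn b \<le> expn (b + r) + r"
      using real \<open>r = ennreal s\<close> \<open>0 \<le> s\<close> by (simp add: expn_ennreal ennreal_leI flip: ennreal_plus)
    also have "\<dots> \<le> expn a + r" by (intro add_right_mono expn_antimono assms)
    finally show ?thesis .
  qed simp
qed simp

text \<open>The one-dimensional Cameron-Martin formula: tilting the Gaussian by
  \<open>exp (t * s)\<close> is the same as translating it by \<open>t\<close>, up to
  normalisation.\<close>

lemma gauss_translate:
  fixes g :: "real \<Rightarrow> ennreal"
  assumes [measurable]: "g \<in> borel_measurable borel"
  shows "(\<integral>\<^sup>+s. g s * ennreal (exp (t * s)) \<partial>gauss) = ennreal (exp (t\<^sup>2 / 2)) * (\<integral>\<^sup>+s. g (t + s) \<partial>gauss)"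
proof -
  have e: "std_normal_density (t + s) * exp (t * (t + s)) = exp (t\<^sup>2 / 2) * std_normal_density s" for s
  proof -
    have "- (t + s)\<^sup>2 / 2 + t * (t + s) = t\<^sup>2 / 2 + (- s\<^sup>2 / 2)"
      by (simp add: power2_eq_square field_simps)
    then have "exp (- (t + s)\<^sup>2 / 2) * exp (t * (t + s)) = exp (t\<^sup>2 / 2) * exp (- s\<^sup>2 / 2)"
      by (simp only: exp_add[symmetric])
    then show ?thesis by (simp add: std_normal_density_def)
  qed
  have "(\<integral>\<^sup>+s. g s * ennreal (exp (t * s)) \<partial>gauss) =
      (\<integral>\<^sup>+s. ennreal (std_normal_density s) * (g s * ennreal (exp (t * s))) \<partial>lborel)"
    unfolding gauss_def by (subst nn_integral_density) auto
  also have "\<dots> = (\<integral>\<^sup>+s. ennreal (std_normal_density (t + s)) * (g (t + s) * ennreal (exp (t * (t + s)))) \<partial>lborel)"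
    using nn_integral_real_affine[of "\<lambda>s. ennreal (std_normal_density s) * (g s * ennreal (exp (t * s)))" 1 t] by simp
  also have "\<dots> = (\<integral>\<^sup>+s. ennreal (exp (t\<^sup>2 / 2)) * (ennreal (std_normal_density s) * g (t + s)) \<partial>lborel)"
  proof (rule nn_integral_cong)
    fix s
    have "ennreal (std_normal_density (t + s)) * (g (t + s) * ennreal (exp (t * (t + s)))) = 
      ennreal (std_normal_density (t + s) * exp (t * (t + s))) * g (t + s)"
      by (simp add: ennreal_mult mult_ac)
    then show "ennreal (std_normal_density (t + s)) * (g (t + s) * ennreal (exp (t * (t + s)))) = 
      ennreal (exp (t\<^sup>2 / 2)) * (ennreal (std_normal_density s) * g (t + s))"
      unfolding e by (simp add: ennreal_mult mult_ac)
  qed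
  also have "\<dots> = ennreal (exp (t\<^sup>2 / 2)) * (\<integral>\<^sup>+s. g (t + s) \<partial>gauss)"
    unfolding gauss_def by (subst nn_integral_cmult) (auto simp: nn_integral_density)
  finally show ?thesis .
qed

text \<open>By \<open>gauss_translate\<close> the hypothesis says that
  \<open>density gauss g\<close> and \<open>density gauss g'\<close> have the same moment generating
  function. So \<open>g\<close> and \<open>g'\<close> agree almost everywhere, and right continuity
  transfers this to the point 0.\<close>

lemma gauss_deconvolution:
  fixes g g' :: "real \<Rightarrow> ennreal"
  assumes [measurable]: "g \<in> borel_measurable borel" "g' \<in> borel_measurable borel"
    and le1: "\<And>s. g s \<le> 1"
    and cont: "(g \<longlongrightarrow> g 0) (at_right 0)" "(g' \<longlongrightarrow> g' 0) (at_right 0)"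
    and eq: "\<And>t. (\<integral>\<^sup>+s. g (t + s) \<partial>gauss) = (\<integral>\<^sup>+s. g' (t + s) \<partial>gauss)"
  shows "g 0 = g' 0"
proof -
  have mgf: "(\<integral>\<^sup>+s. ennreal (exp (t * s)) \<partial>density gauss u) = ennreal (exp (t\<^sup>2 / 2)) * (\<integral>\<^sup>+s. u (t + s) \<partial>gauss)"
    if [measurable]: "u \<in> borel_measurable borel" for u t
    by (subst nn_integral_density) (auto simp: gauss_translate[symmetric])
  have fin: "(\<integral>\<^sup>+s. g (t + s) \<partial>gauss) < \<infinity>" for t
  proof -
    have "(\<integral>\<^sup>+s. g (t + s) \<partial>gauss) \<le> (\<integral>\<^sup>+s. 1 \<partial>gauss)" by (intro nn_integral_mono le1)
    then show ?thesis by (rule le_less_trans) (use gauss.emeasure_space_1 in simp)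
  qed
  have "density gauss g = density gauss g'"
    by (rule measure_eqI_mgf) (use fin in \<open>auto simp: mgf eq ennreal_mult_less_top\<close>)
  then have "AE s in gauss. g s = g' s"
    by (subst (asm) gauss.density_unique_iff) auto
  \<comment> \<open>The Gaussian density is positive everywhere, so a Gaussian null set is a
    Lebesgue null set.\<close>
  then have ae: "AE s in lborel. g s = g' s"
    unfolding gauss_def by (subst (asm) AE_density) (auto simp: normal_density_pos)
  \<comment> \<open>An interval to the right of 0 has positive length and cannot lie in the
    exceptional null set.\<close>
  have ex: "\<exists>s. 0 < s \<and> s < e \<and> g s = g' s" if "e > 0" for e
  proof (rule ccontr)
    assume "\<not> ?thesis"
    then have "AE s in lborel. s \<notin> {0<..<e}" using ae by (auto elim: AE_mp)
    then have "emeasure lborel {0<..<e} = 0" by (subst (asm) AE_iff_measurable[where N="{0<..<e}"]) auto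
    then show False using that by simp
  qed
  have "\<exists>s. \<forall>i. 0 < s i \<and> s i < inverse (real (Suc i)) \<and> g (s i) = g' (s i)"
    using ex by (intro choice allI) auto
  then obtain s where s: "\<And>i. 0 < s i" "\<And>i. s i < inverse (real (Suc i))" "\<And>i. g (s i) = g' (s i)" by auto
  have "s \<longlonglongrightarrow> 0"
    by (rule tendsto_sandwich[OF _ _ tendsto_const LIMSEQ_inverse_real_of_nat])
       (use s in \<open>auto intro!: always_eventually less_imp_le\<close>)
  then have lim: "filterlim s (at_right 0) sequentially"
    using s(1) by (auto simp: filterlim_at less_imp_neq[symmetric] intro!: always_eventually)
  have "(\<lambda>i. g (s i)) \<longlonglongrightarrow> g 0" "(\<lambda>i. g' (s i)) \<longlonglongrightarrow> g' 0"
    using cont lim by (auto intro: filterlim_compose)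
  then show ?thesis unfolding s(3) by (rule LIMSEQ_unique)
qed

section \<open>Laplace functionals of the multiplicative chaos of a fixed measure\<close>

context gaussian_series
begin

text \<open>This is the variance of \<open>field n x\<close>, as \<open>field_exp_moment\<close>
  shows.\<close>

abbreviation tail_var :: "nat \<Rightarrow> 'a \<Rightarrow> real" where
  "tail_var n x \<equiv> (\<Sum>k. (h (n + k) x)\<^sup>2)"

lemma tail_summable: "x \<in> space K \<Longrightarrow> summable (\<lambda>k. (h (n + k) x)\<^sup>2)"
  using h_summable[of x] summable_iff_shift[of "\<lambda>k. (h k x)\<^sup>2" n] by (simp add: add.commute)

lemma field_exp_moment:
  assumes "x \<in> space K"
  shows "(\<integral>\<^sup>+\<omega>. ennreal (exp (t * field n x \<omega>)) \<partial>gauss_seq) = ennreal (exp (t\<^sup>2 * tail_var n x / 2))"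
  using field_mgf[of "[(t, x)]" n] assms tail_summable[OF assms, of n]
  by (simp add: power_mult_distrib suminf_mult)

lemma tail_var_eq:
  assumes "x \<in> space K" shows "tail_var n x = tail_var 0 x - (\<Sum>k<n. (h k x)\<^sup>2)"
  using suminf_minus_initial_segment[OF h_summable[OF assms], of n] by (simp add: add.commute)

lemma tail_var_le: "x \<in> space K \<Longrightarrow> tail_var n x \<le> tail_var 0 x"
  by (subst tail_var_eq) (auto intro: sum_nonneg)

lemma tail_var_LIMSEQ:
  assumes "x \<in> space K" shows "(\<lambda>n. tail_var n x) \<longlonglongrightarrow> 0"
proof -
  have "(\<lambda>n. tail_var 0 x - (\<Sum>k<n. (h k x)\<^sup>2)) \<longlonglongrightarrow> tail_var 0 x - tail_var 0 x"
    using summable_LIMSEQ[OF h_summable[OF assms]] by (intro tendsto_intros) simp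
  then show ?thesis by (subst tail_var_eq[OF assms]) simp
qed

lemma field_exp_integrable:
  assumes x: "x \<in> space K"
  shows "integrable gauss_seq (\<lambda>\<omega>. exp (t * field n x \<omega>))"
    "(LINT \<omega>|gauss_seq. exp (t * field n x \<omega>)) = exp (t\<^sup>2 * tail_var n x / 2)"
proof -
  note [measurable] = measurable_field_at[OF x]
  show "integrable gauss_seq (\<lambda>\<omega>. exp (t * field n x \<omega>))"
    by (simp add: integrable_iff_bounded field_exp_moment[OF x])
  show "(LINT \<omega>|gauss_seq. exp (t * field n x \<omega>)) = exp (t\<^sup>2 * tail_var n x / 2)"
    by (simp add: integral_eq_nn_integral field_exp_moment[OF x])
qed

lemma field_exp_L1:
  assumes x: "x \<in> space K"
  shows "(\<lambda>n. \<integral>\<^sup>+\<omega>. ennreal \<bar>exp (field n x \<omega>) - 1\<bar> \<partial>gauss_seq) \<longlonglongrightarrow> 0"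
proof (rule order_tendstoI)
  fix e :: ennreal assume "0 < e"
  obtain r where r: "0 < r" "ennreal r < e"
  proof (cases e)
    case (real s)
    with \<open>0 < e\<close> show ?thesis by (intro that[of "s / 2"]) (auto simp: ennreal_less_iff)
  qed (use that[of 1] in auto)
  note [measurable] = measurable_field_at[OF x]
  \<comment> \<open>The second moment of \<open>exp (field n x) - 1\<close>, expanded by the
    Gaussian exponential moments at 2 and at 1.\<close>
  define q where "q n = exp (2 * tail_var n x) - 2 * exp (tail_var n x / 2) + 1" for n
  have "q \<longlonglongrightarrow> exp (2 * 0) - 2 * exp (0 / 2) + 1"
    unfolding q_def by (intro tendsto_intros tail_var_LIMSEQ x) simp_all
  then have "eventually (\<lambda>n. q n < r\<^sup>2 / 4) sequentially"
    by (rule order_tendstoD) (use r in simp)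
  then show "eventually (\<lambda>n. (\<integral>\<^sup>+\<omega>. ennreal \<bar>exp (field n x \<omega>) - 1\<bar> \<partial>gauss_seq) < e) sequentially"
  proof eventually_elim
    case (elim n)
    let ?u = "\<lambda>\<omega>. exp (field n x \<omega>) - 1"
    note i1 = field_exp_integrable[OF x, of 1 n, simplified] and i2 = field_exp_integrable[OF x, of 2 n]
    have sq: "(?u \<omega>)\<^sup>2 = exp (2 * field n x \<omega>) - 2 * exp (field n x \<omega>) + 1" for \<omega>
      by (simp add: power2_eq_square algebra_simps mult_exp_exp)
    have isq: "integrable gauss_seq (\<lambda>\<omega>. (?u \<omega>)\<^sup>2)"
      unfolding sq by (intro Bochner_Integration.integrable_add Bochner_Integration.integrable_diff integrable_mult_right i1 i2) auto
    have "(LINT \<omega>|gauss_seq. (?u \<omega>)\<^sup>2) = q n"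
      unfolding sq q_def using i1 i2 gauss_seq.P.prob_space by simp
    \<comment> \<open>Values of modulus above \<open>r / 2\<close> are paid for by the square.
      Together with \<open>q n < r\<^sup>2 / 4\<close> the two terms contribute \<open>r / 2\<close>
      each.\<close>
    moreover have "(LINT \<omega>|gauss_seq. \<bar>?u \<omega>\<bar>) \<le> (LINT \<omega>|gauss_seq. r / 2 + (2 / r) * (?u \<omega>)\<^sup>2)"
    proof (rule integral_mono)
      show "\<bar>?u \<omega>\<bar> \<le> r / 2 + (2 / r) * (?u \<omega>)\<^sup>2" for \<omega>
      proof (cases "\<bar>?u \<omega>\<bar> \<le> r / 2")
        case False
        then have "r / 2 * \<bar>?u \<omega>\<bar> \<le> \<bar>?u \<omega>\<bar> * \<bar>?u \<omega>\<bar>" by (intro mult_right_mono) auto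
        then have "\<bar>?u \<omega>\<bar> \<le> (2 / r) * (?u \<omega>)\<^sup>2" using r by (simp add: field_simps power2_eq_square)
        then show ?thesis using r by simp
      qed (use r in \<open>simp add: add_increasing2\<close>)
    qed (use i1 isq in auto)
    ultimately have "(LINT \<omega>|gauss_seq. \<bar>?u \<omega>\<bar>) \<le> r / 2 + (2 / r) * q n"
      using isq gauss_seq.P.prob_space by simp
    also have "\<dots> \<le> r / 2 + (2 / r) * (r\<^sup>2 / 4)"
      using elim r by (intro add_left_mono mult_left_mono) auto
    also have "\<dots> = r" using r by (simp add: power2_eq_square)
    finally have "(LINT \<omega>|gauss_seq. \<bar>?u \<omega>\<bar>) \<le> r" .
    then have "(\<integral>\<^sup>+\<omega>. ennreal \<bar>?u \<omega>\<bar> \<partial>gauss_seq) \<le> ennreal r"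
      using i1 by (subst nn_integral_eq_integral) (auto intro!: ennreal_leI)
    then show ?case using r by simp
  qed
qed auto

text \<open>
  The variance of the field need not be bounded, so the test functions are restricted to the sets
  where it is.
\<close>

definition admissible :: "('a \<Rightarrow> ennreal) \<Rightarrow> bool" where
  "admissible f \<longleftrightarrow> f \<in> borel_measurable K \<and>
     (\<exists>C R. \<forall>x\<in>space K. f x \<le> ennreal C * indicator {x. tail_var 0 x \<le> R} x)"

text \<open>The Laplace functional at \<open>f\<close> of the Gaussian multiplicative chaos that
  \<open>field n\<close> generates over the deterministic measure \<open>\<mu>\<close>.\<close>

definition chaos :: "nat \<Rightarrow> ('a \<Rightarrow> ennreal) \<Rightarrow> 'a measure \<Rightarrow> ennreal" where
  "chaos n f \<mu> = (\<integral>\<^sup>+\<omega>. expn (\<integral>\<^sup>+x. f x * ennreal (exp (field n x \<omega>)) \<partial>\<mu>) \<partial>gauss_seq)"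

lemma chaos_le_1: "chaos n f \<mu> \<le> 1"
proof -
  have "chaos n f \<mu> \<le> (\<integral>\<^sup>+\<omega>. 1 \<partial>gauss_seq)" unfolding chaos_def by (intro nn_integral_mono) simp
  also have "\<dots> = 1" using prob_space.emeasure_space_1[OF prob_space_gauss_seq] by simp
  finally show ?thesis .
qed

text \<open>One constant for all \<open>x\<close> and \<open>n\<close>, since the tail variance is
  at most \<open>tail_var 0 x\<close>. The summand 1 accounts for
  \<open>\<bar>exp y - 1\<bar> \<le> exp y + 1\<close> and makes \<open>f\<close> itself
  finite.\<close>

lemma admissible_bound:
  assumes "admissible f"
  obtains c where "\<And>x n. x \<in> space K \<Longrightarrow> f x * (ennreal (exp (tail_var n x / 2)) + 1) \<le> ennreal c"
proof -
  obtain C R where CR: "\<forall>x\<in>space K. f x \<le> ennreal C * indicator {x. tail_var 0 x \<le> R} x"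
    using assms unfolding admissible_def by blast
  show ?thesis
  proof (rule that[of "max C 0 * (exp (R / 2) + 1)"])
    fix x n assume x: "x \<in> space K"
    show "f x * (ennreal (exp (tail_var n x / 2)) + 1) \<le> ennreal (max C 0 * (exp (R / 2) + 1))"
    proof (cases "tail_var 0 x \<le> R")
      case True
      have "f x \<le> ennreal C" using CR x True by auto
      also have "\<dots> \<le> ennreal (max C 0)" by (rule ennreal_leI) simp
      finally have "f x * (ennreal (exp (tail_var n x / 2)) + 1) \<le> ennreal (max C 0) * (ennreal (exp (R / 2)) + 1)"
        using tail_var_le[OF x, of n] True by (intro mult_mono add_mono ennreal_leI) auto
      also have "ennreal (exp (R / 2)) + 1 = ennreal (exp (R / 2) + 1)"
        by (simp flip: ennreal_1 ennreal_plus)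
      also have "ennreal (max C 0) * ennreal (exp (R / 2) + 1) = ennreal (max C 0 * (exp (R / 2) + 1))"
        by (rule ennreal_mult[symmetric]) (auto intro: add_nonneg_nonneg)
      finally show ?thesis .
    next
      case False
      then have "f x = 0" using CR x by force
      then show ?thesis by simp
    qed
  qed
qed

text \<open>\<open>r n\<close> bounds the distance between the random integral and \<open>m\<close>.
  Its mean tends to 0 by Tonelli, \<open>field_exp_L1\<close> at each \<open>x\<close> and the bound
  of \<open>admissible_bound\<close>; \<open>expn_lipschitz\<close> in both directions then squeezes
  the functional.\<close>

lemma chaos_LIMSEQ:
  assumes f: "admissible f" and \<mu>: "finite_measure \<mu>" and sets: "sets \<mu> = sets K"
  shows "(\<lambda>n. chaos n f \<mu>) \<longlonglongrightarrow> expn (\<integral>\<^sup>+x. f x \<partial>\<mu>)"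
proof -
  interpret \<mu>: finite_measure \<mu> by fact
  interpret S\<mu>: pair_sigma_finite gauss_seq \<mu> ..
  note [measurable_cong] = sets
  have sp: "space \<mu> = space K" using sets by (rule sets_eq_imp_space_eq)
  have fm[measurable]: "f \<in> borel_measurable K" using f by (simp add: admissible_def)
  have [measurable]: "(\<lambda>z. field n (snd z) (fst z)) \<in> borel_measurable (gauss_seq \<Otimes>\<^sub>M K)" for n
    using measurable_field[of n] by (simp add: split_beta')
  define r where "r n \<omega> = (\<integral>\<^sup>+x. f x * ennreal \<bar>exp (field n x \<omega>) - 1\<bar> \<partial>\<mu>)" for n \<omega>
  define a where "a n \<omega> = (\<integral>\<^sup>+x. f x * ennreal (exp (field n x \<omega>)) \<partial>\<mu>)" for n \<omega>
  define m where "m = (\<integral>\<^sup>+x. f x \<partial>\<mu>)"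
  have meas: "(\<lambda>(\<omega>, x). f x * ennreal \<bar>exp (field n x \<omega>) - 1\<bar>) \<in> borel_measurable (gauss_seq \<Otimes>\<^sub>M \<mu>)"
    "(\<lambda>(\<omega>, x). f x * ennreal (exp (field n x \<omega>))) \<in> borel_measurable (gauss_seq \<Otimes>\<^sub>M \<mu>)" for n
    unfolding split_beta' by measurable
  note [measurable] = meas
  have rm[measurable]: "r n \<in> borel_measurable gauss_seq" "a n \<in> borel_measurable gauss_seq" for n
    unfolding r_def a_def by measurable
  have ar: "a n \<omega> \<le> m + r n \<omega>" "m \<le> a n \<omega> + r n \<omega>" if \<omega>: "\<omega> \<in> space gauss_seq" for n \<omega>
  proof -
    have [measurable]: "(\<lambda>x. f x * ennreal \<bar>exp (field n x \<omega>) - 1\<bar>) \<in> borel_measurable \<mu>"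
        "(\<lambda>x. f x * ennreal (exp (field n x \<omega>))) \<in> borel_measurable \<mu>"
      using measurable_Pair2[OF meas(1) \<omega>] measurable_Pair2[OF meas(2) \<omega>] by simp_all
    have le: "ennreal (exp y) \<le> 1 + ennreal \<bar>exp y - 1\<bar>" "1 \<le> ennreal (exp y) + ennreal \<bar>exp y - 1\<bar>" for y :: real
      by (simp_all flip: ennreal_1 ennreal_plus add: ennreal_leI del: ennreal_1)
    have "a n \<omega> \<le> (\<integral>\<^sup>+x. f x + f x * ennreal \<bar>exp (field n x \<omega>) - 1\<bar> \<partial>\<mu>)"
      unfolding a_def using mult_left_mono[OF le(1)] by (intro nn_integral_mono) (simp add: distrib_left)
    also have "\<dots> = m + r n \<omega>" unfolding m_def r_def by (intro nn_integral_add) measurable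
    finally show "a n \<omega> \<le> m + r n \<omega>" .
    have "m \<le> (\<integral>\<^sup>+x. f x * ennreal (exp (field n x \<omega>)) + f x * ennreal \<bar>exp (field n x \<omega>) - 1\<bar> \<partial>\<mu>)"
      unfolding m_def using mult_left_mono[OF le(2)] by (intro nn_integral_mono) (simp add: distrib_left)
    also have "\<dots> = a n \<omega> + r n \<omega>" unfolding a_def r_def by (intro nn_integral_add) measurable
    finally show "m \<le> a n \<omega> + r n \<omega>" .
  qed
  have r0: "(\<lambda>n. \<integral>\<^sup>+\<omega>. r n \<omega> \<partial>gauss_seq) \<longlonglongrightarrow> 0"
  proof -
    obtain c where c: "\<And>x n. x \<in> space K \<Longrightarrow> f x * (ennreal (exp (tail_var n x / 2)) + 1) \<le> ennreal c"
      using admissible_bound[OF f] by blast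
    \<comment> \<open>Multiplication by \<open>f x\<close> preserves limits in
      \<open>ennreal\<close> only if \<open>f x\<close> is finite.\<close>
    have fx: "f x < \<top>" if "x \<in> space K" for x
    proof -
      have "f x * 1 \<le> f x * (ennreal (exp (tail_var 0 x / 2)) + 1)" by (intro mult_left_mono) auto
      then show ?thesis using c[OF that, of 0] by (metis ennreal_less_top le_less_trans mult.right_neutral)
    qed
    have eq: "(\<integral>\<^sup>+\<omega>. r n \<omega> \<partial>gauss_seq) = (\<integral>\<^sup>+x. f x * (\<integral>\<^sup>+\<omega>. ennreal \<bar>exp (field n x \<omega>) - 1\<bar> \<partial>gauss_seq) \<partial>\<mu>)" for n
    proof -
      have "(\<integral>\<^sup>+\<omega>. r n \<omega> \<partial>gauss_seq) = (\<integral>\<^sup>+x. \<integral>\<^sup>+\<omega>. f x * ennreal \<bar>exp (field n x \<omega>) - 1\<bar> \<partial>gauss_seq \<partial>\<mu>)"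
        unfolding r_def by (rule S\<mu>.Fubini'[symmetric]) measurable
      also have "\<dots> = (\<integral>\<^sup>+x. f x * (\<integral>\<^sup>+\<omega>. ennreal \<bar>exp (field n x \<omega>) - 1\<bar> \<partial>gauss_seq) \<partial>\<mu>)"
        using measurable_field_at by (intro nn_integral_cong nn_integral_cmult) (simp add: sp)
      finally show ?thesis .
    qed
    have [measurable]: "(\<lambda>x. \<integral>\<^sup>+\<omega>. ennreal \<bar>exp (field n x \<omega>) - 1\<bar> \<partial>gauss_seq) \<in> borel_measurable K" for n
    proof -
      have "(\<lambda>(x, \<omega>). ennreal \<bar>exp (field n x \<omega>) - 1\<bar>) \<in> borel_measurable (K \<Otimes>\<^sub>M gauss_seq)"
        using measurable_compose[OF measurable_Pair[OF measurable_snd measurable_fst] measurable_field[of n]]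
        by (simp add: split_beta')
      then show ?thesis by measurable
    qed
    have "(\<lambda>n. \<integral>\<^sup>+x. f x * (\<integral>\<^sup>+\<omega>. ennreal \<bar>exp (field n x \<omega>) - 1\<bar> \<partial>gauss_seq) \<partial>\<mu>) \<longlonglongrightarrow> (\<integral>\<^sup>+x. 0 \<partial>\<mu>)"
    proof (rule nn_integral_dominated_convergence[where w="\<lambda>_. ennreal c"])
      show "(\<integral>\<^sup>+x. ennreal c \<partial>\<mu>) < \<infinity>"
        using \<mu>.emeasure_finite[of "space \<mu>"] by (simp add: less_top[symmetric] ennreal_mult_eq_top_iff)
      show "AE x in \<mu>. (\<lambda>n. f x * (\<integral>\<^sup>+\<omega>. ennreal \<bar>exp (field n x \<omega>) - 1\<bar> \<partial>gauss_seq)) \<longlonglongrightarrow> 0"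
      proof (rule AE_I2)
        fix x assume "x \<in> space \<mu>"
        then have x: "x \<in> space K" by (simp add: sp)
        have "(\<lambda>n. f x * (\<integral>\<^sup>+\<omega>. ennreal \<bar>exp (field n x \<omega>) - 1\<bar> \<partial>gauss_seq)) \<longlonglongrightarrow> f x * 0"
          using fx[OF x] by (intro ennreal_tendsto_cmult field_exp_L1 x)
        then show "(\<lambda>n. f x * (\<integral>\<^sup>+\<omega>. ennreal \<bar>exp (field n x \<omega>) - 1\<bar> \<partial>gauss_seq)) \<longlonglongrightarrow> 0" by simp
      qed
      show "AE x in \<mu>. f x * (\<integral>\<^sup>+\<omega>. ennreal \<bar>exp (field n x \<omega>) - 1\<bar> \<partial>gauss_seq) \<le> ennreal c" for n
      proof (rule AE_I2)
        fix x assume "x \<in> space \<mu>"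
        then have x: "x \<in> space K" by (simp add: sp)
        note [measurable] = measurable_field_at[OF x]
        have "(\<integral>\<^sup>+\<omega>. ennreal \<bar>exp (field n x \<omega>) - 1\<bar> \<partial>gauss_seq) \<le> (\<integral>\<^sup>+\<omega>. ennreal (exp (field n x \<omega>)) + 1 \<partial>gauss_seq)"
        proof (rule nn_integral_mono)
          fix \<omega>
          have "ennreal \<bar>exp (field n x \<omega>) - 1\<bar> \<le> ennreal (exp (field n x \<omega>) + 1)"
            by (rule ennreal_leI) (simp add: abs_le_iff add_increasing)
          then show "ennreal \<bar>exp (field n x \<omega>) - 1\<bar> \<le> ennreal (exp (field n x \<omega>)) + 1" by simp
        qed
        also have "\<dots> = ennreal (exp (tail_var n x / 2)) + 1"
          using field_exp_moment[OF x, of 1 n] gauss_seq.P.emeasure_space_1 by (simp add: nn_integral_add)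
        finally have "f x * (\<integral>\<^sup>+\<omega>. ennreal \<bar>exp (field n x \<omega>) - 1\<bar> \<partial>gauss_seq) \<le> f x * (ennreal (exp (tail_var n x / 2)) + 1)"
          by (intro mult_left_mono) auto
        also have "\<dots> \<le> ennreal c" by (rule c[OF x])
        finally show "f x * (\<integral>\<^sup>+\<omega>. ennreal \<bar>exp (field n x \<omega>) - 1\<bar> \<partial>gauss_seq) \<le> ennreal c" .
      qed
    qed measurable
    then show ?thesis by (simp add: eq)
  qed
  have up: "chaos n f \<mu> \<le> expn m + (\<integral>\<^sup>+\<omega>. r n \<omega> \<partial>gauss_seq)" for n
  proof -
    have "chaos n f \<mu> \<le> (\<integral>\<^sup>+\<omega>. expn m + r n \<omega> \<partial>gauss_seq)"
      unfolding chaos_def a_def[symmetric] by (intro nn_integral_mono expn_lipschitz ar)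
    also have "\<dots> = expn m + (\<integral>\<^sup>+\<omega>. r n \<omega> \<partial>gauss_seq)"
      by (subst nn_integral_add) (use gauss_seq.P.emeasure_space_1 in auto)
    finally show ?thesis .
  qed
  have lo: "expn m \<le> chaos n f \<mu> + (\<integral>\<^sup>+\<omega>. r n \<omega> \<partial>gauss_seq)" for n
  proof -
    have "expn m = (\<integral>\<^sup>+\<omega>. expn m \<partial>gauss_seq)" using gauss_seq.P.emeasure_space_1 by simp
    also have "\<dots> \<le> (\<integral>\<^sup>+\<omega>. expn (a n \<omega>) + r n \<omega> \<partial>gauss_seq)"
      by (intro nn_integral_mono expn_lipschitz ar)
    also have "\<dots> = chaos n f \<mu> + (\<integral>\<^sup>+\<omega>. r n \<omega> \<partial>gauss_seq)"
      unfolding chaos_def a_def[symmetric] by (intro nn_integral_add) measurable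
    finally show ?thesis .
  qed
  show ?thesis unfolding m_def[symmetric]
  proof (rule tendsto_sandwich)
    show "eventually (\<lambda>n. expn m - (\<integral>\<^sup>+\<omega>. r n \<omega> \<partial>gauss_seq) \<le> chaos n f \<mu>) sequentially"
      using lo less_imp_neq[OF expn_less_top[of m]] by (intro always_eventually allI) (auto simp: ennreal_minus_le_iff add.commute)
    show "eventually (\<lambda>n. chaos n f \<mu> \<le> expn m + (\<integral>\<^sup>+\<omega>. r n \<omega> \<partial>gauss_seq)) sequentially"
      using up by (intro always_eventually allI)
    have "(\<lambda>n. expn m - (\<integral>\<^sup>+\<omega>. r n \<omega> \<partial>gauss_seq)) \<longlonglongrightarrow> expn m - 0"
      using less_imp_neq[OF expn_less_top[of m]] by (intro tendsto_diff_ennreal tendsto_const r0) simp_all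
    then show "(\<lambda>n. expn m - (\<integral>\<^sup>+\<omega>. r n \<omega> \<partial>gauss_seq)) \<longlonglongrightarrow> expn m" by simp
    have "(\<lambda>n. expn m + (\<integral>\<^sup>+\<omega>. r n \<omega> \<partial>gauss_seq)) \<longlonglongrightarrow> expn m + 0"
      by (intro tendsto_add r0) auto
    then show "(\<lambda>n. expn m + (\<integral>\<^sup>+\<omega>. r n \<omega> \<partial>gauss_seq)) \<longlonglongrightarrow> expn m" by simp
  qed
qed

text \<open>Where the tail series converges, \<open>field_case_nat\<close> splits the exponent. The
  exceptional event depends on \<open>x\<close>, but by Tonelli almost every \<open>\<omega>\<close>
  is good for \<open>\<mu>\<close>-almost all \<open>x\<close>, which is enough inside the
  integral.\<close>

lemma chaos_step:
  assumes f[measurable]: "f \<in> borel_measurable K" and \<mu>: "finite_measure \<mu>" and sets: "sets \<mu> = sets K"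
  shows "chaos n f \<mu> = (\<integral>\<^sup>+s. chaos (Suc n) (\<lambda>x. f x * ennreal (exp (s * h n x))) \<mu> \<partial>gauss)"
proof -
  interpret \<mu>: finite_measure \<mu> by fact
  interpret S\<mu>: pair_sigma_finite gauss_seq \<mu> ..
  note [measurable_cong] = sets
  have sp: "space \<mu> = space K" using sets by (rule sets_eq_imp_space_eq)
  have [measurable]: "(\<lambda>z. field n (snd z) (fst z)) \<in> borel_measurable (gauss_seq \<Otimes>\<^sub>M K)" for n
    using measurable_field[of n] by (simp add: split_beta')
  have [measurable]: "(\<lambda>(\<omega>, x). f x * ennreal (exp (field n x \<omega>))) \<in> borel_measurable (gauss_seq \<Otimes>\<^sub>M \<mu>)" for n
    unfolding split_beta' by measurable
  \<comment> \<open>Convergence is phrased as the Cauchy property because exchanging the quantifiers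
    requires the set of good pairs to be measurable.\<close>
  have "AE x in \<mu>. AE \<omega> in gauss_seq. Cauchy (\<lambda>j. partial (Suc n) j x \<omega>)"
    using AE_convergent[of _ "Suc n"] unfolding Cauchy_convergent_iff sp[symmetric] by (rule AE_I2)
  moreover have "{z \<in> space (gauss_seq \<Otimes>\<^sub>M \<mu>). Cauchy (\<lambda>j. partial (Suc n) j (snd z) (fst z))} \<in> sets (gauss_seq \<Otimes>\<^sub>M \<mu>)"
  proof (rule sets_Collect_Cauchy)
    show "(\<lambda>z. partial (Suc n) j (snd z) (fst z)) \<in> borel_measurable (gauss_seq \<Otimes>\<^sub>M \<mu>)" for j
      using measurable_partial[of "Suc n" j] by (simp add: split_beta')
  qed
  ultimately have ae: "AE \<omega> in gauss_seq. AE x in \<mu>. Cauchy (\<lambda>j. partial (Suc n) j x \<omega>)"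
    using S\<mu>.AE_commute[of "\<lambda>\<omega> x. Cauchy (\<lambda>j. partial (Suc n) j x \<omega>)"] by blast
  have "chaos n f \<mu> = (\<integral>\<^sup>+s. \<integral>\<^sup>+\<omega>. expn (\<integral>\<^sup>+x. f x * ennreal (exp (field n x (case_nat s \<omega>))) \<partial>\<mu>) \<partial>gauss_seq \<partial>gauss)"
    unfolding chaos_def by (rule nn_integral_gauss_seq_iter) measurable
  also have "\<dots> = (\<integral>\<^sup>+s. chaos (Suc n) (\<lambda>x. f x * ennreal (exp (s * h n x))) \<mu> \<partial>gauss)"
    unfolding chaos_def
  proof (rule nn_integral_cong, rule nn_integral_cong_AE)
    fix s
    show "AE \<omega> in gauss_seq. expn (\<integral>\<^sup>+x. f x * ennreal (exp (field n x (case_nat s \<omega>))) \<partial>\<mu>) =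
        expn (\<integral>\<^sup>+x. f x * ennreal (exp (s * h n x)) * ennreal (exp (field (Suc n) x \<omega>)) \<partial>\<mu>)"
      using ae
    proof eventually_elim
      case (elim \<omega>)
      have "AE x in \<mu>. x \<in> space K" by (rule AE_I2) (simp add: sp)
      with elim have "AE x in \<mu>. f x * ennreal (exp (field n x (case_nat s \<omega>))) =
          f x * ennreal (exp (s * h n x)) * ennreal (exp (field (Suc n) x \<omega>))"
      proof eventually_elim
        case (elim x)
        then show ?case
          by (simp add: field_case_nat Cauchy_convergent_iff exp_add ennreal_mult mult_ac)
      qed
      then show ?case by (intro arg_cong[where f=expn] nn_integral_cong_AE)
    qed
  qed
  finally show ?thesis .
qed

end

section \<open>Random measures with equal mean chaos\<close>

locale bounded_gaussian_series = gaussian_series +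
  assumes h_bounded: "\<And>k. \<exists>B. \<forall>x\<in>space K. \<bar>h k x\<bar> \<le> B"
begin

lemma tilt_le:
  assumes "\<forall>x\<in>space K. \<bar>h n x\<bar> \<le> B" "x \<in> space K" "\<bar>t\<bar> \<le> U"
  shows "ennreal (exp (t * h n x)) \<le> ennreal (exp (U * B))"
proof -
  have "t * h n x \<le> \<bar>t\<bar> * \<bar>h n x\<bar>" by (simp add: abs_mult[symmetric])
  also have "\<dots> \<le> U * B" using assms by (intro mult_mono) auto
  finally show ?thesis by (intro ennreal_leI) simp
qed

text \<open>As \<open>h n\<close> is bounded, a tilt only enlarges the constant and keeps the
  sublevel set of the variance.\<close>

lemma admissible_tilt:
  assumes f: "admissible f"
  shows "admissible (\<lambda>x. f x * ennreal (exp (t * h n x)))"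
proof -
  obtain C R where CR: "\<forall>x\<in>space K. f x \<le> ennreal C * indicator {x. tail_var 0 x \<le> R} x"
    and [measurable]: "f \<in> borel_measurable K"
    using f unfolding admissible_def by blast
  obtain B where B: "\<forall>x\<in>space K. \<bar>h n x\<bar> \<le> B" using h_bounded by blast
  note [measurable] = h_measurable
  have "f x * ennreal (exp (t * h n x)) \<le> ennreal (max C 0 * exp (\<bar>t\<bar> * B)) * indicator {x. tail_var 0 x \<le> R} x"
    if x: "x \<in> space K" for x
  proof -
    have "f x * ennreal (exp (t * h n x)) \<le> (ennreal C * indicator {x. tail_var 0 x \<le> R} x) * ennreal (exp (\<bar>t\<bar> * B))"
      using CR x B by (intro mult_mono tilt_le) auto
    also have "ennreal C = ennreal (max C 0)" by (simp add: max_def ennreal_neg)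
    finally show ?thesis by (simp add: ennreal_mult mult_ac)
  qed
  then show ?thesis unfolding admissible_def by (intro conjI exI ballI) auto
qed

text \<open>The untilted integral has finite mean, hence is finite for almost every
  \<open>\<omega>\<close>. As the convergent sequence \<open>u\<close> is bounded by some
  \<open>U\<close>, the constant \<open>exp (U * B)\<close> times the untilted integrand dominates
  all the tilted ones.\<close>

lemma chaos_tilt_LIMSEQ:
  assumes f: "admissible f" and \<mu>: "finite_measure \<mu>" and sets: "sets \<mu> = sets K" and u: "u \<longlonglongrightarrow> 0"
  shows "(\<lambda>i. chaos n (\<lambda>x. f x * ennreal (exp (u i * h m x))) \<mu>) \<longlonglongrightarrow> chaos n f \<mu>"
proof -
  interpret \<mu>: finite_measure \<mu> by fact
  interpret S\<mu>: pair_sigma_finite gauss_seq \<mu> ..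
  note [measurable_cong] = sets
  note [measurable] = h_measurable
  have sp: "space \<mu> = space K" using sets by (rule sets_eq_imp_space_eq)
  have fm[measurable]: "f \<in> borel_measurable K" using f by (simp add: admissible_def)
  have [measurable]: "(\<lambda>z. field n (snd z) (fst z)) \<in> borel_measurable (gauss_seq \<Otimes>\<^sub>M K)" for n
    using measurable_field[of n] by (simp add: split_beta')
  have meas[measurable]: "(\<lambda>(\<omega>, x). f x * ennreal (exp (field n x \<omega>))) \<in> borel_measurable (gauss_seq \<Otimes>\<^sub>M \<mu>)"
    "(\<lambda>(\<omega>, x). f x * ennreal (exp (u i * h m x)) * ennreal (exp (field n x \<omega>))) \<in> borel_measurable (gauss_seq \<Otimes>\<^sub>M \<mu>)" for i
    unfolding split_beta' by measurable
  obtain B where B: "\<forall>x\<in>space K. \<bar>h m x\<bar> \<le> B" using h_bounded by blast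
  obtain U where U: "\<And>i. \<bar>u i\<bar> \<le> U"
    using convergent_imp_Bseq[OF convergentI[OF u]] by (auto simp: Bseq_def)
  obtain c where c: "\<And>x n. x \<in> space K \<Longrightarrow> f x * (ennreal (exp (tail_var n x / 2)) + 1) \<le> ennreal c"
    using admissible_bound[OF f] by blast
  have "(\<integral>\<^sup>+\<omega>. (\<integral>\<^sup>+x. f x * ennreal (exp (field n x \<omega>)) \<partial>\<mu>) \<partial>gauss_seq) =
      (\<integral>\<^sup>+x. (\<integral>\<^sup>+\<omega>. f x * ennreal (exp (field n x \<omega>)) \<partial>gauss_seq) \<partial>\<mu>)"
    by (rule S\<mu>.Fubini'[symmetric]) measurable
  also have "\<dots> \<le> (\<integral>\<^sup>+x. ennreal c \<partial>\<mu>)"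
  proof (rule nn_integral_mono)
    fix x assume "x \<in> space \<mu>"
    then have x: "x \<in> space K" by (simp add: sp)
    have "(\<integral>\<^sup>+\<omega>. f x * ennreal (exp (field n x \<omega>)) \<partial>gauss_seq) = f x * ennreal (exp (tail_var n x / 2))"
      using field_exp_moment[OF x, of 1 n] measurable_field_at[OF x, of n] by (subst nn_integral_cmult) auto
    also have "\<dots> \<le> f x * (ennreal (exp (tail_var n x / 2)) + 1)" by (intro mult_left_mono) auto
    also have "\<dots> \<le> ennreal c" by (rule c[OF x])
    finally show "(\<integral>\<^sup>+\<omega>. f x * ennreal (exp (field n x \<omega>)) \<partial>gauss_seq) \<le> ennreal c" .
  qed
  also have "\<dots> < \<infinity>"
    using \<mu>.emeasure_finite[of "space \<mu>"] by (simp add: less_top[symmetric] ennreal_mult_eq_top_iff)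
  finally have "AE \<omega> in gauss_seq. (\<integral>\<^sup>+x. f x * ennreal (exp (field n x \<omega>)) \<partial>\<mu>) \<noteq> \<infinity>"
    by (intro nn_integral_PInf_AE) auto
  then have fin: "AE \<omega> in gauss_seq. (\<integral>\<^sup>+x. f x * ennreal (exp (field n x \<omega>)) \<partial>\<mu>) < \<infinity>"
    by eventually_elim (simp add: less_top)
  show ?thesis unfolding chaos_def
  proof (rule nn_integral_dominated_convergence[where w="\<lambda>_. 1"])
    show "AE \<omega> in gauss_seq. (\<lambda>i. expn (\<integral>\<^sup>+x. f x * ennreal (exp (u i * h m x)) * ennreal (exp (field n x \<omega>)) \<partial>\<mu>))
        \<longlonglongrightarrow> expn (\<integral>\<^sup>+x. f x * ennreal (exp (field n x \<omega>)) \<partial>\<mu>)"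
      using fin AE_space
    proof eventually_elim
      case (elim \<omega>)
      have m1[measurable]: "(\<lambda>x. f x * ennreal (exp (field n x \<omega>))) \<in> borel_measurable \<mu>"
        "(\<lambda>x. f x * ennreal (exp (u i * h m x)) * ennreal (exp (field n x \<omega>))) \<in> borel_measurable \<mu>" for i
        using measurable_Pair2[OF meas(1) elim(2)] measurable_Pair2[OF meas(2) elim(2)] by simp_all
      show ?case
      proof (intro tendsto_expn nn_integral_dominated_convergence[where w="\<lambda>x. ennreal (exp (U * B)) * (f x * ennreal (exp (field n x \<omega>)))"])
        show "AE x in \<mu>. f x * ennreal (exp (u i * h m x)) * ennreal (exp (field n x \<omega>)) \<le>
            ennreal (exp (U * B)) * (f x * ennreal (exp (field n x \<omega>)))" for i
        proof (rule AE_I2)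
          fix x assume "x \<in> space \<mu>"
          then have "ennreal (exp (u i * h m x)) \<le> ennreal (exp (U * B))" by (intro tilt_le B U) (simp add: sp)
          then have "ennreal (exp (u i * h m x)) * (f x * ennreal (exp (field n x \<omega>))) \<le>
            ennreal (exp (U * B)) * (f x * ennreal (exp (field n x \<omega>)))" by (rule mult_right_mono) simp
          then show "f x * ennreal (exp (u i * h m x)) * ennreal (exp (field n x \<omega>)) \<le>
            ennreal (exp (U * B)) * (f x * ennreal (exp (field n x \<omega>)))" by (simp add: mult_ac)
        qed
        show "(\<integral>\<^sup>+x. ennreal (exp (U * B)) * (f x * ennreal (exp (field n x \<omega>))) \<partial>\<mu>) < \<infinity>"
          using elim by (subst nn_integral_cmult) (auto simp: ennreal_mult_less_top)
        show "AE x in \<mu>. (\<lambda>i. f x * ennreal (exp (u i * h m x)) * ennreal (exp (field n x \<omega>))) \<longlonglongrightarrow> f x * ennreal (exp (field n x \<omega>))"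
        proof (rule AE_I2)
          fix x assume "x \<in> space \<mu>"
          then have x: "x \<in> space K" by (simp add: sp)
          have "f x * 1 \<le> f x * (ennreal (exp (tail_var 0 x / 2)) + 1)" by (intro mult_left_mono) auto
          then have "f x < \<top>" using c[OF x, of 0] by (metis ennreal_less_top le_less_trans mult.right_neutral)
          then have lt: "f x * ennreal (exp (field n x \<omega>)) < \<top>" by (simp add: ennreal_mult_less_top)
          have "(\<lambda>i. exp (u i * h m x)) \<longlonglongrightarrow> exp (0 * h m x)" by (intro tendsto_intros u)
          then have "(\<lambda>i. ennreal (exp (u i * h m x))) \<longlonglongrightarrow> ennreal 1" by (intro tendsto_ennrealI) simp
          then have "(\<lambda>i. (f x * ennreal (exp (field n x \<omega>))) * ennreal (exp (u i * h m x))) \<longlonglongrightarrow> (f x * ennreal (exp (field n x \<omega>))) * ennreal 1"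
            using lt by (intro ennreal_tendsto_cmult)
          then show "(\<lambda>i. f x * ennreal (exp (u i * h m x)) * ennreal (exp (field n x \<omega>))) \<longlonglongrightarrow> f x * ennreal (exp (field n x \<omega>))"
            by (simp add: mult_ac)
        qed
      qed measurable
    qed
    show "(\<integral>\<^sup>+\<omega>. 1 \<partial>gauss_seq) < \<infinity>" using gauss_seq.P.emeasure_space_1 by simp
  qed (simp_all, measurable)
qed

end

text \<open>Finiteness holds at every \<open>\<omega>\<close>, as
  \<open>measurable_nn_integral_kernel\<close> requires; an almost surely finite random measure
  enters through \<open>fin_part\<close>.\<close>

locale finite_kernel = prob_space P for P :: "'w measure" +
  fixes K :: "'a measure" and \<kappa> :: "'w \<Rightarrow> 'a measure"
  assumes kernel_measurable: "\<kappa> \<in> P \<rightarrow>\<^sub>M measure_algebra K"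
    and kernel_finite: "\<And>\<omega>. \<omega> \<in> space P \<Longrightarrow> emeasure (\<kappa> \<omega>) (space K) < \<infinity>"
begin

lemma kernel_sets: "\<omega> \<in> space P \<Longrightarrow> sets (\<kappa> \<omega>) = sets K"
  using measurable_space[OF kernel_measurable] by (simp add: space_measure_algebra)

lemma kernel_finite_measure: "\<omega> \<in> space P \<Longrightarrow> finite_measure (\<kappa> \<omega>)"
  using kernel_finite kernel_sets[THEN sets_eq_imp_space_eq] by (intro finite_measureI) (auto simp: less_top)

end

locale gaussian_series_kernel = bounded_gaussian_series K h + finite_kernel P K \<kappa>
  for P :: "'w measure" and K :: "'a measure" and h and \<kappa>
begin

lemma measurable_chaos_tilt:
  assumes [measurable]: "f \<in> borel_measurable K"
  shows "(\<lambda>(\<omega>, s). chaos n (\<lambda>x. f x * ennreal (exp (s * h m x))) (\<kappa> \<omega>)) \<in> borel_measurable (P \<Otimes>\<^sub>M borel)"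
proof -
  note [measurable] = h_measurable kernel_measurable
  have [measurable]: "(\<lambda>z. field n (snd z) (fst z)) \<in> borel_measurable (gauss_seq \<Otimes>\<^sub>M K)"
    using measurable_field[of n] by (simp add: split_beta')
  have "(\<lambda>z. \<integral>\<^sup>+x. f x * ennreal (exp (snd (fst z) * h m x)) * ennreal (exp (field n x (snd z))) \<partial>\<kappa> (fst (fst z)))
    \<in> borel_measurable ((P \<Otimes>\<^sub>M borel) \<Otimes>\<^sub>M gauss_seq)"
  proof (rule measurable_nn_integral_kernel[where K=K])
    show "(\<lambda>z. \<kappa> (fst (fst z))) \<in> (P \<Otimes>\<^sub>M borel) \<Otimes>\<^sub>M gauss_seq \<rightarrow>\<^sub>M measure_algebra K" by measurable
    show "emeasure (\<kappa> (fst (fst z))) (space K) < \<infinity>" if "z \<in> space ((P \<Otimes>\<^sub>M borel) \<Otimes>\<^sub>M gauss_seq)" for z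
      using that by (intro kernel_finite) (auto simp: space_pair_measure)
    show "(\<lambda>(z, x). f x * ennreal (exp (snd (fst z) * h m x)) * ennreal (exp (field n x (snd z))))
      \<in> borel_measurable (((P \<Otimes>\<^sub>M borel) \<Otimes>\<^sub>M gauss_seq) \<Otimes>\<^sub>M K)"
      unfolding split_beta' by measurable
  qed
  then have [measurable]: "(\<lambda>(z, \<omega>'). expn (\<integral>\<^sup>+x. f x * ennreal (exp (snd z * h m x)) * ennreal (exp (field n x \<omega>')) \<partial>\<kappa> (fst z)))
    \<in> borel_measurable ((P \<Otimes>\<^sub>M borel) \<Otimes>\<^sub>M gauss_seq)"
    unfolding split_beta' by (rule measurable_compose[OF _ measurable_expn])
  show ?thesis unfolding chaos_def split_beta' by measurable
qed

lemma measurable_chaos: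
  assumes "f \<in> borel_measurable K"
  shows "(\<lambda>\<omega>. chaos n f (\<kappa> \<omega>)) \<in> borel_measurable P"
  \<comment> \<open>The tilt with parameter 0, where the choice of the function \<open>h 0\<close>
    has no effect.\<close>
  using measurable_Pair1[OF measurable_chaos_tilt[OF assms, of n 0], of 0] by simp

text \<open>The Laplace functional of the chaos over the random measure \<open>\<kappa>\<close>,
  with the field independent of \<open>\<kappa>\<close> because the two averages are taken
  separately.\<close>

definition mean_chaos :: "nat \<Rightarrow> ('a \<Rightarrow> ennreal) \<Rightarrow> ennreal" where
  "mean_chaos n f = (\<integral>\<^sup>+\<omega>. chaos n f (\<kappa> \<omega>) \<partial>P)"

lemma mean_chaos_le_1: "mean_chaos n f \<le> 1"
proof -
  have "mean_chaos n f \<le> (\<integral>\<^sup>+\<omega>. 1 \<partial>P)" unfolding mean_chaos_def by (intro nn_integral_mono chaos_le_1)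
  then show ?thesis by (simp add: emeasure_space_1)
qed

lemma measurable_mean_chaos_tilt:
  assumes "f \<in> borel_measurable K"
  shows "(\<lambda>s. mean_chaos n (\<lambda>x. f x * ennreal (exp (s * h m x)))) \<in> borel_measurable borel"
proof -
  have "(\<lambda>(s, \<omega>). chaos n (\<lambda>x. f x * ennreal (exp (s * h m x))) (\<kappa> \<omega>)) \<in> borel_measurable (borel \<Otimes>\<^sub>M P)"
    using measurable_chaos_tilt[OF assms, of n m] by (subst measurable_pair_swap_iff) (simp add: split_beta')
  then show ?thesis unfolding mean_chaos_def by (rule borel_measurable_nn_integral)
qed

lemma mean_chaos_step:
  assumes f[measurable]: "f \<in> borel_measurable K"
  shows "mean_chaos n (\<lambda>x. f x * ennreal (exp (t * h n x))) =
    (\<integral>\<^sup>+s. mean_chaos (Suc n) (\<lambda>x. f x * ennreal (exp ((t + s) * h n x))) \<partial>gauss)"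
proof -
  interpret PG: pair_sigma_finite P gauss ..
  note [measurable] = h_measurable
  have g: "(\<lambda>x. f x * ennreal (exp (t * h n x))) \<in> borel_measurable K" by measurable
  have e: "(\<lambda>x. f x * ennreal (exp (t * h n x)) * ennreal (exp (s * h n x))) = (\<lambda>x. f x * ennreal (exp ((t + s) * h n x)))" for s
    by (simp add: distrib_right exp_add ennreal_mult mult_ac)
  have "mean_chaos n (\<lambda>x. f x * ennreal (exp (t * h n x))) =
    (\<integral>\<^sup>+\<omega>. \<integral>\<^sup>+s. chaos (Suc n) (\<lambda>x. f x * ennreal (exp ((t + s) * h n x))) (\<kappa> \<omega>) \<partial>gauss \<partial>P)"
    unfolding mean_chaos_def e[symmetric]
    by (intro nn_integral_cong chaos_step g kernel_finite_measure kernel_sets)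
  also have "\<dots> = (\<integral>\<^sup>+s. mean_chaos (Suc n) (\<lambda>x. f x * ennreal (exp ((t + s) * h n x))) \<partial>gauss)"
    unfolding mean_chaos_def
  proof (rule PG.Fubini'[symmetric])
    have "(\<lambda>(\<omega>, s). chaos (Suc n) (\<lambda>x. f x * ennreal (exp (t * h n x)) * ennreal (exp (s * h n x))) (\<kappa> \<omega>)) \<in> borel_measurable (P \<Otimes>\<^sub>M borel)"
      by (rule measurable_chaos_tilt[OF g])
    then show "(\<lambda>(\<omega>, s). chaos (Suc n) (\<lambda>x. f x * ennreal (exp ((t + s) * h n x))) (\<kappa> \<omega>)) \<in> borel_measurable (P \<Otimes>\<^sub>M gauss)"
      unfolding e by simp
  qed
  finally show ?thesis .
qed

lemma mean_chaos_tilt_continuous: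
  assumes f: "admissible f"
  shows "((\<lambda>s. mean_chaos n (\<lambda>x. f x * ennreal (exp (s * h m x)))) \<longlongrightarrow> mean_chaos n f) (at_right 0)"
  unfolding tendsto_at_iff_sequentially
proof (intro allI impI)
  fix u :: "nat \<Rightarrow> real" assume u: "u \<longlonglongrightarrow> 0"
  have fm[measurable]: "f \<in> borel_measurable K" using f by (simp add: admissible_def)
  note [measurable] = h_measurable
  show "((\<lambda>s. mean_chaos n (\<lambda>x. f x * ennreal (exp (s * h m x)))) \<circ> u) \<longlonglongrightarrow> mean_chaos n f"
    unfolding mean_chaos_def comp_def
    by (rule nn_integral_dominated_convergence[where w="\<lambda>_. 1"])
       (auto intro!: measurable_chaos chaos_le_1 chaos_tilt_LIMSEQ f kernel_finite_measure kernel_sets u simp: emeasure_space_1)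
qed

lemma mean_chaos_LIMSEQ:
  assumes f: "admissible f"
  shows "(\<lambda>n. mean_chaos n f) \<longlonglongrightarrow> (\<integral>\<^sup>+\<omega>. expn (\<integral>\<^sup>+x. f x \<partial>\<kappa> \<omega>) \<partial>P)"
  unfolding mean_chaos_def
proof (rule nn_integral_dominated_convergence[where w="\<lambda>_. 1"])
  have fm: "f \<in> borel_measurable K" using f by (simp add: admissible_def)
  show "(\<lambda>\<omega>. chaos n f (\<kappa> \<omega>)) \<in> borel_measurable P" for n by (rule measurable_chaos[OF fm])
  show "(\<lambda>\<omega>. expn (\<integral>\<^sup>+x. f x \<partial>\<kappa> \<omega>)) \<in> borel_measurable P"
    using measurable_compose[OF measurable_compose[OF kernel_measurable measurable_nn_integral_measure_algebra[OF fm]] measurable_expn] .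
qed (auto intro!: chaos_le_1 chaos_LIMSEQ f kernel_finite_measure kernel_sets simp: emeasure_space_1)

end

lemma measurable_sum_list_indicator:
  "set l \<subseteq> sets N \<Longrightarrow> (\<lambda>x. \<Sum>A\<leftarrow>l. indicator A x :: ennreal) \<in> borel_measurable N"
  by (induction l) auto

text \<open>In the induction \<open>f\<close> is arbitrary: the convolutions agree at every
  \<open>t\<close> because the induction hypothesis is applied to the tilted functions. Letting
  \<open>n\<close> grow removes the field and leaves the Laplace functionals of the kernels on
  admissible functions.\<close>

lemma distr_kernel_eq:
  fixes \<kappa> \<kappa>' :: "'w \<Rightarrow> 'a measure"
  assumes "gaussian_series_kernel P K h \<kappa>" "gaussian_series_kernel P K h \<kappa>'"
    and eq: "\<And>f. f \<in> borel_measurable K \<Longrightarrow>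
      (\<integral>\<^sup>+\<omega>. gaussian_series.chaos h 0 f (\<kappa> \<omega>) \<partial>P) = (\<integral>\<^sup>+\<omega>. gaussian_series.chaos h 0 f (\<kappa>' \<omega>) \<partial>P)"
  shows "distr P (measure_algebra K) \<kappa> = distr P (measure_algebra K) \<kappa>'"
proof -
  interpret A: gaussian_series_kernel P K h \<kappa> by fact
  interpret B: gaussian_series_kernel P K h \<kappa>' by fact
  note [measurable] = A.h_measurable
  have mc: "A.mean_chaos n f = B.mean_chaos n f" if "A.admissible f" for n f
    using that
  proof (induction n arbitrary: f)
    case 0
    then show ?case unfolding A.mean_chaos_def B.mean_chaos_def by (intro eq) (simp add: A.admissible_def)
  next
    case (Suc n)
    have fm[measurable]: "f \<in> borel_measurable K" using Suc.prems by (simp add: A.admissible_def)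
    define g where "g s = A.mean_chaos (Suc n) (\<lambda>x. f x * ennreal (exp (s * h n x)))" for s
    define g' where "g' s = B.mean_chaos (Suc n) (\<lambda>x. f x * ennreal (exp (s * h n x)))" for s
    have g0: "g 0 = A.mean_chaos (Suc n) f" "g' 0 = B.mean_chaos (Suc n) f" by (simp_all add: g_def g'_def)
    have "g 0 = g' 0"
    proof (rule gauss_deconvolution)
      show "g \<in> borel_measurable borel" "g' \<in> borel_measurable borel"
        unfolding g_def g'_def by (rule A.measurable_mean_chaos_tilt[OF fm] B.measurable_mean_chaos_tilt[OF fm])+
      show "g s \<le> 1" for s unfolding g_def by (rule A.mean_chaos_le_1)
      show "(g \<longlongrightarrow> g 0) (at_right 0)" "(g' \<longlongrightarrow> g' 0) (at_right 0)"
        unfolding g0 unfolding g_def g'_def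
        by (rule A.mean_chaos_tilt_continuous[OF Suc.prems] B.mean_chaos_tilt_continuous[OF Suc.prems])+
      show "(\<integral>\<^sup>+s. g (t + s) \<partial>gauss) = (\<integral>\<^sup>+s. g' (t + s) \<partial>gauss)" for t
        unfolding g_def g'_def A.mean_chaos_step[OF fm, symmetric] B.mean_chaos_step[OF fm, symmetric]
        by (intro Suc.IH A.admissible_tilt Suc.prems)
    qed
    then show ?case by (simp add: g0)
  qed
  have ad: "(\<integral>\<^sup>+\<omega>. expn (\<integral>\<^sup>+x. f x \<partial>\<kappa> \<omega>) \<partial>P) = (\<integral>\<^sup>+\<omega>. expn (\<integral>\<^sup>+x. f x \<partial>\<kappa>' \<omega>) \<partial>P)" if "A.admissible f" for f
    using A.mean_chaos_LIMSEQ[OF that] B.mean_chaos_LIMSEQ[OF that] unfolding mc[OF that] by (rule LIMSEQ_unique)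
  show ?thesis
  proof (rule distr_measure_algebra_eqI)
    show "prob_space P" by (rule A.prob_space_axioms)
    then show "prob_space P" .
    show "\<kappa> \<in> P \<rightarrow>\<^sub>M measure_algebra K" "\<kappa>' \<in> P \<rightarrow>\<^sub>M measure_algebra K"
      by (rule A.kernel_measurable B.kernel_measurable)+
    fix l :: "'a set list" assume l: "set l \<subseteq> sets K"
    \<comment> \<open>A sum of indicators is admissible only after restriction to a sublevel set of
      the variance. These sets increase to the whole space, and \<open>expn\<close> turns the
      resulting sum of masses into the product required.\<close>
    define f :: "nat \<Rightarrow> 'a \<Rightarrow> ennreal"
      where "f n x = (\<Sum>A\<leftarrow>l. indicator A x) * indicator {x \<in> space K. A.tail_var 0 x \<le> real n} x" for n x
    have fs[measurable]: "(\<lambda>x. \<Sum>A\<leftarrow>l. indicator A x :: ennreal) \<in> borel_measurable K"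
      using l by (rule measurable_sum_list_indicator)
    have [measurable]: "f n \<in> borel_measurable K" for n unfolding f_def by measurable
    have "(\<Sum>A\<leftarrow>l. indicator A x :: ennreal) \<le> of_nat (length l)" for x
    proof (induction l)
      case (Cons A l)
      then show ?case by (auto simp: indicator_def intro: add_mono add_increasing)
    qed simp
    then have adm: "A.admissible (f n)" for n
      unfolding A.admissible_def
      by (intro conjI exI[of _ "real (length l)"] exI[of _ "real n"]) 
         (auto simp: f_def indicator_def ennreal_of_nat_eq_real_of_nat)
    have lim: "(\<lambda>n. \<integral>\<^sup>+\<omega>. expn (\<integral>\<^sup>+x. f n x \<partial>\<nu> \<omega>) \<partial>P) \<longlonglongrightarrow> (\<integral>\<^sup>+\<omega>. (\<Prod>A\<leftarrow>l. expn (emeasure (\<nu> \<omega>) A)) \<partial>P)"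
      if \<nu>: "\<nu> \<in> P \<rightarrow>\<^sub>M measure_algebra K" for \<nu>
    proof (rule nn_integral_dominated_convergence[where w="\<lambda>_. 1"])
      show "(\<lambda>\<omega>. expn (\<integral>\<^sup>+x. f n x \<partial>\<nu> \<omega>)) \<in> borel_measurable P" for n
        by (rule measurable_compose[OF measurable_compose[OF \<nu> measurable_nn_integral_measure_algebra] measurable_expn]) simp
      show "(\<lambda>\<omega>. \<Prod>A\<leftarrow>l. expn (emeasure (\<nu> \<omega>) A)) \<in> borel_measurable P"
        using l by (intro measurable_prod_list_ennreal measurable_compose[OF measurable_compose[OF \<nu> measurable_emeasure_measure_algebra] measurable_expn]) auto
      show "AE \<omega> in P. (\<lambda>n. expn (\<integral>\<^sup>+x. f n x \<partial>\<nu> \<omega>)) \<longlonglongrightarrow> (\<Prod>A\<leftarrow>l. expn (emeasure (\<nu> \<omega>) A))"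
      proof (rule AE_I2)
        fix \<omega> assume "\<omega> \<in> space P"
        then have sets[measurable_cong]: "sets (\<nu> \<omega>) = sets K"
          using measurable_space[OF \<nu>] by (simp add: space_measure_algebra)
        then have sp: "space (\<nu> \<omega>) = space K" by (rule sets_eq_imp_space_eq)
        \<comment> \<open>The convergence is asked for at all points of the type, hence the factor
          \<open>indicator (space K)\<close>, which is 1 under the integral.\<close>
        have l1: "(\<lambda>n. \<integral>\<^sup>+x. f n x * indicator (space K) x \<partial>\<nu> \<omega>) \<longlonglongrightarrow> (\<integral>\<^sup>+x. (\<Sum>A\<leftarrow>l. indicator A x) * indicator (space K) x \<partial>\<nu> \<omega>)"
        proof (rule nn_integral_LIMSEQ)
          show "incseq (\<lambda>n x. f n x * indicator (space K) x)"
            by (auto simp: incseq_def le_fun_def f_def indicator_def)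
          show "(\<lambda>x. f n x * indicator (space K) x) \<in> borel_measurable (\<nu> \<omega>)" for n by measurable
          fix x
          obtain N where "A.tail_var 0 x \<le> real N" using real_arch_simple by blast
          then have "f n x * indicator (space K) x = (\<Sum>A\<leftarrow>l. indicator A x) * indicator (space K) x" if "n \<ge> N" for n
            using that by (auto simp: f_def indicator_def)
          then show "(\<lambda>n. f n x * indicator (space K) x) \<longlonglongrightarrow> (\<Sum>A\<leftarrow>l. indicator A x) * indicator (space K) x"
            by (intro tendsto_eventually eventually_sequentiallyI)
        qed
        have l2: "(\<integral>\<^sup>+x. f n x * indicator (space K) x \<partial>\<nu> \<omega>) = (\<integral>\<^sup>+x. f n x \<partial>\<nu> \<omega>)" for n
          by (intro nn_integral_cong) (simp add: sp)
        have l3: "(\<integral>\<^sup>+x. (\<Sum>A\<leftarrow>l. indicator A x) * indicator (space K) x \<partial>\<nu> \<omega>) = (\<Sum>A\<leftarrow>l. emeasure (\<nu> \<omega>) A)"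
        proof -
          have "(\<integral>\<^sup>+x. (\<Sum>A\<leftarrow>l. indicator A x) * indicator (space K) x \<partial>\<nu> \<omega>) = (\<integral>\<^sup>+x. (\<Sum>A\<leftarrow>l. indicator A x) \<partial>\<nu> \<omega>)"
            by (intro nn_integral_cong) (simp add: sp)
          also have "\<dots> = (\<Sum>A\<leftarrow>l. emeasure (\<nu> \<omega>) A)"
            using l
          proof (induction l)
            case (Cons A l)
            then have "(\<lambda>x. \<Sum>A\<leftarrow>l. indicator A x :: ennreal) \<in> borel_measurable (\<nu> \<omega>)"
              by (intro measurable_sum_list_indicator) (simp add: sets)
            moreover have "A \<in> sets (\<nu> \<omega>)" using Cons.prems by (simp add: sets)
            ultimately show ?case using Cons by (simp add: nn_integral_add)
          qed simp
          finally show ?thesis .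
        qed
        have l4: "expn (\<Sum>A\<leftarrow>l. emeasure (\<nu> \<omega>) A) = (\<Prod>A\<leftarrow>l. expn (emeasure (\<nu> \<omega>) A))"
          by (induction l) (auto simp: expn_add)
        show "(\<lambda>n. expn (\<integral>\<^sup>+x. f n x \<partial>\<nu> \<omega>)) \<longlonglongrightarrow> (\<Prod>A\<leftarrow>l. expn (emeasure (\<nu> \<omega>) A))"
          using tendsto_expn[OF l1] by (simp only: l2 l3 l4)
      qed
    qed (auto simp: A.emeasure_space_1)
    show "(\<integral>\<^sup>+\<omega>. (\<Prod>A\<leftarrow>l. expn (emeasure (\<kappa> \<omega>) A)) \<partial>P) = (\<integral>\<^sup>+\<omega>. (\<Prod>A\<leftarrow>l. expn (emeasure (\<kappa>' \<omega>) A)) \<partial>P)"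
      using lim[OF A.kernel_measurable] lim[OF B.kernel_measurable] unfolding ad[OF adm] by (rule LIMSEQ_unique)
  qed
qed

section \<open>Gaussian fields independent of a random measure\<close>

text \<open>A preimage under \<open>g\<close> differs from one under \<open>f\<close> by a subset of
  a null set, and the completion contains all such subsets.\<close>

lemma measurable_completion_AE:
  assumes f: "f \<in> P \<rightarrow>\<^sub>M N" and eq: "AE \<omega> in P. f \<omega> = g \<omega>" and sp: "\<And>\<omega>. \<omega> \<in> space P \<Longrightarrow> g \<omega> \<in> space N"
  shows "g \<in> completion P \<rightarrow>\<^sub>M N"
proof (rule measurableI)
  obtain Z where Z: "Z \<in> null_sets P" "{\<omega> \<in> space P. f \<omega> \<noteq> g \<omega>} \<subseteq> Z"
    using AE_E[OF eq] by (metis (no_types, lifting) null_setsI)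
  fix A assume A: "A \<in> sets N"
  have "g -` A \<inter> space P = (f -` A \<inter> space P - Z) \<union> (g -` A \<inter> Z \<inter> space P)"
    using Z(2) by auto
  moreover have "f -` A \<inter> space P - Z \<in> sets P" using measurable_sets[OF f A] Z(1) by auto
  moreover have "g -` A \<inter> Z \<inter> space P \<in> null_sets (completion P)"
    by (rule null_sets_completion_subset[OF _ null_sets_completionI[OF Z(1)]]) auto
  ultimately show "g -` A \<inter> space (completion P) \<in> sets (completion P)" by auto
qed (use sp in simp)

text \<open>Replaces an infinite measure by the zero measure on the same \<sigma>-algebra. For an
  almost surely finite random measure this is a measurable modification on a null event.\<close>

definition fin_part :: "'a measure \<Rightarrow> 'a measure" where
  "fin_part \<mu> = (if emeasure \<mu> (space \<mu>) < \<infinity> then \<mu> else null_measure \<mu>)"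

lemma sets_fin_part[simp]: "sets (fin_part \<mu>) = sets \<mu>"
  by (simp add: fin_part_def)

lemma emeasure_fin_part: "emeasure (fin_part \<mu>) A = (if emeasure \<mu> (space \<mu>) < \<infinity> then emeasure \<mu> A else 0)"
  by (simp add: fin_part_def)

lemma fin_part_finite: "emeasure (fin_part \<mu>) A < \<infinity>"
  using emeasure_space[of \<mu> A] by (auto simp: emeasure_fin_part intro: le_less_trans)

lemma measurable_fin_part[measurable]: "fin_part \<in> measure_algebra K \<rightarrow>\<^sub>M measure_algebra K"
proof (rule measurable_measure_algebraI)
  fix A assume A: "A \<in> sets K"
  note [measurable] = measurable_emeasure_measure_algebra[OF A] measurable_emeasure_measure_algebra[OF sets.top[of K]]
  have "(\<lambda>\<mu>. if emeasure \<mu> (space K) < \<infinity> then emeasure \<mu> A else 0) \<in> borel_measurable (measure_algebra K)"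
    by measurable
  then show "(\<lambda>\<mu>. emeasure (fin_part \<mu>) A) \<in> borel_measurable (measure_algebra K)"
    by (rule measurable_cong[THEN iffD1, rotated])
       (auto simp: emeasure_fin_part space_measure_algebra dest: sets_eq_imp_space_eq)
qed (simp add: space_measure_algebra)

text \<open>Writing the exponential moment through the second moment covers the degenerate case and
  the case with a density by one formula.\<close>

lemma (in prob_space) centered_gaussian_props:
  assumes X: "centered_gaussian M X"
  shows "X \<in> borel_measurable M" "integrable M (\<lambda>\<omega>. (X \<omega>)\<^sup>2)" "integrable M X" "expectation X = 0"
    "(\<integral>\<^sup>+\<omega>. ennreal (exp (X \<omega>)) \<partial>M) = ennreal (exp (expectation (\<lambda>\<omega>. (X \<omega>)\<^sup>2) / 2))"
proof -
  show m[measurable]: "X \<in> borel_measurable M" using X by (simp add: centered_gaussian_def)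
  consider "AE \<omega> in M. X \<omega> = 0" | \<sigma> where "\<sigma> > 0" "distributed M lborel X (\<lambda>t. ennreal (normal_density 0 \<sigma> t))"
    using X by (auto simp: centered_gaussian_def)
  then have "integrable M (\<lambda>\<omega>. (X \<omega>)\<^sup>2) \<and> integrable M X \<and> expectation X = 0 \<and>
    (\<integral>\<^sup>+\<omega>. ennreal (exp (X \<omega>)) \<partial>M) = ennreal (exp (expectation (\<lambda>\<omega>. (X \<omega>)\<^sup>2) / 2))"
  proof cases
    case 1
    have i: "integrable M (\<lambda>\<omega>. (X \<omega>)\<^sup>2)" "integrable M X"
      by (rule integrable_cong_AE_imp[of M "\<lambda>_. 0"]; use 1 in \<open>auto elim: eventually_mono\<close>)+
    have "expectation X = expectation (\<lambda>_. 0)" "expectation (\<lambda>\<omega>. (X \<omega>)\<^sup>2) = expectation (\<lambda>_. 0)"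
      by (rule integral_cong_AE; use 1 in \<open>auto elim: eventually_mono\<close>)+
    moreover have "(\<integral>\<^sup>+\<omega>. ennreal (exp (X \<omega>)) \<partial>M) = (\<integral>\<^sup>+\<omega>. 1 \<partial>M)"
      by (rule nn_integral_cong_AE) (use 1 in \<open>auto elim: eventually_mono\<close>)
    ultimately show ?thesis using i by (simp add: emeasure_space_1)
  next
    case 2
    note D = 2(2)
    have e: "expectation X = 0" using normal_distributed_expectation[OF 2] .
    have "integrable lborel (\<lambda>x. normal_density 0 \<sigma> x * x)"
      using integrable_normal_moment_nz_1[OF 2(1)] by (simp add: mult.commute)
    then have iX: "integrable M X"
      by (subst distributed_integrable[OF D, of "\<lambda>x. x", symmetric]) auto
    have "integrable lborel (\<lambda>x. normal_density 0 \<sigma> x * x\<^sup>2)"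
      using integrable_normal_moment[OF 2(1), of 0 2] by simp
    then have iX2: "integrable M (\<lambda>\<omega>. (X \<omega>)\<^sup>2)"
      by (subst distributed_integrable[OF D, of "\<lambda>x. x\<^sup>2", symmetric]) auto
    have v: "expectation (\<lambda>\<omega>. (X \<omega>)\<^sup>2) = \<sigma>\<^sup>2"
      using normal_distributed_variance[OF 2] by (simp add: e)
    have "(\<integral>\<^sup>+\<omega>. ennreal (exp (X \<omega>)) \<partial>M) = (\<integral>\<^sup>+x. ennreal (normal_density 0 \<sigma> x) * ennreal (exp (1 * x)) \<partial>lborel)"
      by (subst distributed_nn_integral[OF D, symmetric]) auto
    also have "\<dots> = ennreal (exp (\<sigma>\<^sup>2 / 2))" by (subst nn_integral_normal_density_exp[OF 2(1)]) simp
    finally show ?thesis using e iX iX2 v by simp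
  qed
  then show "integrable M (\<lambda>\<omega>. (X \<omega>)\<^sup>2)" "integrable M X" "expectation X = 0"
    "(\<integral>\<^sup>+\<omega>. ennreal (exp (X \<omega>)) \<partial>M) = ennreal (exp (expectation (\<lambda>\<omega>. (X \<omega>)\<^sup>2) / 2))" by auto
qed

text \<open>Passes from lists, where points may repeat, to the finite sets in
  \<open>centered_gaussian_field\<close>; the coefficients of equal points are added up.\<close>

lemma lin_comb_eq_sum:
  assumes "finite F" "snd ` set l \<subseteq> F"
  shows "lin_comb Y l \<omega> = (\<Sum>x\<in>F. (\<Sum>(a, y)\<leftarrow>l. if y = x then a else 0) * Y x \<omega>)"
  using assms(2)
proof (induction l)
  case (Cons p l)
  obtain a y where p: "p = (a, y)" by (cases p)
  have "(\<Sum>x\<in>F. (if y = x then a else 0) * Y x \<omega>) = (\<Sum>x\<in>F. if y = x then a * Y x \<omega> else 0)"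
    by (intro sum.cong) auto
  also have "\<dots> = a * Y y \<omega>" using Cons.prems p assms(1) by (subst sum.delta') auto
  finally show ?case using Cons by (simp add: p sum.distrib distrib_right)
qed simp

section \<open>Comparison of a Gaussian field with its series\<close>

context gaussian_series
begin

text \<open>Both sides are bilinear: the case of two points is the covariance hypothesis, since the
  means vanish, and it is extended to lists first in the second argument and then in the
  first.\<close>

lemma gaussian_field_second_moment:
  assumes P: "prob_space P" and G: "centered_gaussian_field P (space K) \<Phi>"
    and cov: "\<And>x y. x \<in> space K \<Longrightarrow> y \<in> space K \<Longrightarrow> (\<lambda>k. h k x * h k y) sums covariance P (\<Phi> x) (\<Phi> y)"
    and l: "snd ` set l \<subseteq> space K" "snd ` set l' \<subseteq> space K"
  shows "integrable P (\<lambda>\<omega>. lin_comb \<Phi> l \<omega> * lin_comb \<Phi> l' \<omega>) \<and>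
     (\<lambda>k. coef 0 l k * coef 0 l' k) sums (LINT \<omega>|P. lin_comb \<Phi> l \<omega> * lin_comb \<Phi> l' \<omega>)"
proof -
  interpret P: prob_space P by fact
  have g: "centered_gaussian P (\<Phi> x)" if "x \<in> space K" for x
    using G[unfolded centered_gaussian_field_def, rule_format, of "{x}" "\<lambda>_. 1"] that by simp
  have base: "integrable P (\<lambda>\<omega>. \<Phi> x \<omega> * \<Phi> y \<omega>) \<and> (\<lambda>k. h k x * h k y) sums (LINT \<omega>|P. \<Phi> x \<omega> * \<Phi> y \<omega>)"
    if x: "x \<in> space K" and y: "y \<in> space K" for x y
  proof
    note gx = P.centered_gaussian_props[OF g[OF x]] and gy = P.centered_gaussian_props[OF g[OF y]]
    note [measurable] = gx(1) gy(1)
    show "integrable P (\<lambda>\<omega>. \<Phi> x \<omega> * \<Phi> y \<omega>)"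
    proof (rule Bochner_Integration.integrable_bound[OF Bochner_Integration.integrable_add[OF gx(2) gy(2)]])
      have "\<bar>u * v\<bar> \<le> u\<^sup>2 + v\<^sup>2" for u v :: real
        using zero_le_power2[of "\<bar>u\<bar> - \<bar>v\<bar>"] mult_nonneg_nonneg[OF abs_ge_zero[of u] abs_ge_zero[of v]]
        unfolding power2_diff abs_mult power2_abs by linarith
      then show "AE \<omega> in P. norm (\<Phi> x \<omega> * \<Phi> y \<omega>) \<le> norm ((\<Phi> x \<omega>)\<^sup>2 + (\<Phi> y \<omega>)\<^sup>2)"
        by simp
    qed simp
    show "(\<lambda>k. h k x * h k y) sums (LINT \<omega>|P. \<Phi> x \<omega> * \<Phi> y \<omega>)"
      using cov[OF x y] by (simp add: covariance_def gx(4) gy(4))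
  qed
  have one: "integrable P (\<lambda>\<omega>. \<Phi> x \<omega> * lin_comb \<Phi> l' \<omega>) \<and>
     (\<lambda>k. h k x * coef 0 l' k) sums (LINT \<omega>|P. \<Phi> x \<omega> * lin_comb \<Phi> l' \<omega>)"
    if x: "x \<in> space K" for x
    using l(2)
  proof (induction l')
    case (Cons p l')
    obtain b y where p: "p = (b, y)" by (cases p)
    have y: "y \<in> space K" using Cons.prems p by auto
    have sub: "snd ` set l' \<subseteq> space K" using Cons.prems by auto
    note B = base[OF x y] and IH = Cons.IH[OF sub]
    have e: "\<Phi> x \<omega> * lin_comb \<Phi> (p # l') \<omega> = b * (\<Phi> x \<omega> * \<Phi> y \<omega>) + \<Phi> x \<omega> * lin_comb \<Phi> l' \<omega>" for \<omega>
      by (simp add: p algebra_simps)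
    have e2: "h k x * coef 0 (p # l') k = b * (h k x * h k y) + h k x * coef 0 l' k" for k
      by (simp add: p algebra_simps)
    have "(\<lambda>k. b * (h k x * h k y) + h k x * coef 0 l' k) sums
        (b * (LINT \<omega>|P. \<Phi> x \<omega> * \<Phi> y \<omega>) + (LINT \<omega>|P. \<Phi> x \<omega> * lin_comb \<Phi> l' \<omega>))"
      using B IH by (intro sums_add sums_mult) auto
    then show ?case unfolding e e2 using B IH by (auto simp: Bochner_Integration.integral_add)
  qed simp
  show ?thesis
    using l(1)
  proof (induction l)
    case (Cons p l)
    obtain a x where p: "p = (a, x)" by (cases p)
    have x: "x \<in> space K" using Cons.prems p by auto
    have sub: "snd ` set l \<subseteq> space K" using Cons.prems by auto
    note B = one[OF x] and IH = Cons.IH[OF sub]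
    have e: "lin_comb \<Phi> (p # l) \<omega> * lin_comb \<Phi> l' \<omega> = a * (\<Phi> x \<omega> * lin_comb \<Phi> l' \<omega>) + lin_comb \<Phi> l \<omega> * lin_comb \<Phi> l' \<omega>" for \<omega>
      by (simp add: p algebra_simps)
    have e2: "coef 0 (p # l) k * coef 0 l' k = a * (h k x * coef 0 l' k) + coef 0 l k * coef 0 l' k" for k
      by (simp add: p algebra_simps)
    have "(\<lambda>k. a * (h k x * coef 0 l' k) + coef 0 l k * coef 0 l' k) sums
        (a * (LINT \<omega>|P. \<Phi> x \<omega> * lin_comb \<Phi> l' \<omega>) + (LINT \<omega>|P. lin_comb \<Phi> l \<omega> * lin_comb \<Phi> l' \<omega>))"
      using B IH by (intro sums_add sums_mult) auto
    then show ?case unfolding e e2 using B IH by (auto simp: Bochner_Integration.integral_add)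
  qed simp
qed

text \<open>A linear combination of values of \<open>\<Phi>\<close> is a centered Gaussian, so its
  exponential moment depends on the variance alone. The variance is the sum of the squares of
  \<open>coef 0 l k\<close>, the same number as in \<open>field_mgf\<close>.\<close>

lemma gaussian_field_same_moments:
  assumes P: "prob_space P" and G: "centered_gaussian_field P (space K) \<Phi>"
    and cov: "\<And>x y. x \<in> space K \<Longrightarrow> y \<in> space K \<Longrightarrow> (\<lambda>k. h k x * h k y) sums covariance P (\<Phi> x) (\<Phi> y)"
  shows "same_exponential_moments (space K) P \<Phi> gauss_seq (field 0)"
proof -
  interpret P: prob_space P by fact
  have g: "centered_gaussian P (lin_comb \<Phi> l)" if "snd ` set l \<subseteq> space K" for l
    using G[unfolded centered_gaussian_field_def, rule_format, of "snd ` set l" "\<lambda>x. \<Sum>(a, y)\<leftarrow>l. if y = x then a else 0"] that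
    by (subst lin_comb_eq_sum[of "snd ` set l"]) auto
  have "\<Phi> y \<in> borel_measurable P" if "y \<in> space K" for y
    using P.centered_gaussian_props(1)[OF g[of "[(1, y)]"]] that by simp
  moreover have "(\<integral>\<^sup>+\<omega>. ennreal (exp (lin_comb \<Phi> l \<omega>)) \<partial>P) = (\<integral>\<^sup>+\<omega>. ennreal (exp (lin_comb (field 0) l \<omega>)) \<partial>gauss_seq)"
    if l: "snd ` set l \<subseteq> space K" for l
    using P.centered_gaussian_props(5)[OF g[OF l]] field_mgf[OF l, of 0]
      gaussian_field_second_moment[OF P G cov l l, THEN conjunct2, THEN sums_unique]
    by (simp add: power2_eq_square)
  ultimately show ?thesis
    unfolding same_exponential_moments_def using measurable_field_at field_mgf by auto
qed

end

text \<open>The identity map into \<open>G\<close> serves as the random element that carries the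
  whole field. Independence makes the law of \<open>(\<omega>, X \<omega>)\<close> on the product of
  \<open>G\<close> and \<open>N\<close> a product measure, and Tonelli applies.\<close>

lemma (in prob_space) indep_nn_integral:
  assumes G: "subalgebra M G" and X: "X \<in> M \<rightarrow>\<^sub>M N"
    and ind: "indep_set (sets G) (sets (vimage_algebra (space M) X N))"
    and H[measurable]: "(\<lambda>(\<omega>, \<mu>). H \<omega> \<mu>) \<in> borel_measurable (G \<Otimes>\<^sub>M N)"
  shows "(\<integral>\<^sup>+\<omega>. H \<omega> (X \<omega>) \<partial>M) = (\<integral>\<^sup>+\<omega>. \<integral>\<^sup>+\<omega>'. H \<omega>' (X \<omega>) \<partial>M \<partial>M)"
proof -
  have spG: "space G = space M" and sG: "sets G \<subseteq> sets M" using G by (auto simp: subalgebra_def)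
  have id[measurable]: "(\<lambda>\<omega>. \<omega>) \<in> M \<rightarrow>\<^sub>M G" using spG sG by (auto intro!: measurableI)
  note X[measurable]
  interpret A: prob_space "distr M G (\<lambda>\<omega>. \<omega>)" by (rule prob_space_distr[OF id])
  interpret B: prob_space "distr M N X" by (rule prob_space_distr[OF X])
  interpret AB: pair_sigma_finite "distr M G (\<lambda>\<omega>. \<omega>)" "distr M N X" ..
  have D: "distr M G (\<lambda>\<omega>. \<omega>) \<Otimes>\<^sub>M distr M N X = distr M (G \<Otimes>\<^sub>M N) (\<lambda>\<omega>. (\<omega>, X \<omega>))"
  proof (rule pair_measure_eqI)
    fix A B assume "A \<in> sets (distr M G (\<lambda>\<omega>. \<omega>))" "B \<in> sets (distr M N X)"
    then have A[measurable]: "A \<in> sets G" and B[measurable]: "B \<in> sets N" by simp_all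
    have "A \<inter> space M = A" using sets.sets_into_space[OF A] spG by auto
    moreover have "(\<lambda>\<omega>. (\<omega>, X \<omega>)) -` (A \<times> B) \<inter> space M = A \<inter> (X -` B \<inter> space M)"
      using sets.sets_into_space[OF A] spG by auto
    moreover have "prob (A \<inter> (X -` B \<inter> space M)) = prob A * prob (X -` B \<inter> space M)"
      using ind A B by (intro indep_setD[OF ind]) (auto intro: in_vimage_algebra)
    ultimately show "emeasure (distr M G (\<lambda>\<omega>. \<omega>)) A * emeasure (distr M N X) B =
        emeasure (distr M (G \<Otimes>\<^sub>M N) (\<lambda>\<omega>. (\<omega>, X \<omega>))) (A \<times> B)"
      by (simp add: emeasure_distr emeasure_eq_measure flip: ennreal_mult)
  qed (simp_all add: A.sigma_finite_measure_axioms B.sigma_finite_measure_axioms cong: sets_pair_measure_cong)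
  have Hm: "(\<lambda>z. H (fst z) (snd z)) \<in> borel_measurable (G \<Otimes>\<^sub>M N)" using H by (simp add: split_beta')
  have "(\<integral>\<^sup>+\<omega>. H \<omega> (X \<omega>) \<partial>M) = (\<integral>\<^sup>+z. H (fst z) (snd z) \<partial>distr M (G \<Otimes>\<^sub>M N) (\<lambda>\<omega>. (\<omega>, X \<omega>)))"
    by (subst nn_integral_distr) (auto intro: Hm)
  also have "\<dots> = (\<integral>\<^sup>+\<mu>. \<integral>\<^sup>+\<omega>'. H \<omega>' \<mu> \<partial>distr M G (\<lambda>\<omega>. \<omega>) \<partial>distr M N X)"
    unfolding D[symmetric] by (subst AB.nn_integral_snd[symmetric]) (auto intro!: Hm)
  also have "\<dots> = (\<integral>\<^sup>+\<mu>. \<integral>\<^sup>+\<omega>'. H \<omega>' \<mu> \<partial>M \<partial>distr M N X)"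
    using measurable_Pair1[OF H] by (intro nn_integral_cong) (simp add: nn_integral_distr)
  also have "\<dots> = (\<integral>\<^sup>+\<omega>. \<integral>\<^sup>+\<omega>'. H \<omega>' (X \<omega>) \<partial>M \<partial>M)"
  proof (rule nn_integral_distr[OF X])
    have "(\<lambda>(\<mu>, \<omega>). H \<omega> \<mu>) \<in> borel_measurable (N \<Otimes>\<^sub>M M)"
      using measurable_compose[OF measurable_Pair[OF measurable_compose[OF measurable_snd id] measurable_fst] Hm]
      by (simp add: split_beta')
    then show "(\<lambda>\<mu>. \<integral>\<^sup>+\<omega>'. H \<omega>' \<mu> \<partial>M) \<in> borel_measurable (distr M N X)"
      using borel_measurable_nn_integral by simp
  qed
  finally show ?thesis .
qed

text \<open>Transfers the almost sure hypotheses to the everywhere finite kernel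
  \<open>fin_part (M \<omega>)\<close>. The last conclusion separates the randomness of the field
  from that of the measure, so that the field can be replaced for each fixed measure.\<close>

lemma field_times_measure:
  fixes D :: "'a::topological_space set"
  assumes P: "prob_space P" and M: "random_finite_measure P D M" and ind: "field_indep_measure P D \<Phi> M"
  defines "K \<equiv> borel_on D"
  shows "finite_kernel P K (\<lambda>\<omega>. fin_part (M \<omega>))"
    and "(\<lambda>(\<omega>, x). \<Phi> x \<omega>) \<in> borel_measurable (P \<Otimes>\<^sub>M K)"
    and "law_on P D M = distr P (measure_algebra K) (\<lambda>\<omega>. fin_part (M \<omega>))"
    and "f \<in> borel_measurable K \<Longrightarrow> (\<integral>\<^sup>+\<mu>. expn (\<integral>\<^sup>+x. f x \<partial>\<mu>) \<partial>law_on P D (exp_times \<Phi> M)) =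
      (\<integral>\<^sup>+\<omega>. \<integral>\<^sup>+\<omega>'. expn (\<integral>\<^sup>+x. f x * ennreal (exp (\<Phi> x \<omega>')) \<partial>fin_part (M \<omega>)) \<partial>P \<partial>P)"
proof -
  interpret P: prob_space P by fact
  have Mm[measurable]: "M \<in> P \<rightarrow>\<^sub>M measure_algebra K" and Mf: "AE \<omega> in P. finite_measure (M \<omega>)"
    using M by (auto simp: random_finite_measure_def K_def)
  obtain G where G: "subalgebra P G" and \<Phi>: "(\<lambda>(\<omega>, x). \<Phi> x \<omega>) \<in> borel_measurable (G \<Otimes>\<^sub>M K)"
    and indG: "P.indep_set (sets G) (sets (vimage_algebra (space P) M (measure_algebra K)))"
    using ind by (auto simp: field_indep_measure_def K_def)
  have \<Phi>G[measurable]: "(\<lambda>z. \<Phi> (snd z) (fst z)) \<in> borel_measurable (G \<Otimes>\<^sub>M K)"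
    using \<Phi> by (simp add: split_beta')
  have id[measurable]: "(\<lambda>\<omega>. \<omega>) \<in> P \<rightarrow>\<^sub>M G" using G by (auto intro!: measurableI simp: subalgebra_def)
  have \<Phi>P[measurable]: "(\<lambda>z. \<Phi> (snd z) (fst z)) \<in> borel_measurable (P \<Otimes>\<^sub>M K)"
    using measurable_compose[OF measurable_Pair[OF measurable_compose[OF measurable_fst id] measurable_snd] \<Phi>G] by simp
  then show "(\<lambda>(\<omega>, x). \<Phi> x \<omega>) \<in> borel_measurable (P \<Otimes>\<^sub>M K)" by (simp add: split_beta')
  define \<kappa> where "\<kappa> \<omega> = fin_part (M \<omega>)" for \<omega>
  have \<kappa>m[measurable]: "\<kappa> \<in> P \<rightarrow>\<^sub>M measure_algebra K" unfolding \<kappa>_def by measurable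
  show fk: "finite_kernel P K (\<lambda>\<omega>. fin_part (M \<omega>))"
    using \<kappa>m by unfold_locales (auto simp: \<kappa>_def[abs_def] fin_part_finite[unfolded infinity_ennreal_def])
  interpret finite_kernel P K \<kappa> using fk by (simp add: \<kappa>_def[abs_def])
  have ae: "AE \<omega> in P. \<kappa> \<omega> = M \<omega>"
    using Mf by eventually_elim (auto simp: \<kappa>_def fin_part_def less_top[symmetric] finite_measure.emeasure_finite)
  show "law_on P D M = distr P (measure_algebra K) (\<lambda>\<omega>. fin_part (M \<omega>))"
    unfolding law_on_def K_def[symmetric] \<kappa>_def[symmetric] distr_completion[OF Mm]
    using ae by (intro distr_cong_AE) (auto elim: eventually_mono)
  \<comment> \<open>A version of \<open>exp_times \<Phi> M\<close> that is measurable for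
    \<open>P\<close> itself; the latter is so far only known to agree with it almost surely, hence
    to be measurable for the completion.\<close>
  define X where "X \<omega> = density (\<kappa> \<omega>) (\<lambda>x. ennreal (exp (\<Phi> x \<omega>)))" for \<omega>
  have \<Phi>\<omega>: "(\<lambda>x. \<Phi> x \<omega>) \<in> borel_measurable K" if "\<omega> \<in> space P" for \<omega>
    using measurable_Pair2[OF \<Phi>P that] by simp
  have X: "X \<in> P \<rightarrow>\<^sub>M measure_algebra K"
  proof (rule measurable_measure_algebraI)
    show "sets (X \<omega>) = sets K" if "\<omega> \<in> space P" for \<omega> using kernel_sets[OF that] by (simp add: X_def)
    fix A assume A[measurable]: "A \<in> sets K"
    have "(\<lambda>\<omega>. \<integral>\<^sup>+x. ennreal (exp (\<Phi> x \<omega>)) * indicator A x \<partial>\<kappa> \<omega>) \<in> borel_measurable P"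
      by (rule measurable_nn_integral_kernel[OF \<kappa>m kernel_finite]) (auto simp: split_beta')
    then show "(\<lambda>\<omega>. emeasure (X \<omega>) A) \<in> borel_measurable P"
    proof (rule measurable_cong[THEN iffD1, rotated])
      fix \<omega> assume \<omega>: "\<omega> \<in> space P"
      have [measurable_cong]: "sets (\<kappa> \<omega>) = sets K" by (rule kernel_sets[OF \<omega>])
      show "(\<integral>\<^sup>+x. ennreal (exp (\<Phi> x \<omega>)) * indicator A x \<partial>\<kappa> \<omega>) = emeasure (X \<omega>) A"
        unfolding X_def using \<Phi>\<omega>[OF \<omega>] by (subst emeasure_density) auto
    qed
  qed
  have aeX: "AE \<omega> in P. X \<omega> = exp_times \<Phi> M \<omega>"
    using ae by eventually_elim (simp add: X_def exp_times_def)
  have XM: "exp_times \<Phi> M \<in> completion P \<rightarrow>\<^sub>M measure_algebra K"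
    using aeX measurable_space[OF Mm]
    by (intro measurable_completion_AE[OF X]) (auto simp: space_measure_algebra exp_times_def)
  have law: "law_on P D (exp_times \<Phi> M) = distr P (measure_algebra K) X"
    unfolding law_on_def K_def[symmetric] distr_completion[OF X, symmetric]
    using aeX by (intro distr_cong_AE XM measurable_completion[OF X]) (auto intro: AE_completion elim: eventually_mono)
  assume f[measurable]: "f \<in> borel_measurable K"
  have "(\<integral>\<^sup>+\<mu>. expn (\<integral>\<^sup>+x. f x \<partial>\<mu>) \<partial>law_on P D (exp_times \<Phi> M)) = (\<integral>\<^sup>+\<omega>. expn (\<integral>\<^sup>+x. f x \<partial>X \<omega>) \<partial>P)"
    unfolding law
    by (rule nn_integral_distr[OF X]) (simp add: measurable_compose[OF measurable_nn_integral_measure_algebra[OF f] measurable_expn])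
  also have "\<dots> = (\<integral>\<^sup>+\<omega>. expn (\<integral>\<^sup>+x. f x * ennreal (exp (\<Phi> x \<omega>)) \<partial>fin_part (M \<omega>)) \<partial>P)"
  proof (intro nn_integral_cong arg_cong[where f=expn])
    fix \<omega> assume \<omega>: "\<omega> \<in> space P"
    have [measurable_cong]: "sets (\<kappa> \<omega>) = sets K" by (rule kernel_sets[OF \<omega>])
    show "(\<integral>\<^sup>+x. f x \<partial>X \<omega>) = (\<integral>\<^sup>+x. f x * ennreal (exp (\<Phi> x \<omega>)) \<partial>fin_part (M \<omega>))"
      unfolding X_def \<kappa>_def[symmetric] using \<Phi>\<omega>[OF \<omega>]
      by (subst nn_integral_density) (auto simp: mult.commute)
  qed
  also have "\<dots> = (\<integral>\<^sup>+\<omega>. \<integral>\<^sup>+\<omega>'. expn (\<integral>\<^sup>+x. f x * ennreal (exp (\<Phi> x \<omega>')) \<partial>fin_part (M \<omega>)) \<partial>P \<partial>P)"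
  proof (rule P.indep_nn_integral[OF G Mm indG])
    have "(\<lambda>z. \<integral>\<^sup>+x. f x * ennreal (exp (\<Phi> x (fst z))) \<partial>fin_part (snd z)) \<in> borel_measurable (G \<Otimes>\<^sub>M measure_algebra K)"
    proof (rule measurable_nn_integral_kernel[where K=K])
      show "(\<lambda>z. fin_part (snd z)) \<in> G \<Otimes>\<^sub>M measure_algebra K \<rightarrow>\<^sub>M measure_algebra K" by measurable
      have "(\<lambda>z. \<Phi> (snd z) (fst (fst z))) \<in> borel_measurable ((G \<Otimes>\<^sub>M measure_algebra K) \<Otimes>\<^sub>M K)"
        using measurable_compose[OF measurable_Pair[OF measurable_compose[OF measurable_fst measurable_fst] measurable_snd] \<Phi>G] by simp
      then show "(\<lambda>(z, x). f x * ennreal (exp (\<Phi> x (fst z)))) \<in> borel_measurable ((G \<Otimes>\<^sub>M measure_algebra K) \<Otimes>\<^sub>M K)"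
        unfolding split_beta' by measurable
    qed (rule fin_part_finite)
    then show "(\<lambda>(\<omega>', \<mu>). expn (\<integral>\<^sup>+x. f x * ennreal (exp (\<Phi> x \<omega>')) \<partial>fin_part \<mu>)) \<in> borel_measurable (G \<Otimes>\<^sub>M measure_algebra K)"
      unfolding split_beta' by (rule measurable_compose[OF _ measurable_expn])
  qed
  finally show "(\<integral>\<^sup>+\<mu>. expn (\<integral>\<^sup>+x. f x \<partial>\<mu>) \<partial>law_on P D (exp_times \<Phi> M)) =
      (\<integral>\<^sup>+\<omega>. \<integral>\<^sup>+\<omega>'. expn (\<integral>\<^sup>+x. f x * ennreal (exp (\<Phi> x \<omega>')) \<partial>fin_part (M \<omega>)) \<partial>P \<partial>P)" .
qed

theorem theorem3p1:
  fixes P :: "'w measure"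
    and D :: "(real ^ 'd) set"
    and M M' :: "'w \<Rightarrow> (real ^ 'd) measure"
    and \<Phi> :: "real ^ 'd \<Rightarrow> 'w \<Rightarrow> real"
    and h :: "nat \<Rightarrow> real ^ 'd \<Rightarrow> real"
  assumes "prob_space P"
    and "open D" and "bounded D"
    and "random_finite_measure P D M"
    and "random_finite_measure P D M'"
    and "centered_gaussian_field P D \<Phi>"
    and "field_indep_measure P D \<Phi> M"
    and "field_indep_measure P D \<Phi> M'"
    and "\<And>k. h k \<in> borel_measurable (borel_on D)"
    and "\<And>k. bounded (h k ` D)"
    and "locally_uniform_limit (D \<times> D)
           (\<lambda>n (x, y). \<Sum>k<n. h k x * h k y)
           (\<lambda>(x, y). covariance P (\<Phi> x) (\<Phi> y))"
    and "law_on P D (exp_times \<Phi> M) = law_on P D (exp_times \<Phi> M')"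
  shows "law_on P D M = law_on P D M'"
proof -
  define K where "K = borel_on D"
  have spK: "space K = D" by (simp add: K_def space_restrict_space)
  have cov: "(\<lambda>k. h k x * h k y) sums covariance P (\<Phi> x) (\<Phi> y)" if "x \<in> space K" "y \<in> space K" for x y
  proof -
    have xy: "(x, y) \<in> D \<times> D" using that by (simp add: spK)
    obtain U where "(x, y) \<in> U" "uniform_limit (U \<inter> D \<times> D) (\<lambda>n (x, y). \<Sum>k<n. h k x * h k y)
        (\<lambda>(x, y). covariance P (\<Phi> x) (\<Phi> y)) sequentially"
      using assms(11) xy unfolding locally_uniform_limit_def by blast
    from tendsto_uniform_limitI[OF this(2), of "(x, y)"] this(1) xy
    show ?thesis by (simp add: sums_def)
  qed
  interpret bounded_gaussian_series K h
  proof
    show "h k \<in> borel_measurable K" for k using assms(9) by (simp add: K_def)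
    show "summable (\<lambda>k. (h k x)\<^sup>2)" if "x \<in> space K" for x
      using cov[OF that that] by (simp add: power2_eq_square sums_iff)
    show "\<exists>B. \<forall>x\<in>space K. \<bar>h k x\<bar> \<le> B" for k
      using assms(10)[of k] by (auto simp: bounded_iff spK)
  qed
  define \<kappa> where "\<kappa> \<omega> = fin_part (M \<omega>)" for \<omega>
  define \<kappa>' where "\<kappa>' \<omega> = fin_part (M' \<omega>)" for \<omega>
  note F = field_times_measure[OF assms(1,4,7), folded K_def \<kappa>_def]
  note F' = field_times_measure[OF assms(1,5,8), folded K_def \<kappa>'_def]
  interpret A: finite_kernel P K \<kappa> by (rule F(1))
  interpret B: finite_kernel P K \<kappa>' by (rule F'(1))
  have sm: "same_exponential_moments (space K) P \<Phi> gauss_seq (field 0)"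
    using assms(6) cov by (intro gaussian_field_same_moments A.prob_space_axioms) (simp_all add: spK)
  \<comment> \<open>With the measure frozen, only the exponential moments of the field matter, so
    \<open>\<Phi>\<close> may be exchanged for the series on another probability space.\<close>
  have chaos: "(\<integral>\<^sup>+\<omega>'. expn (\<integral>\<^sup>+x. f x * ennreal (exp (\<Phi> x \<omega>')) \<partial>\<mu>) \<partial>P) = chaos 0 f \<mu>"
    if "f \<in> borel_measurable K" "finite_measure \<mu>" "sets \<mu> = sets K" for f :: "real ^ 'd \<Rightarrow> ennreal" and \<mu>
    unfolding chaos_def
    by (rule expn_integral_exp_eq[OF sm A.prob_space_axioms prob_space_gauss_seq that(2,3) F(2) measurable_field that(1)])
  have "distr P (measure_algebra K) \<kappa> = distr P (measure_algebra K) \<kappa>'"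
  proof (rule distr_kernel_eq)
    show "gaussian_series_kernel P K h \<kappa>" "gaussian_series_kernel P K h \<kappa>'" by unfold_locales
    fix f :: "real ^ 'd \<Rightarrow> ennreal" assume f: "f \<in> borel_measurable K"
    \<comment> \<open>The equality of the product laws is used through their Laplace functionals,
      which are the mean chaos at \<open>n = 0\<close>.\<close>
    have "(\<integral>\<^sup>+\<omega>. chaos 0 f (\<kappa> \<omega>) \<partial>P) = (\<integral>\<^sup>+\<mu>. expn (\<integral>\<^sup>+x. f x \<partial>\<mu>) \<partial>law_on P D (exp_times \<Phi> M))"
      unfolding F(4)[OF f]
      by (intro nn_integral_cong chaos[symmetric] f A.kernel_finite_measure A.kernel_sets)
    also have "\<dots> = (\<integral>\<^sup>+\<omega>. chaos 0 f (\<kappa>' \<omega>) \<partial>P)"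
      unfolding assms(12) F'(4)[OF f]
      by (intro nn_integral_cong chaos f B.kernel_finite_measure B.kernel_sets)
    finally show "(\<integral>\<^sup>+\<omega>. chaos 0 f (\<kappa> \<omega>) \<partial>P) = (\<integral>\<^sup>+\<omega>. chaos 0 f (\<kappa>' \<omega>) \<partial>P)" .
  qed
  then show ?thesis using F(3) F'(3) by simp
qed

end
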